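(* Fix an integer $k\ge2$. As $m\geq k$ varies, the Betti numbers of the discriminantal arrangements $\mathcal{A}(k,m)$ and $\mathcal{B}(k,m)$ are polynomials in $m$. More precisely, for each $0\le i\le k-1$, the $i$-th Betti number $b_i(\mathcal{A}(k,m))$ is a polynomial in $m$ of degree $i(k-1)$, and $b_i(\mathcal{B}(k,m))$ is a polynomial in $m$ of degree $i(k-1)$. Moreover, the number of bounded regions of $\mathcal{A}(k,m)$ is given by a polynomial in $m$ of degree $(k-1)^2$, and the same holds for the number of bounded regions of $\mathcal{B}(k,m)$.
   Context: For a finite arrangement $\mathcal{A}$ of affine hyperplanes in $\mathbb{R}^d$, let $L(\mathcal{A})$ be its intersection poset: the nonempty intersections of hyperplanes (including $\mathbb{R}^d$ itself), ordered by reverse inclusion. With $\mu(F)=\mu(\mathbb{R}^d,F)$ the Möbius function of $L(\mathcal{A})$, the characteristic polynomial is $\chi_{\mathcal{A}}(t)=\sum_{F\in L(\mathcal{A})}\mu(F)\,t^{d-\mathrm{codim}(F)}=\sum_{i=0}^d(-1)^i b_i(\mathcal{A})\,t^{d-i}$; the nonnegative integers $b_i(\mathcal{A})$ are the Betti numbers of $\mathcal{A}$. The regions of $\mathcal{A}$ are the connected components of the complement of the hyperplanes in $\mathbb{R}^d$. $\mathcal{A}(k,m)$: the arrangement in $\mathbb{R}^{k-1}$ of the $\binom{m}{k-1}$ affine hyperplanes spanned by the $(k-1)$-subsets of a very generic set of $m$ points in $\mathbb{R}^{k-1}$. $\mathcal{B}(k,m)$: let $M_{k,m}$ be the $k\times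 m$ matrix whose $j$-th column for $1\le j\le k$ has the single nonzero entry $(-1)^j$ in row $k+1-j$, whose column $k+1$ (if $m\ge k+1$) is $(1,\dots,1)^T$, and whose column $k+1+j$, for $1\le j\le m-k-1$, is $(1,x_{1,j},\dots,x_{k-1,j})^T$ with very generic real $x_{i,j}$. Let $\widetilde{\mathcal{B}}(k,m)$ be the central arrangement in $\mathbb{R}^k$ of the $\binom{m}{k-1}$ linear hyperplanes spanned by $k-1$ of the columns. $\mathcal{B}(k,m)$ is the restriction of $\widetilde{\mathcal{B}}(k,m)$ to the affine hyperplane $\{x_1=1\}\simeq\mathbb{R}^{k-1}$; it has $\binom{m}{k-1}-1$ hyperplanes, as the hyperplane $\{x_1=0\}$ of $\widetilde{\mathcal{B}}(k,m)$ goes to infinity. Very generic: the parameters (coordinates of the points, respectively the $x_{i,j}$) are such that every minor (of any size) of the matrix of coefficients of the equations of the spanned hyperplanes (and, in the affine case, also of the matrix of their linear parts) that is not identically zero as a polynomial in the parameters is nonzero. All very generic choices yield combinatorially equivalent arrangements, so $b_i$ and the number of bounded regions depend only on $k$ and $m$. *)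

theory Defs
  imports
    "HOL-Analysis.Analysis"
    "HOL-Computational_Algebra.Polynomial"
    "HOL-Library.Option_ord"
    "Jordan_Normal_Form.Determinant"
begin

no_notation Matrix.vec_index (infixl "$" 100)

subsection \<open>Arrangements of affine hyperplanes\<close>

definition intersection_poset :: "'a set set \<Rightarrow> 'a set set" where
  "intersection_poset \<A> = {F. (\<exists>\<B>\<subseteq>\<A>. F = \<Inter>\<B>) \<and> F \<noteq> {}}"

text \<open>
  The Moebius function of a finite family of sets ordered by \<^emph>\<open>reverse\<close> inclusion, so the
  interval from \<open>E\<close> to \<open>F\<close> consists of the members \<open>G\<close> with \<open>F \<subseteq> G \<subseteq> E\<close>.
\<close>

function moebius :: "'a set set \<Rightarrow> 'a set \<Rightarrow> 'a set \<Rightarrow> int" where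
  "moebius L E F =
    (if finite L \<and> E \<in> L \<and> F \<in> L \<and> F \<subseteq> E
     then if F = E then 1 else - (\<Sum>G | G \<in> L \<and> F \<subset> G \<and> G \<subseteq> E. moebius L E G)
     else 0)"
  by auto
termination
proof (relation "Wellfounded.measure (\<lambda>(L, E, F). card {G \<in> L. F \<subset> G})", goal_cases)
  case (2 L E F G)
  then have "{H \<in> L. G \<subset> H} \<subset> {H \<in> L. F \<subset> H}" "finite {H \<in> L. F \<subset> H}"
    by auto
  then show ?case
    by (simp add: psubset_card_mono)
qed simp

declare moebius.simps [simp del]

definition characteristic_polynomial :: "'a::euclidean_space set set \<Rightarrow> int poly" where
  "characteristic_polynomial \<A> =
    (\<Sum>F\<in>intersection_poset \<A>.
      Polynomial.monom (moebius (intersection_poset \<A>) UNIV F) (nat (aff_dim F)))"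

definition betti :: "'a::euclidean_space set set \<Rightarrow> nat \<Rightarrow> int" where
  "betti \<A> i = (-1) ^ i * Polynomial.coeff (characteristic_polynomial \<A>) (DIM('a) - i)"

definition regions :: "'a::euclidean_space set set \<Rightarrow> 'a set set" where
  "regions \<A> = components (- \<Union>\<A>)"

definition bounded_regions :: "'a::euclidean_space set set \<Rightarrow> 'a set set" where
  "bounded_regions \<A> = {R \<in> regions \<A>. bounded R}"

subsection \<open>Coordinates\<close>

text \<open>
  The rows \<open>1, \<dots>, k\<close> of a vector in \<open>real ^ 'r\<close>, \<open>k = CARD('r)\<close>, are numbered by the order of
  \<open>'r\<close>. The space \<open>real ^ 'n option\<close> plays the role of the space one dimension above
  \<open>real ^ 'n\<close>; as \<open>None\<close> is least, it is the first row.
\<close>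

definition row_number :: "'r::{finite,linorder} \<Rightarrow> nat" where
  "row_number r = card {s. s \<le> r}"

definition homogenize :: "real ^ 'n \<Rightarrow> real ^ 'n option" where
  "homogenize y = (\<chi> r. case r of None \<Rightarrow> 1 | Some i \<Rightarrow> y $ i)"

subsection \<open>Very generic parameters\<close>

definition minor :: "('a \<Rightarrow> 'b \<Rightarrow> real) \<Rightarrow> 'a list \<Rightarrow> 'b list \<Rightarrow> real" where
  "minor C rs cs =
    Determinant.det (Matrix.mat (length rs) (length cs) (\<lambda>(a, b). C (rs ! a) (cs ! b)))"

definition index_sets :: "nat \<Rightarrow> nat \<Rightarrow> nat set set" where
  "index_sets k m = {S. S \<subseteq> {1..m} \<and> card S = k - 1}"

text \<open>
  The coefficient of \<open>x\<^sub>r\<close> in the equation \<open>det (x, v\<^sub>j\<^sub>1, \<dots>, v\<^sub>j\<^sub>l) = 0\<close> of the linear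
  hyperplane spanned by the \<open>v\<^sub>j\<close>, \<open>j \<in> S = {j\<^sub>1 < \<dots> < j\<^sub>l}\<close>, where \<open>l = CARD('r) - 1\<close>:
  the cofactor of the first column. For \<open>v\<^sub>j = homogenize (P j)\<close> this is also the equation of
  the affine hyperplane spanned by the points \<open>P j\<close>, with \<open>r = None\<close> giving the constant term.
\<close>

definition hyperplane_coeff ::
    "(nat \<Rightarrow> real ^ 'r::{finite,linorder}) \<Rightarrow> nat set \<Rightarrow> 'r \<Rightarrow> real" where
  "hyperplane_coeff v S r =
    (-1) ^ (row_number r + 1) *
    minor (\<lambda>s j. v j $ s) (sorted_list_of_set (UNIV - {r})) (sorted_list_of_set S)"

text \<open>
  \<open>V\<close> sends a choice \<open>z\<close> of parameters to the spanning vectors, which depend on it polynomially;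
  a polynomial over the reals is identically zero iff it vanishes at every choice of parameters.
  The matrix of linear parts (the coefficients with \<open>r \<noteq> None\<close>) is formed by some
  of the columns of the coefficient matrix, so its minors are covered as well.
\<close>

definition very_generic ::
    "('p \<Rightarrow> nat \<Rightarrow> real ^ 'r::{finite,linorder}) \<Rightarrow> nat \<Rightarrow> 'p \<Rightarrow> bool" where
  "very_generic V m z \<longleftrightarrow>
    (\<forall>Ss rs. set Ss \<subseteq> index_sets CARD('r) m \<and> distinct Ss \<and> distinct rs \<and> length Ss = length rs \<and>
      (\<exists>z'. minor (hyperplane_coeff (V z')) Ss rs \<noteq> 0) \<longrightarrow>
      minor (hyperplane_coeff (V z)) Ss rs \<noteq> 0)"

subsection \<open>The two families of discriminantal arrangements\<close>

definition homogeneous_points :: "(nat \<Rightarrow> real ^ 'n) \<Rightarrow> nat \<Rightarrow> real ^ 'n option" where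
  "homogeneous_points P j = homogenize (P j)"

definition arrangement_A :: "nat \<Rightarrow> (nat \<Rightarrow> real ^ 'n) \<Rightarrow> (real ^ 'n) set set" where
  "arrangement_A m P = (\<lambda>S. affine hull (P ` S)) ` index_sets (CARD('n) + 1) m"

definition matrix_column :: "(nat \<Rightarrow> nat \<Rightarrow> real) \<Rightarrow> nat \<Rightarrow> real ^ 'r::{finite,linorder}" where
  "matrix_column x j =
    (\<chi> r. if j \<le> CARD('r) then (if row_number r = CARD('r) + 1 - j then (-1) ^ j else 0)
         else if j = CARD('r) + 1 then 1
         else if row_number r = 1 then 1
         else x (row_number r - 1) (j - (CARD('r) + 1)))"

definition central_arrangement_B ::
    "nat \<Rightarrow> (nat \<Rightarrow> nat \<Rightarrow> real) \<Rightarrow> (real ^ 'r::{finite,linorder}) set set" where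
  "central_arrangement_B m x = (\<lambda>S. span (matrix_column x ` S)) ` index_sets CARD('r) m"

text \<open>
  Restriction to the affine hyperplane where the first coordinate is 1, identified with
  \<open>real ^ 'n\<close> by \<^const>\<open>homogenize\<close>; a hyperplane at infinity leaves an empty trace.
\<close>

definition arrangement_B ::
    "nat \<Rightarrow> (nat \<Rightarrow> nat \<Rightarrow> real) \<Rightarrow> (real ^ 'n::{finite,linorder}) set set" where
  "arrangement_B m x = (\<lambda>H. homogenize -` H) ` central_arrangement_B m x - {{}}"

end

theory Submission
  imports Defs
begin

text \<open>
  Both arrangements come from the central arrangement of all hyperplanes spanned by \<open>d = k - 1\<close> of
  \<open>m\<close> generic vectors in \<open>\<real>\<^sup>k\<close>: \<open>\<A>(k,m)\<close> is a generic affine section of it,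
  and \<open>\<B>(k,m)\<close> is its section parallel to one of its own hyperplanes.

  By Philip Hall's theorem, the sum of the Moebius function over the flats of codimension \<open>i\<close> is a
  signed count of chains of flats. A flat \<open>X\<close> spanned using only points of \<open>T\<close> does not change
  when a point \<open>j \<notin> T\<close> moves; so if \<open>X\<close> lies in the span of \<open>v\<^sub>j\<close> and other points, it already lies in
  the span of the others. Hence every chain has a least set of points over which it is defined, its
  support, and the signed number of chains with support \<open>R\<close> depends only on \<open>\<bar>R\<bar>\<close>. A chain
  down to codimension \<open>i\<close> is cut out by \<open>i\<close> hyperplanes, so \<open>\<bar>R\<bar> \<le> i d\<close>, and the count is
  \<open>\<Sum>s\<le>i d. g s (m choose s)\<close>. For \<open>\<bar>R\<bar> = i d\<close> and \<open>i \<le> d\<close> the hyperplanes are disjoint, the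
  interval above their intersection is Boolean, and \<open>g (i d)\<close> is \<open>(-1)\<^sup>i\<close> times the number of
  partitions of an \<open>i d\<close>-set into \<open>d\<close>-sets.

  Bounded regions are counted by Zaslavsky's theorem. It follows by applying an Euler
  characteristic with value 1 on affine flats, \<open>(-1)\<^sup>d\<close> on bounded open polyhedra and 0 on unbounded
  line-free ones to the identity that expresses the indicator function of the complement through
  those of the flats.
\<close>

no_notation Matrix.scalar_prod (infix "\<bullet>" 70)

subsection \<open>Moebius functions\<close>

text \<open>Even for generic vectors the spanned hyperplanes are far from generic: many of them
  share a common vector, and the poset of flats has no simple description. What replaces one is
  uniformity: dimensions and inclusions of flats agree for any two configurations of maximal rank,
  so counts of chains can be compared without being computed. Only the largest support size is
  evaluated, as it gives the leading coefficient.

  Very genericity concerns minors within a family of restricted shape: homogenized points, or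
  matrices with a prescribed frame. It becomes maximality of rank among all choices of vectors
  because a small perturbation, a linear map and a rescaling bring any configuration into such a
  shape without losing independence of normals. Both families therefore share the polynomials
  \<open>q i\<close> of the central arrangement. Up to sign, the Betti numbers are
  \<open>q i\<close> for A, since flats of positive dimension do not lie at infinity, and
  \<open>q 0 + ... + q i\<close> for B, from division by \<open>t - 1\<close>. The degrees
  \<open>i * d\<close> increase strictly, so nothing cancels in top degree.\<close>

lemma moebius_sum_above:
  assumes "finite L" "UNIV \<in> L" "F \<in> L"
  shows "(\<Sum>G | G \<in> L \<and> F \<subseteq> G. moebius L UNIV G) = (if F = UNIV then 1 else 0)"
proof (cases "F = UNIV")
  case True
  have "{G. G \<in> L \<and> F \<subseteq> G} = {UNIV}" using True assms by auto
  then show ?thesis using True assms by (simp add: moebius.simps[of L UNIV UNIV])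
next
  case False
  have *: "{G. G \<in> L \<and> F \<subseteq> G} = insert F {G. G \<in> L \<and> F \<subset> G \<and> G \<subseteq> UNIV}"
    using assms by auto
  have "moebius L UNIV F = - (\<Sum>G | G \<in> L \<and> F \<subset> G \<and> G \<subseteq> UNIV. moebius L UNIV G)"
    using False assms by (subst moebius.simps) auto
  then show ?thesis using False assms unfolding * by (subst sum.insert) auto
qed

lemma strict_upper_induct [consumes 2, case_names step]:
  fixes F :: "'a set"
  assumes "finite L" "F \<in> L"
    and step: "\<And>F. F \<in> L \<Longrightarrow> (\<And>G. G \<in> L \<Longrightarrow> F \<subset> G \<Longrightarrow> P G) \<Longrightarrow> P F"
  shows "P F"
  using assms(2)
proof (induction "card {G \<in> L. F \<subset> G}" arbitrary: F rule: less_induct)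
  case less
  show ?case
  proof (rule step[OF less.prems])
    fix G assume G: "G \<in> L" "F \<subset> G"
    have "{H \<in> L. G \<subset> H} \<subset> {H \<in> L. F \<subset> H}" using G by blast
    then have "card {H \<in> L. G \<subset> H} < card {H \<in> L. F \<subset> H}"
      using assms(1) by (intro psubset_card_mono) auto
    then show "P G" using less.hyps G by blast
  qed
qed

text \<open>The recursion expresses the value at \<open>F\<close> by those at larger members, so the
  equations on an upward closed \<open>U\<close> already determine the function there. This admits a
  candidate \<open>f\<close> that is correct only on part of \<open>L\<close>: above a single flat,
  or away from infinity.\<close>

lemma moebius_unique:
  assumes "finite L" "UNIV \<in> L" "U \<subseteq> L"
    and up: "\<And>F G. F \<in> U \<Longrightarrow> G \<in> L \<Longrightarrow> F \<subseteq> G \<Longrightarrow> G \<in> U"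
    and f: "\<And>F. F \<in> U \<Longrightarrow> (\<Sum>G | G \<in> L \<and> F \<subseteq> G. f G) = (if F = UNIV then 1 else 0)"
    and "F \<in> U"
  shows "moebius L UNIV F = f F"
proof -
  have "F \<in> L" using assms by blast
  with \<open>finite L\<close> have "F \<in> U \<longrightarrow> moebius L UNIV F = f F"
  proof (induction rule: strict_upper_induct)
    case (step F)
    show ?case
    proof
      assume F: "F \<in> U"
      have *: "{G. G \<in> L \<and> F \<subseteq> G} = insert F {G. G \<in> L \<and> F \<subset> G}"
        using step.hyps by auto
      have "(\<Sum>G | G \<in> L \<and> F \<subseteq> G. moebius L UNIV G) = (\<Sum>G | G \<in> L \<and> F \<subseteq> G. f G)"
        using moebius_sum_above[OF assms(1,2) step.hyps] f[OF F] by simp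
      moreover have "(\<Sum>G | G \<in> L \<and> F \<subset> G. moebius L UNIV G) = (\<Sum>G | G \<in> L \<and> F \<subset> G. f G)"
        using step.IH up[OF F] by (intro sum.cong) auto
      ultimately show "moebius L UNIV F = f F"
        unfolding * using assms(1) by (simp add: sum.insert_if)
    qed
  qed
  then show ?thesis using assms by blast
qed

text \<open>Pulled back along \<open>\<phi>\<close>, the Moebius function of \<open>L'\<close>
  satisfies the equations that characterize the one of \<open>L\<close> on \<open>U\<close>. The
  bijection starts from an upward closed part only, because flats at infinity have no counterpart in
  the affine arrangement.\<close>

lemma moebius_iso:
  fixes L :: "'a set set" and L' :: "'b set set"
  assumes fin: "finite L" "finite L'" and top: "UNIV \<in> L" "UNIV \<in> L'"
    and UL: "U \<subseteq> L" and bij: "bij_betw \<phi> U L'"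
    and up: "\<And>F G. F \<in> U \<Longrightarrow> G \<in> L \<Longrightarrow> F \<subseteq> G \<Longrightarrow> G \<in> U"
    and mono: "\<And>F G. F \<in> U \<Longrightarrow> G \<in> U \<Longrightarrow> \<phi> F \<subseteq> \<phi> G \<longleftrightarrow> F \<subseteq> G"
    and "\<phi> UNIV = UNIV" and "F \<in> U"
  shows "moebius L' UNIV (\<phi> F) = moebius L UNIV F"
proof (rule sym, rule moebius_unique[OF fin(1) top(1) UL up, where f = "\<lambda>F. moebius L' UNIV (\<phi> F)"])
  fix F assume F: "F \<in> U"
  have UU: "UNIV \<in> U" using up[OF F top(1)] by simp
  have F': "\<phi> F \<in> L'" using bij F by (auto simp: bij_betw_def)
  have *: "{G. G \<in> L \<and> F \<subseteq> G} \<subseteq> U" using up[OF F] by auto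
  have "(\<Sum>G | G \<in> L \<and> F \<subseteq> G. moebius L' UNIV (\<phi> G)) = (\<Sum>G | G \<in> L' \<and> \<phi> F \<subseteq> G. moebius L' UNIV G)"
  proof (rule sum.reindex_bij_betw)
    have "\<phi> ` {G. G \<in> L \<and> F \<subseteq> G} = {G. G \<in> L' \<and> \<phi> F \<subseteq> G}"
    proof (intro equalityI subsetI)
      fix Y assume "Y \<in> \<phi> ` {G. G \<in> L \<and> F \<subseteq> G}"
      then obtain X where X: "X \<in> U" "F \<subseteq> X" "Y = \<phi> X" using * by auto
      moreover have "\<phi> X \<in> L'" using bij X(1) by (auto simp: bij_betw_def)
      ultimately show "Y \<in> {G. G \<in> L' \<and> \<phi> F \<subseteq> G}" using mono[OF F X(1)] by simp
    next
      fix Y assume Y: "Y \<in> {G. G \<in> L' \<and> \<phi> F \<subseteq> G}"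
      then obtain X where "X \<in> U" "Y = \<phi> X" using bij by (auto simp: bij_betw_def)
      then show "Y \<in> \<phi> ` {G. G \<in> L \<and> F \<subseteq> G}" using Y mono F UL by blast
    qed
    then show "bij_betw \<phi> {G. G \<in> L \<and> F \<subseteq> G} {G. G \<in> L' \<and> \<phi> F \<subseteq> G}"
      using bij_betw_subset[OF bij *] by simp
  qed
  also have "\<dots> = (if F = UNIV then 1 else 0)"
    using moebius_sum_above[OF fin(2) top(2) F'] mono[OF UU F] \<open>\<phi> UNIV = UNIV\<close> by auto
  finally show "(\<Sum>G | G \<in> L \<and> F \<subseteq> G. moebius L' UNIV (\<phi> G)) = (if F = UNIV then 1 else 0)" .
qed (use assms in auto)

section \<open>Philip Hall's theorem: Moebius values as signed counts of chains\<close>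

definition chains_to :: "'a set set \<Rightarrow> 'a set \<Rightarrow> 'a set set set" where
  "chains_to L F = {C. C \<subseteq> L \<and> UNIV \<in> C \<and> F \<in> C \<and> (\<forall>X\<in>C. F \<subseteq> X) \<and>
    (\<forall>X\<in>C. \<forall>Y\<in>C. X \<subseteq> Y \<or> Y \<subseteq> X)}"

lemma finite_chain_has_least:
  assumes "finite C" "C \<noteq> {}" "\<forall>X\<in>C. \<forall>Y\<in>C. X \<subseteq> Y \<or> Y \<subseteq> (X::'a set)"
  obtains F where "F \<in> C" "\<forall>X\<in>C. F \<subseteq> X"
  using finite_has_minimal[OF assms(1,2)] assms(3) by (metis subset_antisym)

text \<open>Deleting \<open>F\<close> turns the chains down to \<open>F\<close> bijectively into the
  chains down to some strictly larger \<open>G\<close> and flips the sign, which is the recursion of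
  the Moebius function. A chain contains both of its ends and has \<open>card C - 1\<close> steps;
  the exponent \<open>card C + 1\<close> has the same parity.\<close>

lemma moebius_eq_chain_sum:
  assumes fin: "finite L" and "UNIV \<in> L" "F \<in> L"
  shows "moebius L UNIV F = (\<Sum>C\<in>chains_to L F. (-1) ^ (card C + 1))"
proof (rule moebius_unique[OF assms(1,2) subset_refl])
  fix F assume F: "F \<in> L"
  have fin_ch: "finite (chains_to L G)" for G
    by (rule finite_subset[of _ "Pow L"]) (use fin in \<open>auto simp: chains_to_def\<close>)
  let ?f = "\<lambda>F. \<Sum>C\<in>chains_to L F. (-1::int) ^ (card C + 1)"
  have eq: "{G. G \<in> L \<and> F \<subseteq> G} = insert F {G. G \<in> L \<and> F \<subset> G}"
    using F by auto
  show "(\<Sum>G | G \<in> L \<and> F \<subseteq> G. ?f G) = (if F = UNIV then 1 else 0)"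
  proof (cases "F = UNIV")
    case True
    have "{G. G \<in> L \<and> F \<subseteq> G} = {UNIV}" using True F by auto
    moreover have "chains_to L UNIV = {{UNIV}}"
      using \<open>UNIV \<in> L\<close> unfolding chains_to_def by auto
    ultimately show ?thesis using True by simp
  next
    case False
    have "?f F = (\<Sum>C\<in>(\<Union>G\<in>{G. G \<in> L \<and> F \<subset> G}. chains_to L G). - ((-1) ^ (card C + 1)))"
    proof (rule sum.reindex_bij_witness[of _ "insert F" "\<lambda>C. C - {F}"])
      fix C assume C: "C \<in> chains_to L F"
      then have CL: "C \<subseteq> L" "UNIV \<in> C" "F \<in> C" "\<forall>X\<in>C. F \<subseteq> X" "\<forall>X\<in>C. \<forall>Y\<in>C. X \<subseteq> Y \<or> Y \<subseteq> X"
        by (auto simp: chains_to_def)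
      have finC: "finite C" using finite_subset[OF CL(1) fin] .
      show "insert F (C - {F}) = C" using CL by auto
      have "finite (C - {F})" "UNIV \<in> C - {F}" "\<forall>X\<in>C-{F}. \<forall>Y\<in>C-{F}. X \<subseteq> Y \<or> Y \<subseteq> X"
        using finC CL False by auto
      then obtain G where G: "G \<in> C - {F}" "\<forall>X\<in>C-{F}. G \<subseteq> X"
        using finite_chain_has_least[of "C - {F}"] by blast
      have "C - {F} \<in> chains_to L G" using G CL False by (auto simp: chains_to_def)
      moreover have "G \<in> L" "F \<subset> G" using G CL by auto
      ultimately show "C - {F} \<in> (\<Union>G\<in>{G. G \<in> L \<and> F \<subset> G}. chains_to L G)" by blast
      have "card C = Suc (card (C - {F}))" using card_Suc_Diff1[OF finC CL(3)] by simp
      then show "- ((-1::int) ^ (card (C - {F}) + 1)) = (-1) ^ (card C + 1)" by simp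
    next
      fix C assume "C \<in> (\<Union>G\<in>{G. G \<in> L \<and> F \<subset> G}. chains_to L G)"
      then obtain G where G: "G \<in> L" "F \<subset> G" "C \<in> chains_to L G" by blast
      then have "\<forall>X\<in>C. F \<subseteq> X" unfolding chains_to_def by blast
      then show "insert F C \<in> chains_to L F" using F G(3) unfolding chains_to_def by simp
      show "insert F C - {F} = C" using G by (auto simp: chains_to_def)
    qed
    also have "\<dots> = (\<Sum>G\<in>{G. G \<in> L \<and> F \<subset> G}. \<Sum>C\<in>chains_to L G. - ((-1) ^ (card C + 1)))"
    proof (rule sum.UNION_disjoint)
      show "\<forall>i\<in>{G. G \<in> L \<and> F \<subset> G}. \<forall>j\<in>{G. G \<in> L \<and> F \<subset> G}. i \<noteq> j \<longrightarrow> chains_to L i \<inter> chains_to L j = {}"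
        by (auto simp: chains_to_def)
    qed (use fin fin_ch in auto)
    also have "\<dots> = - (\<Sum>G | G \<in> L \<and> F \<subset> G. ?f G)"
      by (simp only: sum_negf)
    finally show ?thesis using False fin unfolding eq by (subst sum.insert) auto
  qed
qed (use assms in auto)

text \<open>Weisner's theorem for the meet with a fixed member.\<close>

lemma moebius_sum_meet_eq:
  assumes fin: "finite L" and "UNIV \<in> L" and "A \<noteq> UNIV"
    and meet: "\<And>X. X \<in> L \<Longrightarrow> X \<inter> A \<in> L"
    and "F \<in> L" "F \<subseteq> A"
  shows "(\<Sum>X | X \<in> L \<and> X \<inter> A = F. moebius L UNIV X) = 0"
proof -
  have "F \<subseteq> A \<longrightarrow> (\<Sum>X | X \<in> L \<and> X \<inter> A = F. moebius L UNIV X) = 0"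
    using fin \<open>F \<in> L\<close>
  proof (induction rule: strict_upper_induct)
    case (step F)
    show ?case
    proof
      assume FA: "F \<subseteq> A"
      let ?Y = "{Y \<in> L. F \<subseteq> Y \<and> Y \<subseteq> A}"
      have "0 = (\<Sum>G | G \<in> L \<and> F \<subseteq> G. moebius L UNIV G)"
        using moebius_sum_above[OF fin \<open>UNIV \<in> L\<close> step.hyps] FA \<open>A \<noteq> UNIV\<close> by auto
      \<comment> \<open>The members above \<open>F\<close> are grouped by their meet with
        \<open>A\<close>; by induction every class vanishes except the one whose meet is
        \<open>F\<close> itself.\<close>
      also have "{G. G \<in> L \<and> F \<subseteq> G} = (\<Union>Y\<in>?Y. {X. X \<in> L \<and> X \<inter> A = Y})"
        using meet FA by auto
      also have "(\<Sum>G\<in>\<dots>. moebius L UNIV G) = (\<Sum>Y\<in>?Y. \<Sum>X | X \<in> L \<and> X \<inter> A = Y. moebius L UNIV X)"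
        by (rule sum.UNION_disjoint) (use fin in auto)
      also have "\<dots> = (\<Sum>Y\<in>{F}. \<Sum>X | X \<in> L \<and> X \<inter> A = Y. moebius L UNIV X)"
        by (rule sum.mono_neutral_right) (use fin step FA in auto)
      finally show "(\<Sum>X | X \<in> L \<and> X \<inter> A = F. moebius L UNIV X) = 0" by simp
    qed
  qed
  then show ?thesis using assms by blast
qed

text \<open>In the vanishing sum over all \<open>X\<close> with \<open>X \<inter> A = F\<close>, the
  member \<open>F\<close> is the only one below \<open>A\<close>, so its value is minus the sum over
  the others, all of rank one higher. Summed over \<open>n\<close>, this says that the
  characteristic polynomial of a central arrangement is divisible by \<open>t - 1\<close>,
  coefficient by coefficient.\<close>

lemma moebius_sum_below_coatom:
  fixes r :: "'a set \<Rightarrow> nat"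
  assumes fin: "finite L" and "UNIV \<in> L" and "A \<noteq> UNIV"
    and meet: "\<And>X. X \<in> L \<Longrightarrow> X \<inter> A \<in> L"
    and rank: "\<And>X. X \<in> L \<Longrightarrow> \<not> X \<subseteq> A \<Longrightarrow> r X = Suc (r (X \<inter> A))"
  shows "(\<Sum>F | F \<in> L \<and> r F = n \<and> F \<subseteq> A. moebius L UNIV F) =
    - (\<Sum>X | X \<in> L \<and> r X = Suc n \<and> \<not> X \<subseteq> A. moebius L UNIV X)"
proof -
  let ?S = "{F \<in> L. r F = n \<and> F \<subseteq> A}"
  have "moebius L UNIV F = - (\<Sum>X | X \<in> L \<and> X \<inter> A = F \<and> \<not> X \<subseteq> A. moebius L UNIV X)" if "F \<in> ?S" for F
  proof -
    have "{X. X \<in> L \<and> X \<inter> A = F} = insert F {X. X \<in> L \<and> X \<inter> A = F \<and> \<not> X \<subseteq> A}"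
      using that by auto
    moreover have "(\<Sum>X | X \<in> L \<and> X \<inter> A = F. moebius L UNIV X) = 0"
      using that by (intro moebius_sum_meet_eq assms) auto
    moreover have "F \<notin> {X. X \<in> L \<and> X \<inter> A = F \<and> \<not> X \<subseteq> A}" using that by auto
    ultimately show ?thesis using fin by simp
  qed
  then have "(\<Sum>F\<in>?S. moebius L UNIV F) =
      - (\<Sum>F\<in>?S. \<Sum>X | X \<in> L \<and> X \<inter> A = F \<and> \<not> X \<subseteq> A. moebius L UNIV X)"
    by (simp add: sum_negf)
  also have "(\<Sum>F\<in>?S. \<Sum>X | X \<in> L \<and> X \<inter> A = F \<and> \<not> X \<subseteq> A. moebius L UNIV X) =
      (\<Sum>X\<in>(\<Union>F\<in>?S. {X. X \<in> L \<and> X \<inter> A = F \<and> \<not> X \<subseteq> A}). moebius L UNIV X)"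
    by (rule sum.UNION_disjoint[symmetric]) (use fin in auto)
  also have "(\<Union>F\<in>?S. {X. X \<in> L \<and> X \<inter> A = F \<and> \<not> X \<subseteq> A}) = {X. X \<in> L \<and> r X = Suc n \<and> \<not> X \<subseteq> A}"
  proof (intro equalityI subsetI)
    fix X assume "X \<in> {X. X \<in> L \<and> r X = Suc n \<and> \<not> X \<subseteq> A}"
    then have "X \<inter> A \<in> ?S" "X \<in> L" "\<not> X \<subseteq> A" using meet rank[of X] by auto
    then show "X \<in> (\<Union>F\<in>?S. {X. X \<in> L \<and> X \<inter> A = F \<and> \<not> X \<subseteq> A})" by blast
  next
    fix X assume "X \<in> (\<Union>F\<in>?S. {X. X \<in> L \<and> X \<inter> A = F \<and> \<not> X \<subseteq> A})"
    then show "X \<in> {X. X \<in> L \<and> r X = Suc n \<and> \<not> X \<subseteq> A}" using rank[of X] by blast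
  qed
  finally show ?thesis by simp
qed

subsection \<open>An Euler characteristic of flats and open polyhedra\<close>

definition coord_slice :: "'a::euclidean_space set \<Rightarrow> 'a \<Rightarrow> 'a set" where
  "coord_slice D c = {x. \<forall>b\<in>Basis - D. x \<bullet> b = c \<bullet> b}"

definition open_polyhedron :: "('a::euclidean_space \<times> real) set \<Rightarrow> 'a set" where
  "open_polyhedron N = {x. \<forall>(a, \<beta>)\<in>N. a \<bullet> x < \<beta>}"

text \<open>Neither the right-hand sides of the constraints nor the base point of a slice enter, so
  all parallel slices are classified alike. The recursion over the coordinates rests on
  this.\<close>

definition has_recession :: "('a::euclidean_space \<times> real) set \<Rightarrow> 'a set \<Rightarrow> bool" where
  "has_recession N D \<longleftrightarrow> (\<exists>h. h \<noteq> 0 \<and> (\<forall>b\<in>Basis - D. h \<bullet> b = 0) \<and> (\<forall>(a, \<beta>)\<in>N. a \<bullet> h \<le> 0))"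

definition line_free :: "('a::euclidean_space \<times> real) set \<Rightarrow> bool" where
  "line_free N \<longleftrightarrow> (\<forall>h. (\<forall>(a, \<beta>)\<in>N. a \<bullet> h = 0) \<longrightarrow> h = 0)"

text \<open>The sum \<open>s h\<close> of the positive parts of \<open>a \<bullet> h\<close> is
  positive on the compact set of unit directions of the slice, hence bounded below there by a
  positive constant. For two points \<open>y\<close> and \<open>p\<close> of the slice,
  \<open>s (y - p)\<close> is at most a constant depending on \<open>p\<close>, which bounds the
  distance.\<close>

lemma no_recession_imp_bounded:
  fixes N :: "('a::euclidean_space \<times> real) set"
  assumes N: "finite N" and nr: "\<not> has_recession N D"
  shows "bounded (open_polyhedron N \<inter> coord_slice D c)"
proof -
  define V where "V = open_polyhedron N \<inter> coord_slice D c"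
  define S :: "'a set" where "S = sphere 0 1 \<inter> {h. \<forall>b\<in>Basis - D. h \<bullet> b = 0}"
  define s where "s h = (\<Sum>(a, \<beta>)\<in>N. max 0 (a \<bullet> h))" for h :: 'a
  have inS: "(1 / norm (y - p)) *\<^sub>R (y - p) \<in> S" if "y \<in> V" "p \<in> V" "y \<noteq> p" for y p
    using that by (auto simp: S_def V_def coord_slice_def inner_diff_left)
  have "compact S" unfolding S_def
  proof (rule compact_Int_closed)
    have "{h::'a. \<forall>b\<in>Basis - D. h \<bullet> b = 0} = (\<Inter>b\<in>Basis - D. {h. b \<bullet> h = 0})"
      by (auto simp: inner_commute)
    then show "closed {h::'a. \<forall>b\<in>Basis - D. h \<bullet> b = 0}"
      by (auto intro!: closed_INT closed_hyperplane)
  qed simp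
  have cont: "continuous_on S s" unfolding s_def case_prod_unfold
    by (intro continuous_intros)
  have spos: "0 < s h" if "h \<in> S" for h
  proof (rule ccontr)
    assume "\<not> 0 < s h"
    moreover have "0 \<le> s h" unfolding s_def by (intro sum_nonneg) auto
    ultimately have "s h = 0" by simp
    then have "\<forall>x\<in>N. (case x of (a, \<beta>) \<Rightarrow> max 0 (a \<bullet> h)) = 0"
      unfolding s_def using N by (subst (asm) sum_nonneg_eq_0_iff) auto
    then have "\<forall>(a, \<beta>)\<in>N. a \<bullet> h \<le> 0" by auto
    moreover have "h \<noteq> 0" "\<forall>b\<in>Basis - D. h \<bullet> b = 0" using that by (auto simp: S_def)
    ultimately show False using nr unfolding has_recession_def by blast
  qed
  have "bounded V"
  proof (cases "S = {}")
    case True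
    then have "y = p" if "y \<in> V" "p \<in> V" for y p using inS that by blast
    then show ?thesis by (metis bounded_empty bounded_insert bounded_subset equals0I insertI1 subsetI)
  next
    case False
    then obtain h0 where h0: "h0 \<in> S" "\<And>h. h \<in> S \<Longrightarrow> s h0 \<le> s h"
      using continuous_attains_inf[OF \<open>compact S\<close> False cont] by blast
    show ?thesis
    proof (cases "V = {}")
      case False
      then obtain p where p: "p \<in> V" by blast
      define C where "C = (\<Sum>(a, \<beta>)\<in>N. max 0 (\<beta> - a \<bullet> p))"
      have C0: "0 \<le> C" unfolding C_def by (intro sum_nonneg) auto
      have "dist p y \<le> C / s h0" if y: "y \<in> V" for y
      proof (cases "y = p")
        case True
        then show ?thesis using C0 spos[OF h0(1)] by simp
      next
        case False
        let ?t = "norm (y - p)"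
        have t: "?t > 0" using False by simp
        have "?t * s h0 \<le> ?t * s ((1 / ?t) *\<^sub>R (y - p))"
          using h0(2)[OF inS[OF y p False]] t by simp
        also have "\<dots> = (\<Sum>(a, \<beta>)\<in>N. max 0 (a \<bullet> (y - p)))"
          unfolding s_def sum_distrib_left case_prod_unfold
        proof (rule sum.cong[OF refl])
          fix x :: "'a \<times> real"
          have "?t * max 0 (fst x \<bullet> (1 / ?t) *\<^sub>R (y - p)) = max (?t * 0) (?t * (fst x \<bullet> (1 / ?t) *\<^sub>R (y - p)))"
            using t by (simp add: max_mult_distrib_left)
          then show "?t * max 0 (fst x \<bullet> (1 / ?t) *\<^sub>R (y - p)) = max 0 (fst x \<bullet> (y - p))"
            using t by simp
        qed
        also have "\<dots> \<le> C" unfolding C_def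
        proof (rule sum_mono)
          fix x assume x: "x \<in> N"
          obtain a \<beta> where ab: "x = (a, \<beta>)" by (cases x)
          have "a \<bullet> y < \<beta>" using x y ab by (auto simp: V_def open_polyhedron_def)
          then show "(case x of (a, \<beta>) \<Rightarrow> max 0 (a \<bullet> (y - p))) \<le> (case x of (a, \<beta>) \<Rightarrow> max 0 (\<beta> - a \<bullet> p))"
            unfolding ab by (auto simp: inner_diff_right)
        qed
        finally show ?thesis using spos[OF h0(1)] by (simp add: field_simps dist_norm norm_minus_commute)
      qed
      then show ?thesis unfolding bounded_def by blast
    qed simp
  qed
  then show ?thesis by (simp add: V_def)
qed

lemma recession_ray:
  assumes "x \<in> open_polyhedron N \<inter> coord_slice D c" "\<forall>b\<in>Basis - D. h \<bullet> b = 0"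
    "\<forall>(a, \<beta>)\<in>N. a \<bullet> h \<le> 0" "t \<ge> 0"
  shows "x + t *\<^sub>R h \<in> open_polyhedron N \<inter> coord_slice D c"
proof -
  have "a \<bullet> (x + t *\<^sub>R h) < \<beta>" if "(a, \<beta>) \<in> N" for a \<beta>
  proof -
    have "t * (a \<bullet> h) \<le> 0" using that assms by (auto intro: mult_nonneg_nonpos)
    moreover have "a \<bullet> x < \<beta>" using that assms by (auto simp: open_polyhedron_def)
    ultimately show ?thesis by (simp add: inner_add_right)
  qed
  then show ?thesis using assms by (auto simp: open_polyhedron_def coord_slice_def inner_add_left)
qed

text \<open>The part of the slice with \<open>x \<bullet> g < 0\<close> is bounded. Otherwise it has
  a recession direction \<open>h'\<close>, and adding the multiple of \<open>h\<close> that cancels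
  the coordinate \<open>b\<close> gives a recession direction of the smaller slice, which must be 0.
  Then \<open>h'\<close> is a negative multiple of \<open>h\<close>, and the polyhedron contains a
  line direction.\<close>

lemma recession_bounded_below:
  fixes N :: "('a::euclidean_space \<times> real) set"
  assumes N: "finite N" and lf: "line_free N" and nr: "\<not> has_recession N D" and b: "b \<in> Basis"
    and h: "\<forall>b\<in>Basis - insert b D. h \<bullet> b = 0" "\<forall>(a, \<beta>)\<in>N. a \<bullet> h \<le> 0"
    and g: "g = b \<or> g = - b" "h \<bullet> g > 0"
  obtains m where "\<And>x. x \<in> open_polyhedron N \<inter> coord_slice (insert b D) c \<Longrightarrow> m \<le> x \<bullet> g"
proof -
  let ?V = "open_polyhedron N \<inter> coord_slice (insert b D) c"
  have "\<exists>m. \<forall>x\<in>?V. m \<le> x \<bullet> g"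
  proof -
    have "\<not> has_recession (insert (g, 0) N) (insert b D)"
    proof
      assume "has_recession (insert (g, 0) N) (insert b D)"
      then obtain h' where h': "h' \<noteq> 0" "\<forall>b\<in>Basis - insert b D. h' \<bullet> b = 0"
        "g \<bullet> h' \<le> 0" "\<forall>(a, \<beta>)\<in>N. a \<bullet> h' \<le> 0"
        unfolding has_recession_def by auto
      define s where "s = - (h' \<bullet> g) / (h \<bullet> g)"
      have s: "s \<ge> 0" using h'(3) g(2) by (simp add: s_def inner_commute field_simps)
      define k where "k = h' + s *\<^sub>R h"
      have "k \<bullet> g = h' \<bullet> g + s * (h \<bullet> g)" by (simp add: k_def inner_add_left)
      then have "k \<bullet> g = 0" using g(2) by (simp add: s_def)
      then have "k \<bullet> b = 0" using g(1) by auto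
      have k1: "\<forall>b'\<in>Basis - D. k \<bullet> b' = 0"
      proof
        fix b' assume "b' \<in> Basis - D"
        then show "k \<bullet> b' = 0"
          using \<open>k \<bullet> b = 0\<close> h'(2) h(1) by (cases "b' = b") (auto simp: k_def inner_add_left)
      qed
      have k2: "\<forall>(a, \<beta>)\<in>N. a \<bullet> k \<le> 0"
        using h'(4) h(2) s by (fastforce simp: k_def inner_add_right intro: add_nonpos_nonpos mult_nonneg_nonpos)
      have "k = 0" using k1 k2 nr unfolding has_recession_def by blast
      then have h'eq: "h' = - (s *\<^sub>R h)" by (simp add: k_def eq_neg_iff_add_eq_0)
      then have "s \<noteq> 0" using h'(1) by auto
      have "\<forall>(a, \<beta>)\<in>N. a \<bullet> h = 0"
      proof clarify
        fix a \<beta> assume "(a, \<beta>) \<in> N"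
        then have "a \<bullet> h \<le> 0" "a \<bullet> h' \<le> 0" using h h' by auto
        then show "a \<bullet> h = 0" using s \<open>s \<noteq> 0\<close> by (simp add: h'eq zero_le_mult_iff)
      qed
      then have "h = 0" using lf unfolding line_free_def by blast
      then show False using g(2) by simp
    qed
    moreover have "has_recession (insert (g, \<beta>) N) E \<longleftrightarrow> has_recession (insert (g, 0) N) E" for \<beta> E
      unfolding has_recession_def by simp
    ultimately have "bounded (open_polyhedron (insert (g, 0) N) \<inter> coord_slice (insert b D) c)"
      using N by (intro no_recession_imp_bounded) auto
    then obtain B where B: "\<And>x. x \<in> open_polyhedron (insert (g, 0) N) \<inter> coord_slice (insert b D) c \<Longrightarrow> norm x \<le> B"
      unfolding bounded_iff by blast
    have ng: "norm g = 1" using g b by auto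
    have "- \<bar>B\<bar> \<le> x \<bullet> g" if x: "x \<in> ?V" for x
    proof (cases "x \<bullet> g < 0")
      case True
      then have "x \<in> open_polyhedron (insert (g, 0) N) \<inter> coord_slice (insert b D) c"
        using x by (auto simp: open_polyhedron_def inner_commute)
      then have "norm x \<le> B" by (rule B)
      moreover have "\<bar>x \<bullet> g\<bar> \<le> norm x" using Cauchy_Schwarz_ineq2[of x g] ng by simp
      ultimately show ?thesis by linarith
    qed simp
    then show ?thesis by blast
  qed
  then show ?thesis using that by blast
qed

text \<open>
  \<open>v\<close> is the value on \<open>S\<close> of the functional
  \<open>f \<mapsto> (\<Sum>x. f x - f (x+)) + f \<infinity>\<close>.
\<close>

definition interval_value :: "real set \<Rightarrow> real \<Rightarrow> bool" where
  "interval_value S v \<longleftrightarrow> S = {} \<and> v = 0 \<or> (\<exists>p. S = {p}) \<and> v = 1 \<or> S = UNIV \<and> v = 1 \<or>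
    (\<exists>l u. l < u \<and> S = {l<..<u}) \<and> v = -1 \<or> (\<exists>l. S = {l<..}) \<and> v = 0 \<or> (\<exists>u. S = {..<u}) \<and> v = 0"

text \<open>The right limit at \<open>z\<close> is replaced by the value at
  \<open>z + \<delta>\<close> and the value at infinity by the value at \<open>X\<close>. The
  formula holds for every \<open>Z\<close> that contains the endpoints of \<open>S\<close> and has
  gaps wider than \<open>\<delta>\<close>. One choice of \<open>Z\<close>, \<open>\<delta>\<close>
  and \<open>X\<close> thus serves finitely many sets at once, and linearity becomes
  visible.\<close>

lemma interval_value_eq_sum:
  assumes "interval_value S v"
  obtains Z0 where "finite Z0" "\<And>Z \<delta> X. finite Z \<Longrightarrow> Z0 \<subseteq> Z \<Longrightarrow> \<delta> > 0 \<Longrightarrow>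
    (\<forall>y\<in>Z. \<forall>z\<in>Z. y < z \<longrightarrow> y + \<delta> < z) \<Longrightarrow> (\<forall>z\<in>Z. z < X) \<Longrightarrow>
    v = (\<Sum>z\<in>Z. indicator S z - indicator S (z + \<delta>)) + indicator S X"
proof -
  have "\<exists>Z0. finite Z0 \<and> (\<forall>Z \<delta> X. finite Z \<longrightarrow> Z0 \<subseteq> Z \<longrightarrow> \<delta> > 0 \<longrightarrow>
    (\<forall>y\<in>Z. \<forall>z\<in>Z. y < z \<longrightarrow> y + \<delta> < z) \<longrightarrow> (\<forall>z\<in>Z. z < X) \<longrightarrow>
    v = (\<Sum>z\<in>Z. indicator S z - indicator S (z + \<delta>)) + indicator S X)"
    using assms unfolding interval_value_def
  proof (elim disjE conjE exE)
    fix p assume S: "S = {p}" and v: "v = 1"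
    show ?thesis
    proof (intro exI[of _ "{p}"] conjI allI impI)
      fix Z \<delta> X assume Z: "finite Z" "{p} \<subseteq> Z" "\<delta> > (0::real)"
        "\<forall>y\<in>Z. \<forall>z\<in>Z. y < z \<longrightarrow> y + \<delta> < z" "\<forall>z\<in>Z. z < X"
      have "indicator S z - indicator S (z + \<delta>) = (if z = p then 1 else 0::real)" if z: "z \<in> Z" for z
      proof -
        have "z < p \<longrightarrow> z + \<delta> < p" using Z z by auto
        then show ?thesis using Z(3) S by (auto simp: indicator_def)
      qed
      moreover have "indicator S X = (0::real)" using Z S by auto
      ultimately show "v = (\<Sum>z\<in>Z. indicator S z - indicator S (z + \<delta>)) + indicator S X"
        using Z v by simp
    qed simp
  next
    fix l u assume S: "S = {l<..<u}" and v: "v = -1" and lu: "l < (u::real)"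
    show ?thesis
    proof (intro exI[of _ "{l, u}"] conjI allI impI)
      fix Z \<delta> X assume Z: "finite Z" "{l, u} \<subseteq> Z" "\<delta> > (0::real)"
        "\<forall>y\<in>Z. \<forall>z\<in>Z. y < z \<longrightarrow> y + \<delta> < z" "\<forall>z\<in>Z. z < X"
      have "indicator S z - indicator S (z + \<delta>) = (if z = l then -1 else 0::real)" if z: "z \<in> Z" for z
      proof -
        have "z < u \<longrightarrow> z + \<delta> < u" "z < l \<longrightarrow> z + \<delta> < l" using Z z by auto
        then show ?thesis using lu Z(3) S by (auto simp: indicator_def)
      qed
      moreover have "indicator S X = (0::real)" using Z S by auto
      ultimately show "v = (\<Sum>z\<in>Z. indicator S z - indicator S (z + \<delta>)) + indicator S X"
        using Z v by simp
    qed simp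
  next
    fix l assume S: "S = {l<..}" and v: "v = 0"
    show ?thesis
    proof (intro exI[of _ "{l}"] conjI allI impI)
      fix Z \<delta> X assume Z: "finite Z" "{l} \<subseteq> Z" "\<delta> > (0::real)"
        "\<forall>y\<in>Z. \<forall>z\<in>Z. y < z \<longrightarrow> y + \<delta> < z" "\<forall>z\<in>Z. z < X"
      have "indicator S z - indicator S (z + \<delta>) = (if z = l then -1 else 0::real)" if z: "z \<in> Z" for z
      proof -
        have "z < l \<longrightarrow> z + \<delta> < l" using Z z by auto
        then show ?thesis using Z(3) S by (auto simp: indicator_def)
      qed
      moreover have "indicator S X = (1::real)" using Z S by auto
      ultimately show "v = (\<Sum>z\<in>Z. indicator S z - indicator S (z + \<delta>)) + indicator S X"
        using Z v by simp
    qed simp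
  next
    fix u assume S: "S = {..<u}" and v: "v = 0"
    show ?thesis
    proof (intro exI[of _ "{u}"] conjI allI impI)
      fix Z \<delta> X assume Z: "finite Z" "{u} \<subseteq> Z" "\<delta> > (0::real)"
        "\<forall>y\<in>Z. \<forall>z\<in>Z. y < z \<longrightarrow> y + \<delta> < z" "\<forall>z\<in>Z. z < X"
      have "indicator S z - indicator S (z + \<delta>) = (0::real)" if z: "z \<in> Z" for z
      proof -
        have "z < u \<longrightarrow> z + \<delta> < u" using Z z by auto
        then show ?thesis using Z(3) S by (auto simp: indicator_def)
      qed
      moreover have "indicator S X = (0::real)" using Z S by auto
      ultimately show "v = (\<Sum>z\<in>Z. indicator S z - indicator S (z + \<delta>)) + indicator S X"
        using Z v by simp
    qed simp
  qed (auto intro!: exI[of _ "{}"])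
  then show ?thesis using that by blast
qed

lemma interval_relation:
  fixes c v :: "'i \<Rightarrow> real"
  assumes I: "finite I" and S: "\<And>i. i \<in> I \<Longrightarrow> c i \<noteq> 0 \<Longrightarrow> interval_value (S i) (v i)"
    and 0: "\<And>t. (\<Sum>i\<in>I. c i * indicator (S i) t) = 0"
  shows "(\<Sum>i\<in>I. c i * v i) = 0"
proof -
  let ?P = "\<lambda>i Z0. finite Z0 \<and> (\<forall>Z \<delta> X. finite Z \<longrightarrow> Z0 \<subseteq> Z \<longrightarrow> \<delta> > 0 \<longrightarrow>
    (\<forall>y\<in>Z. \<forall>z\<in>Z. y < z \<longrightarrow> y + \<delta> < z) \<longrightarrow> (\<forall>z\<in>Z. z < X) \<longrightarrow>
    v i = (\<Sum>z\<in>Z. indicator (S i) z - indicator (S i) (z + \<delta>)) + indicator (S i) X)"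
  have "\<exists>Z0. ?P i Z0" if "i \<in> I" "c i \<noteq> 0" for i
    by (rule interval_value_eq_sum[OF S[OF that]]) blast
  then have "\<forall>i\<in>{i\<in>I. c i \<noteq> 0}. \<exists>Z0. ?P i Z0" by blast
  from bchoice[OF this] obtain Zf where Zf0: "\<forall>i\<in>{i\<in>I. c i \<noteq> 0}. ?P i (Zf i)"
    by (rule exE)
  have Zf: "?P i (Zf i)" if "i \<in> I" "c i \<noteq> 0" for i
    by (rule bspec[OF Zf0]) (use that in simp)
  define Z where "Z = (\<Union>i\<in>{i\<in>I. c i \<noteq> 0}. Zf i)"
  have Z: "finite Z" using I Zf by (auto simp: Z_def)
  \<comment> \<open>Half the smallest gap of \<open>Z\<close>; the inserted 1 provides a minimum
    when there is no gap.\<close>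
  define \<delta> where "\<delta> = Min (insert 1 ((\<lambda>(y, z). z - y) ` {(y, z). y \<in> Z \<and> z \<in> Z \<and> y < z})) / 2"
  have finD: "finite {(y, z). y \<in> Z \<and> z \<in> Z \<and> y < z}"
    by (rule finite_subset[of _ "Z \<times> Z"]) (use Z in auto)
  have \<delta>: "\<delta> > 0" unfolding \<delta>_def using finD by (auto simp: Min_gr_iff)
  have gap: "\<forall>y\<in>Z. \<forall>z\<in>Z. y < z \<longrightarrow> y + \<delta> < z"
  proof (intro ballI impI)
    fix y z assume "y \<in> Z" "z \<in> Z" "y < z"
    then have "2 * \<delta> \<le> z - y" unfolding \<delta>_def using finD by (simp, intro Min_le) auto
    then show "y + \<delta> < z" using \<delta> by linarith
  qed
  define X where "X = Max (insert 0 Z) + 1"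
  have X: "\<forall>z\<in>Z. z < X"
  proof
    fix z assume "z \<in> Z"
    then have "z \<le> Max (insert 0 Z)" using Z by (intro Max_ge) auto
    then show "z < X" by (simp add: X_def)
  qed
  have v: "c i * v i = (\<Sum>z\<in>Z. c i * indicator (S i) z - c i * indicator (S i) (z + \<delta>)) + c i * indicator (S i) X"
    if "i \<in> I" for i
  proof (cases "c i = 0")
    case False
    then have "Zf i \<subseteq> Z" using that by (auto simp: Z_def)
    then have "v i = (\<Sum>z\<in>Z. indicator (S i) z - indicator (S i) (z + \<delta>)) + indicator (S i) X"
      using Zf[OF that False] Z \<delta> gap X by blast
    then show ?thesis by (simp add: sum_distrib_left algebra_simps)
  qed simp
  have "(\<Sum>i\<in>I. c i * v i) = (\<Sum>i\<in>I. \<Sum>z\<in>Z. c i * indicator (S i) z - c i * indicator (S i) (z + \<delta>)) +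
      (\<Sum>i\<in>I. c i * indicator (S i) X)"
    using v by (simp add: sum.distrib)
  also have "\<dots> = (\<Sum>z\<in>Z. (\<Sum>i\<in>I. c i * indicator (S i) z) - (\<Sum>i\<in>I. c i * indicator (S i) (z + \<delta>))) +
      (\<Sum>i\<in>I. c i * indicator (S i) X)"
    by (subst sum.swap) (simp add: sum_subtractf)
  also have "\<dots> = 0" using 0 by simp
  finally show ?thesis .
qed

section \<open>Shadows of slices on a coordinate axis\<close>

lemma open_interval_cases:
  fixes S :: "real set"
  assumes "open S" "is_interval S" "S \<noteq> {}"
  shows "bdd_below S \<Longrightarrow> bdd_above S \<Longrightarrow> \<exists>l u. l < u \<and> S = {l<..<u}"
    and "bdd_below S \<Longrightarrow> \<not> bdd_above S \<Longrightarrow> \<exists>l. S = {l<..}"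
    and "\<not> bdd_below S \<Longrightarrow> bdd_above S \<Longrightarrow> \<exists>u. S = {..<u}"
proof -
  have mid: "t \<in> S" if "x \<in> S" "y \<in> S" "x < t" "t < y" for x y t
    using assms(2) that by (meson is_interval_1 less_imp_le)
  have nbhd: "\<exists>x\<in>S. \<exists>y\<in>S. x < t \<and> t < y" if "t \<in> S" for t
  proof -
    obtain e where "e > 0" "ball t e \<subseteq> S" using assms(1) \<open>t \<in> S\<close> openE by blast
    then have "t - e/2 \<in> S" "t + e/2 \<in> S" by (auto simp: dist_real_def subset_iff)
    then show ?thesis using \<open>e > 0\<close> by (intro bexI[of _ "t - e/2"] bexI[of _ "t + e/2"]) auto
  qed
  have lo: "Inf S < t" if "t \<in> S" "bdd_below S" for t
    using nbhd[OF that(1)] that(2) by (meson cInf_lower order_le_less_trans)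
  have hi: "t < Sup S" if "t \<in> S" "bdd_above S" for t
    using nbhd[OF that(1)] that(2) by (meson cSup_upper order_less_le_trans)
  have lo': "\<exists>x\<in>S. x < t" if "Inf S < t \<or> \<not> bdd_below S" for t
    using that assms(3) by (metis bdd_belowI cInf_lessD not_less)
  have hi': "\<exists>x\<in>S. t < x" if "t < Sup S \<or> \<not> bdd_above S" for t
    using that assms(3) by (metis bdd_aboveI less_cSupD not_less)
  have bt: "t \<in> S" if "Inf S < t \<or> \<not> bdd_below S" "t < Sup S \<or> \<not> bdd_above S" for t
    using lo'[OF that(1)] hi'[OF that(2)] mid by blast
  {
    assume b: "bdd_below S" "bdd_above S"
    then have "t \<in> S \<longleftrightarrow> Inf S < t \<and> t < Sup S" for t using lo[of t] hi[of t] bt[of t] by auto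
    then have "S = {Inf S<..<Sup S}" by (simp add: set_eq_iff)
    moreover have "Inf S < Sup S" using assms(3) lo[OF _ b(1)] hi[OF _ b(2)]
      by (meson equals0I less_trans)
    ultimately show "\<exists>l u. l < u \<and> S = {l<..<u}" by blast
  next
    assume "bdd_below S" "\<not> bdd_above S"
    then have "t \<in> S \<longleftrightarrow> Inf S < t" for t using lo[of t] bt[of t] by auto
    then have "S = {Inf S<..}" by (simp add: set_eq_iff)
    then show "\<exists>l. S = {l<..}" by blast
  next
    assume "\<not> bdd_below S" "bdd_above S"
    then have "t \<in> S \<longleftrightarrow> t < Sup S" for t using hi[of t] bt[of t] by auto
    then have "S = {..<Sup S}" by (simp add: set_eq_iff)
    then show "\<exists>u. S = {..<u}" by blast
  }
qed

text \<open>The Euler characteristic of a nonempty slice with free coordinates \<open>D\<close>. It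
  is the same for all nonempty parallel slices, so it comes out of the sum over slices as a
  factor.\<close>

definition polyhedron_value :: "bool \<Rightarrow> ('a::euclidean_space \<times> real) set \<Rightarrow> 'a set \<Rightarrow> real" where
  "polyhedron_value af N D = (if af then 1 else if has_recession N D then 0 else (-1) ^ card D)"

lemma affine_real_cases:
  fixes S :: "real set"
  assumes "affine S"
  shows "S = {} \<or> (\<exists>p. S = {p}) \<or> S = UNIV"
proof -
  have "S = UNIV" if "x \<in> S" "y \<in> S" "x \<noteq> y" for x y
  proof -
    have "t \<in> S" for t
    proof -
      define s where "s = (t - x) / (y - x)"
      have "(1 - s) *\<^sub>R x + s *\<^sub>R y \<in> S" using assms that unfolding affine_alt by blast
      moreover have "(1 - s) *\<^sub>R x + s *\<^sub>R y = x + s * (y - x)" by (simp add: algebra_simps)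
      ultimately show ?thesis using that by (simp add: s_def)
    qed
    then show ?thesis by blast
  qed
  then show ?thesis by (metis is_singletonI' is_singleton_def)
qed

lemma open_polyhedron_properties:
  assumes "finite N"
  shows "open (open_polyhedron N)" "convex (open_polyhedron N)"
proof -
  have "open_polyhedron N = (\<Inter>x\<in>N. {y. fst x \<bullet> y < snd x})"
    by (force simp: open_polyhedron_def)
  then show "open (open_polyhedron N)" "convex (open_polyhedron N)"
    using assms by (auto intro!: open_INT open_halfspace_lt convex_INT convex_halfspace_lt)
qed

lemma affine_coord_slice: "affine (coord_slice D c)"
proof -
  have "coord_slice D c = (\<Inter>b\<in>Basis - D. {x. b \<bullet> x = c \<bullet> b})"
    by (auto simp: coord_slice_def inner_commute)
  then show ?thesis by (auto intro!: affine_Inter affine_hyperplane)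
qed

text \<open>The ratio is 1 for a flat, whose shadow is a point or the whole line. For an open
  polyhedron without recession in \<open>insert b D\<close> the shadow is a bounded open interval
  and the ratio is -1. If recession appears only when \<open>b\<close> is freed, the shadow is a
  half-line, open by \<open>open_polyhedron_properties\<close> and bounded on one side because there
  is no line, and the ratio is 0.\<close>

lemma slice_projection_value:
  fixes U :: "'a::euclidean_space set" and c :: 'a
  assumes D: "finite D" "b \<notin> D" "b \<in> Basis"
    and af: "af \<Longrightarrow> affine U"
    and na: "\<not> af \<Longrightarrow> finite N \<and> U = open_polyhedron N \<and> line_free N"
    and nz: "polyhedron_value af N D \<noteq> 0"
  defines "T \<equiv> (\<lambda>x. x \<bullet> b) ` (U \<inter> coord_slice (insert b D) c)"
  shows "interval_value T (if T = {} then 0 else polyhedron_value af N (insert b D) / polyhedron_value af N D)"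
proof (cases "T = {}")
  case True
  then show ?thesis by (simp add: interval_value_def)
next
  case ne: False
  have lin: "linear (\<lambda>x::'a. x \<bullet> b)"
    by (intro bounded_linear.linear bounded_linear_inner_left)
  show ?thesis
  proof (cases af)
    case True
    have "affine T" unfolding T_def
    proof -
      have "affine hull (U \<inter> coord_slice (insert b D) c) = U \<inter> coord_slice (insert b D) c"
        using affine_Int[OF af[OF True] affine_coord_slice[of "insert b D" c]] by (simp only: affine_hull_eq)
      then show "affine ((\<lambda>x. x \<bullet> b) ` (U \<inter> coord_slice (insert b D) c))"
        using affine_hull_linear_image[OF bounded_linear_inner_left[of b], of "U \<inter> coord_slice (insert b D) c"]
        by (metis affine_affine_hull)
    qed
    from affine_real_cases[OF this] show ?thesis
      using True by (auto simp: interval_value_def polyhedron_value_def)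
  next
    case False
    then have N: "finite N" "U = open_polyhedron N" "line_free N" using na by auto
    have nr: "\<not> has_recession N D" using nz False by (auto simp: polyhedron_value_def)
    let ?V = "U \<inter> coord_slice (insert b D) c"
    have "convex ?V"
      using convex_Int[OF open_polyhedron_properties(2)[OF N(1)] affine_imp_convex[OF affine_coord_slice]] N(2)
      by simp
    then have T1: "is_interval T" unfolding T_def is_interval_convex_1 by (rule convex_linear_image[OF lin])
    have T2: "open T"
    proof (rule openI)
      fix t assume "t \<in> T"
      then obtain x where x: "x \<in> ?V" "t = x \<bullet> b" by (auto simp: T_def)
      obtain e where e: "e > 0" "ball x e \<subseteq> U"
        using open_polyhedron_properties(1)[OF N(1)] N(2) x openE by blast
      have "ball t e \<subseteq> T"
      proof
        fix s assume s: "s \<in> ball t e"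
        let ?y = "x + (s - t) *\<^sub>R b"
        have "?y \<in> ball x e" using s D by (simp add: dist_norm dist_real_def)
        then have "?y \<in> U" using e by blast
        moreover have "?y \<in> coord_slice (insert b D) c"
          using x D by (auto simp: coord_slice_def inner_add_left inner_Basis)
        moreover have "?y \<bullet> b = s" using x D by (simp add: inner_add_left inner_Basis)
        ultimately show "s \<in> T" unfolding T_def by (metis IntI image_eqI)
      qed
      then show "\<exists>e>0. ball t e \<subseteq> T" using e by blast
    qed
    obtain x0 where x0: "x0 \<in> ?V" using ne by (auto simp: T_def)
    show ?thesis
    proof (cases "has_recession N (insert b D)")
      case False
      then have "bounded ?V" using no_recession_imp_bounded N by auto
      then have "bounded T" unfolding T_def
        by (intro bounded_linear_image bounded_linear_inner_left)
      then have "bdd_below T" "bdd_above T" using bounded_imp_bdd_below bounded_imp_bdd_above by auto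
      from open_interval_cases(1)[OF T2 T1 ne this] show ?thesis
        using False nr \<open>\<not> af\<close> D ne by (auto simp: interval_value_def polyhedron_value_def field_simps)
    next
      case True
      then obtain h where h: "h \<noteq> 0" "\<forall>b\<in>Basis - insert b D. h \<bullet> b = 0" "\<forall>(a, \<beta>)\<in>N. a \<bullet> h \<le> 0"
        unfolding has_recession_def by blast
      have hb: "h \<bullet> b \<noteq> 0"
      proof
        assume "h \<bullet> b = 0"
        then have "\<forall>b\<in>Basis - D. h \<bullet> b = 0" using h(2) by auto
        then show False using h nr unfolding has_recession_def by blast
      qed
      have ray: "x0 \<bullet> b + t * (h \<bullet> b) \<in> T" if "t \<ge> 0" for t
      proof -
        have "x0 + t *\<^sub>R h \<in> ?V" using recession_ray[OF _ h(2,3) that, of x0 c] x0 N(2) by simp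
        moreover have "(x0 + t *\<^sub>R h) \<bullet> b = x0 \<bullet> b + t * (h \<bullet> b)" by (simp add: inner_add_left)
        ultimately show ?thesis unfolding T_def by (metis image_eqI)
      qed
      have "(\<exists>l. T = {l<..}) \<or> (\<exists>u. T = {..<u})"
      proof (cases "h \<bullet> b > 0")
        case True
        obtain m where "\<And>x. x \<in> ?V \<Longrightarrow> m \<le> x \<bullet> b"
          using recession_bounded_below[OF N(1,3) nr D(3) h(2,3) _ True, of c] N(2) by auto
        then have "bdd_below T" by (auto simp: T_def intro!: bdd_belowI[of _ m])
        moreover have "\<not> bdd_above T"
        proof
          assume "bdd_above T"
          then obtain M where M: "\<And>t. t \<in> T \<Longrightarrow> t \<le> M" by (auto simp: bdd_above_def)
          have "x0 \<bullet> b \<le> M" using M[OF ray[of 0]] by simp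
          then have "x0 \<bullet> b + ((M - x0 \<bullet> b + 1) / (h \<bullet> b)) * (h \<bullet> b) \<in> T"
            using True by (intro ray) simp
          then have "M + 1 \<in> T" using True by simp
          then show False using M by fastforce
        qed
        ultimately show ?thesis using open_interval_cases(2)[OF T2 T1 ne] by simp
      next
        case False
        then have neg: "h \<bullet> (- b) > 0" using hb by simp
        obtain m where m: "\<And>x. x \<in> ?V \<Longrightarrow> m \<le> x \<bullet> (- b)"
          using recession_bounded_below[OF N(1,3) nr D(3) h(2,3) _ neg, of c] N(2) by auto
        then have "bdd_above T" by (fastforce simp: T_def intro!: bdd_aboveI[of _ "- m"])
        moreover have "\<not> bdd_below T"
        proof
          assume "bdd_below T"
          then obtain M where M: "\<And>t. t \<in> T \<Longrightarrow> M \<le> t" by (auto simp: bdd_below_def)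
          have "M \<le> x0 \<bullet> b" using M[OF ray[of 0]] by simp
          then have "x0 \<bullet> b + ((M - x0 \<bullet> b - 1) / (h \<bullet> b)) * (h \<bullet> b) \<in> T"
            using neg by (intro ray) (simp add: divide_nonpos_neg)
          then have "M - 1 \<in> T" using hb by simp
          then show False using M by fastforce
        qed
        ultimately show ?thesis using open_interval_cases(3)[OF T2 T1 ne] by simp
      qed
      then show ?thesis using True \<open>\<not> af\<close> ne by (auto simp: interval_value_def polyhedron_value_def)
    qed
  qed
qed

text \<open>Hadwiger's recursion: slice by the values of one coordinate at a time.\<close>

lemma polyhedron_value_relation:
  fixes U :: "'i \<Rightarrow> 'a::euclidean_space set" and w :: "'i \<Rightarrow> real"
  assumes I: "finite I" and D: "finite D" "D \<subseteq> Basis"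
    and af: "\<And>i. i \<in> I \<Longrightarrow> af i \<Longrightarrow> affine (U i)"
    and na: "\<And>i. i \<in> I \<Longrightarrow> \<not> af i \<Longrightarrow> finite (N i) \<and> U i = open_polyhedron (N i) \<and> line_free (N i)"
    and 0: "\<And>x. x \<in> coord_slice D c \<Longrightarrow> (\<Sum>i\<in>I. w i * indicator (U i) x) = 0"
  shows "(\<Sum>i\<in>I. if U i \<inter> coord_slice D c = {} then 0 else w i * polyhedron_value (af i) (N i) D) = 0"
  using D 0
proof (induction D arbitrary: c rule: finite_induct)
  case empty
  have s: "coord_slice {} c = {c}" by (auto simp: coord_slice_def intro: euclidean_eqI)
  have "\<not> has_recession (N i) {}" for i
    unfolding has_recession_def by (auto simp: euclidean_eq_iff[where 'a='a])
  then have "(if U i \<inter> coord_slice {} c = {} then 0 else w i * polyhedron_value (af i) (N i) {}) =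
      w i * indicator (U i) c" for i
    unfolding s by (auto simp: polyhedron_value_def indicator_def)
  then show ?case using empty.prems(2) s by simp
next
  case (insert b D)
  then have b: "b \<in> Basis" "D \<subseteq> Basis" by auto
  let ?u = "\<lambda>t. c + (t - c \<bullet> b) *\<^sub>R b"
  let ?T = "\<lambda>i. (\<lambda>x. x \<bullet> b) ` (U i \<inter> coord_slice (insert b D) c)"
  let ?e = "\<lambda>i. polyhedron_value (af i) (N i)"
  have sl: "x \<in> coord_slice D (?u t) \<longleftrightarrow> x \<in> coord_slice (insert b D) c \<and> x \<bullet> b = t" for x t
  proof -
    have *: "?u t \<bullet> b' = (if b' = b then t else c \<bullet> b')" if "b' \<in> Basis" for b'
      using that b by (auto simp: inner_add_left inner_Basis)
    have "Basis - D = insert b (Basis - insert b D)" using b insert.hyps by auto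
    then show ?thesis unfolding coord_slice_def using * b by auto
  qed
  \<comment> \<open>For each value \<open>t\<close> of the new coordinate the induction hypothesis
    relates the slices at \<open>t\<close>. The slice of \<open>U i\<close> is nonempty exactly for
    \<open>t\<close> in the shadow \<open>?T i\<close>, and its value does not depend on
    \<open>t\<close>, so the one-dimensional functional applies to the shadows with weights
    \<open>w i * ?e i D\<close>.\<close>
  have "(\<Sum>i\<in>I. (w i * ?e i D) * (if ?T i = {} then 0 else ?e i (insert b D) / ?e i D)) = 0"
  proof (rule interval_relation[OF I])
    fix i assume i: "i \<in> I" "w i * ?e i D \<noteq> 0"
    show "interval_value (?T i) (if ?T i = {} then 0 else ?e i (insert b D) / ?e i D)"
      by (rule slice_projection_value) (use insert.hyps b af[OF i(1)] na[OF i(1)] i(2) in auto)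
  next
    fix t
    have "(\<Sum>i\<in>I. if U i \<inter> coord_slice D (?u t) = {} then 0 else w i * ?e i D) = 0"
      by (rule insert.IH) (use b sl insert.prems in auto)
    moreover have "(if U i \<inter> coord_slice D (?u t) = {} then 0 else w i * ?e i D) =
      w i * ?e i D * indicator (?T i) t" for i
      using sl by (auto simp: indicator_def)
    ultimately show "(\<Sum>i\<in>I. w i * ?e i D * indicator (?T i) t) = 0" by simp
  qed
  moreover have "(w i * ?e i D) * (if ?T i = {} then 0 else ?e i (insert b D) / ?e i D) =
      (if U i \<inter> coord_slice (insert b D) c = {} then 0 else w i * ?e i (insert b D))" for i
  proof -
    \<comment> \<open>A recession direction for \<open>D\<close> is one for
      \<open>insert b D\<close> as well, so a zero denominator comes with a zero numerator.\<close>
    have "?e i (insert b D) = 0" if "?e i D = 0"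
      using that by (auto simp: polyhedron_value_def has_recession_def split: if_splits)
    then show ?thesis by auto
  qed
  ultimately show ?case by simp
qed

subsection \<open>Zaslavsky's theorem for bounded regions\<close>

lemma intersection_poset_finite: "finite \<A> \<Longrightarrow> finite (intersection_poset \<A>)"
proof -
  have "intersection_poset \<A> \<subseteq> Inter ` Pow \<A>" by (auto simp: intersection_poset_def)
  then show "finite \<A> \<Longrightarrow> finite (intersection_poset \<A>)" using finite_subset by blast
qed

lemma UNIV_in_intersection_poset: "UNIV \<in> intersection_poset \<A>"
  by (auto simp: intersection_poset_def intro!: exI[of _ "{}"])

text \<open>The condition \<open>ess\<close> excludes a direction common to all hyperplanes; hence
  every region is line-free, and an unbounded one has Euler characteristic 0. Every flat counts 1,
  which leaves the plain sum of Moebius values.\<close>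

theorem bounded_regions_count:
  fixes \<A> :: "'a::euclidean_space set set"
  assumes fin: "finite \<A>"
    and hyp: "\<And>H. H \<in> \<A> \<Longrightarrow> \<exists>a \<beta>. a \<noteq> 0 \<and> H = {x. a \<bullet> x = \<beta>}"
    and ess: "\<And>h. h \<noteq> 0 \<Longrightarrow> \<exists>H\<in>\<A>. \<exists>x\<in>H. x + h \<notin> H"
  shows "(\<Sum>F\<in>intersection_poset \<A>. moebius (intersection_poset \<A>) UNIV F) =
    (-1) ^ DIM('a) * int (card (bounded_regions \<A>))"
proof -
  obtain n \<beta> where nb: "\<And>H. H \<in> \<A> \<Longrightarrow> n H \<noteq> 0 \<and> H = {x. n H \<bullet> x = \<beta> H}"
    using hyp by metis
  let ?s = "\<lambda>H x. sgn (n H \<bullet> x - \<beta> H)"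
  define cell where "cell x = {y. \<forall>H\<in>\<A>. ?s H y = ?s H x}" for x
  define N where "N x = (\<lambda>H. (- ?s H x *\<^sub>R n H, - ?s H x * \<beta> H)) ` \<A>" for x
  let ?M = "- \<Union>\<A>"
  have s_nz: "?s H x \<noteq> 0" if "x \<in> ?M" "H \<in> \<A>" for x H
    using that nb[OF that(2)] by (auto simp: sgn_eq_0_iff)
  have cell_eq: "cell x = open_polyhedron (N x)" if x: "x \<in> ?M" for x
  proof -
    have "?s H y = ?s H x \<longleftrightarrow> (- ?s H x *\<^sub>R n H) \<bullet> y < - ?s H x * \<beta> H" if "H \<in> \<A>" for H y
    proof -
      have "?s H x = 1 \<or> ?s H x = -1" using s_nz[OF x that] by (auto simp: sgn_if split: if_splits)
      then show ?thesis by (auto simp: sgn_if split: if_splits)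
    qed
    then show ?thesis by (auto simp: cell_def open_polyhedron_def N_def)
  qed
  have N_fin: "finite (N x)" for x using fin by (simp add: N_def)
  have N_lf: "line_free (N x)" if x: "x \<in> ?M" for x
    unfolding line_free_def
  proof (intro allI impI, rule ccontr)
    fix h assume h: "\<forall>(a, \<beta>)\<in>N x. a \<bullet> h = 0" "h \<noteq> 0"
    then obtain H y where H: "H \<in> \<A>" "y \<in> H" "y + h \<notin> H" using ess by blast
    have "n H \<bullet> h = 0" using h(1) H(1) s_nz[OF x H(1)] by (auto simp: N_def)
    moreover have "n H \<bullet> y = \<beta> H" "n H \<bullet> (y + h) \<noteq> \<beta> H" using nb[OF H(1)] H by auto
    ultimately show False by (simp add: inner_add_right)
  qed
  have cell_sub: "cell x \<subseteq> ?M" if x: "x \<in> ?M" for x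
  proof
    fix y assume y: "y \<in> cell x"
    have "y \<notin> H" if "H \<in> \<A>" for H
    proof -
      have "?s H y \<noteq> 0" using y s_nz[OF x that] that by (auto simp: cell_def)
      then show ?thesis using nb[OF that] by (metis (mono_tags, lifting) diff_self mem_Collect_eq sgn_zero)
    qed
    then show "y \<in> ?M" by blast
  qed
  \<comment> \<open>A sign cell is convex, and a connected set on which some sign changes would meet
    the corresponding hyperplane.\<close>
  have comp: "connected_component_set ?M x = cell x" if x: "x \<in> ?M" for x
  proof
    show "cell x \<subseteq> connected_component_set ?M x"
    proof (rule connected_component_maximal)
      show "connected (cell x)"
        using cell_eq[OF x] open_polyhedron_properties(2)[OF N_fin] convex_connected by metis
    qed (use cell_sub[OF x] in \<open>auto simp: cell_def\<close>)
    show "connected_component_set ?M x \<subseteq> cell x"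
    proof
      fix y assume y: "y \<in> connected_component_set ?M x"
      let ?C = "connected_component_set ?M x"
      have C: "connected ?C" "?C \<subseteq> ?M" "x \<in> ?C"
        using x connected_component_subset[of ?M x] by (simp_all add: connected_component_refl)
      have "?s H y = ?s H x" if H: "H \<in> \<A>" for H
      proof (rule ccontr)
        assume ne: "?s H y \<noteq> ?s H x"
        have "?s H x \<noteq> 0" "?s H y \<noteq> 0" using s_nz[OF _ H] x y C(2) by blast+
        with ne have "n H \<bullet> x \<le> \<beta> H \<and> \<beta> H \<le> n H \<bullet> y \<or> n H \<bullet> y \<le> \<beta> H \<and> \<beta> H \<le> n H \<bullet> x"
          by (auto simp: sgn_if split: if_splits)
        then obtain z where "z \<in> ?C" "n H \<bullet> z = \<beta> H"
          using connected_ivt_hyperplane[OF C(1)] C(3) y by blast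
        then show False using C(2) nb[OF H] H by blast
      qed
      then show "y \<in> cell x" by (simp add: cell_def)
    qed
  qed
  have reg: "regions \<A> = cell ` ?M"
    unfolding regions_def components_def using comp by (auto simp: image_iff)
  have reg_fin: "finite (regions \<A>)"
  proof -
    have "regions \<A> \<subseteq> (\<lambda>\<sigma>. {y. \<forall>H\<in>\<A>. ?s H y = \<sigma> H}) ` (\<Pi>\<^sub>E H\<in>\<A>. {-1, 0, 1})"
    proof
      fix R assume "R \<in> regions \<A>"
      then obtain x where x: "R = cell x" using reg by blast
      have "R = {y. \<forall>H\<in>\<A>. ?s H y = restrict (\<lambda>H. ?s H x) \<A> H}" unfolding x cell_def by auto
      moreover have "restrict (\<lambda>H. ?s H x) \<A> \<in> (\<Pi>\<^sub>E H\<in>\<A>. {-1, 0, 1})"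
        by (auto simp: sgn_if)
      ultimately show "R \<in> (\<lambda>\<sigma>. {y. \<forall>H\<in>\<A>. ?s H y = \<sigma> H}) ` (\<Pi>\<^sub>E H\<in>\<A>. {-1, 0, 1})"
        by (rule image_eqI)
    qed
    moreover have "finite ((\<lambda>\<sigma>. {y. \<forall>H\<in>\<A>. ?s H y = \<sigma> H}) ` (\<Pi>\<^sub>E H\<in>\<A>. {-1, 0, 1}))"
      by (intro finite_imageI finite_PiE fin) simp
    ultimately show ?thesis by (rule finite_subset)
  qed
  define pt where "pt R = (SOME x. x \<in> ?M \<and> R = cell x)" for R
  have pt: "pt R \<in> ?M \<and> R = cell (pt R)" if "R \<in> regions \<A>" for R
    unfolding pt_def by (rule someI_ex) (use that reg in auto)
  let ?L = "intersection_poset \<A>"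
  have L: "finite ?L" "UNIV \<in> ?L"
    using intersection_poset_finite[OF fin] UNIV_in_intersection_poset by auto
  \<comment> \<open>The relation has one term for each flat, weighted by its Moebius value, and one
    for each region, weighted by -1; the sum type keeps the two kinds of terms apart.\<close>
  define af where "af i = (case i of Inl F \<Rightarrow> True | Inr R \<Rightarrow> False)" for i :: "'a set + 'a set"
  define NN where "NN i = (case i of Inl F \<Rightarrow> {} | Inr R \<Rightarrow> N (pt R))" for i :: "'a set + 'a set"
  define U where "U i = (case i of Inl F \<Rightarrow> F | Inr R \<Rightarrow> R)" for i :: "'a set + 'a set"
  define w where "w i = (case i of Inl F \<Rightarrow> real_of_int (moebius ?L UNIV F) | Inr R \<Rightarrow> -1)" for i :: "'a set + 'a set"
  have "(\<Sum>i\<in>?L <+> regions \<A>. if U i \<inter> coord_slice Basis 0 = {} then 0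
      else w i * polyhedron_value (af i) (NN i) Basis) = 0"
  proof (rule polyhedron_value_relation)
    fix i assume i: "i \<in> ?L <+> regions \<A>" "af i"
    then obtain F \<B> where F: "i = Inl F" "\<B> \<subseteq> \<A>" "F = \<Inter>\<B>"
      by (auto simp: af_def intersection_poset_def)
    have "affine H" if "H \<in> \<B>" for H
      using nb[of H] that F affine_hyperplane[of "n H" "\<beta> H"] by auto
    then show "affine (U i)" using F by (auto simp: U_def intro!: affine_Inter)
  next
    fix i assume i: "i \<in> ?L <+> regions \<A>" "\<not> af i"
    then obtain R where R: "i = Inr R" "R \<in> regions \<A>" by (auto simp: af_def)
    then show "finite (NN i) \<and> U i = open_polyhedron (NN i) \<and> line_free (NN i)"
      using pt[OF R(2)] N_fin N_lf cell_eq by (auto simp: NN_def U_def)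
  next
    fix x :: 'a
    \<comment> \<open>The least flat through \<open>x\<close>. A flat contains \<open>x\<close> iff
      it contains \<open>?X\<close>, so the defining equation of the Moebius function at
      \<open>?X\<close> evaluates the sum at \<open>x\<close>.\<close>
    let ?X = "\<Inter>{H\<in>\<A>. x \<in> H}"
    have X: "?X \<in> ?L" by (auto simp: intersection_poset_def)
    have "{F. F \<in> ?L \<and> x \<in> F} = {F. F \<in> ?L \<and> ?X \<subseteq> F}"
      by (auto simp: intersection_poset_def)
    then have "(\<Sum>F | F \<in> ?L \<and> x \<in> F. moebius ?L UNIV F) = (if ?X = UNIV then 1 else 0)"
      using moebius_sum_above[OF L X] by simp
    also have "?X = UNIV \<longleftrightarrow> x \<in> ?M"
    proof
      assume X1: "?X = UNIV"
      have "x \<notin> H" if H: "H \<in> \<A>" for H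
      proof
        assume "x \<in> H"
        then have "H = UNIV" using X1 H by blast
        then have "n H \<bullet> (x + n H) = \<beta> H" "n H \<bullet> x = \<beta> H" using nb[OF H] by auto
        then show False using nb[OF H] by (simp add: inner_add_right)
      qed
      then show "x \<in> ?M" by blast
    next
      assume "x \<in> ?M"
      then have "{H\<in>\<A>. x \<in> H} = {}" by blast
      then show "?X = UNIV" by (simp only: Inter_empty)
    qed
    finally have 1: "(\<Sum>F\<in>?L. real_of_int (moebius ?L UNIV F) * indicator F x) = (if x \<in> ?M then 1 else 0)"
    proof -
      assume a: "(\<Sum>F | F \<in> ?L \<and> x \<in> F. moebius ?L UNIV F) = (if x \<in> ?M then 1 else 0)"
      have "(\<Sum>F\<in>?L. real_of_int (moebius ?L UNIV F) * indicator F x) =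
          (\<Sum>F\<in>?L. if x \<in> F then real_of_int (moebius ?L UNIV F) else 0)"
        by (intro sum.cong) (auto simp: indicator_def)
      also have "\<dots> = (\<Sum>F\<in>{F. F \<in> ?L \<and> x \<in> F}. real_of_int (moebius ?L UNIV F))"
        using L(1) by (simp add: sum.inter_filter)
      also have "\<dots> = real_of_int (\<Sum>F\<in>{F. F \<in> ?L \<and> x \<in> F}. moebius ?L UNIV F)" by simp
      finally show ?thesis unfolding a by simp
    qed
    have 2: "(\<Sum>R\<in>regions \<A>. - indicator R x) = (if x \<in> ?M then - 1 else (0::real))"
    proof (cases "x \<in> ?M")
      case True
      have "R = cell x" if "R \<in> regions \<A>" "x \<in> R" for R
        using that reg by (auto simp: cell_def)
      then have "(\<Sum>R\<in>regions \<A>. - indicator R x) = (\<Sum>R\<in>{cell x}. - indicator R x :: real)"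
        using True reg reg_fin by (intro sum.mono_neutral_right) (auto simp: indicator_def)
      then show ?thesis using True by (simp add: cell_def)
    next
      case False
      then have "x \<notin> R" if "R \<in> regions \<A>" for R using that reg cell_sub by blast
      then show ?thesis using False by simp
    qed
    show "(\<Sum>i\<in>?L <+> regions \<A>. w i * indicator (U i) x) = 0"
      using 1 2 L(1) reg_fin by (subst sum.Plus) (auto simp: w_def U_def o_def)
  qed (use L reg_fin in auto)
  then have "(\<Sum>F\<in>?L. if F = {} then 0 else real_of_int (moebius ?L UNIV F)) +
      (\<Sum>R\<in>regions \<A>. if R = {} then 0 else - polyhedron_value False (N (pt R)) Basis) = 0"
    using L(1) reg_fin
    by (subst (asm) sum.Plus) (auto simp: w_def U_def o_def af_def NN_def coord_slice_def polyhedron_value_def cong: if_cong)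
  moreover have "(\<Sum>F\<in>?L. if F = {} then 0 else real_of_int (moebius ?L UNIV F)) =
      real_of_int (\<Sum>F\<in>?L. moebius ?L UNIV F)"
    unfolding of_int_sum by (intro sum.cong) (auto simp: intersection_poset_def)
  moreover have "(\<Sum>R\<in>regions \<A>. if R = {} then 0 else - polyhedron_value False (N (pt R)) Basis) =
      (\<Sum>R\<in>regions \<A>. if bounded R then - ((-1) ^ DIM('a)) else 0)"
  proof (intro sum.cong refl)
    fix R assume R: "R \<in> regions \<A>"
    have RN: "R = open_polyhedron (N (pt R))" "pt R \<in> R"
      using pt[OF R] cell_eq by (auto simp: cell_def)
    have UN: "coord_slice Basis 0 = (UNIV::'a set)" by (auto simp: coord_slice_def)
    have "bounded R \<longleftrightarrow> \<not> has_recession (N (pt R)) Basis"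
    proof
      assume "\<not> has_recession (N (pt R)) Basis"
      then show "bounded R" using no_recession_imp_bounded[OF N_fin, of "pt R" Basis 0] RN(1) UN by simp
    next
      assume bd: "bounded R"
      show "\<not> has_recession (N (pt R)) Basis"
      proof
        assume "has_recession (N (pt R)) Basis"
        then obtain h where h: "h \<noteq> 0" "\<forall>(a, \<beta>)\<in>N (pt R). a \<bullet> h \<le> 0"
          unfolding has_recession_def by blast
        obtain B where B: "\<And>x. x \<in> R \<Longrightarrow> norm x \<le> B" using bd unfolding bounded_iff by blast
        define t where "t = (B + norm (pt R) + 1) / norm h"
        have B0: "0 \<le> B" using B[OF RN(2)] norm_ge_zero order_trans by blast
        then have t: "t \<ge> 0" by (simp add: t_def)
        have "pt R + t *\<^sub>R h \<in> R"
          using recession_ray[of "pt R" "N (pt R)" Basis 0 h t] RN UN h t by auto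
        then have "norm (pt R + t *\<^sub>R h) \<le> B" by (rule B)
        moreover have "norm (t *\<^sub>R h) \<le> norm (pt R + t *\<^sub>R h) + norm (pt R)"
          by (metis add_diff_cancel_left' norm_triangle_ineq4)
        moreover have "norm (t *\<^sub>R h) = B + norm (pt R) + 1" using h(1) t B0 by (simp add: t_def)
        ultimately show False by linarith
      qed
    qed
    then show "(if R = {} then 0 else - polyhedron_value False (N (pt R)) Basis) =
        (if bounded R then - ((-1) ^ DIM('a)) else 0)"
      using RN(2) by (auto simp: polyhedron_value_def)
  qed
  moreover have "\<dots> = - ((-1) ^ DIM('a)) * real (card (bounded_regions \<A>))"
    using reg_fin by (simp add: bounded_regions_def sum.inter_filter[symmetric])
  ultimately have "real_of_int (\<Sum>F\<in>?L. moebius ?L UNIV F) = real_of_int ((-1) ^ DIM('a) * int (card (bounded_regions \<A>)))"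
    by simp
  then show ?thesis by (simp only: of_int_eq_iff)
qed

subsection \<open>Independent families and minors\<close>

text \<open>Independence of a family rather than of its image: equal vectors at different indices
  count as dependent. All bookkeeping can then be done with index sets.\<close>

definition ind_fam :: "('i \<Rightarrow> 'a::real_vector) \<Rightarrow> 'i set \<Rightarrow> bool" where
  "ind_fam v S \<longleftrightarrow> inj_on v S \<and> independent (v ` S)"

lemma ind_fam_iff:
  assumes "finite S"
  shows "ind_fam v S \<longleftrightarrow> (\<forall>u. (\<Sum>i\<in>S. u i *\<^sub>R v i) = 0 \<longrightarrow> (\<forall>i\<in>S. u i = 0))"
proof
  assume *: "ind_fam v S"
  show "\<forall>u. (\<Sum>i\<in>S. u i *\<^sub>R v i) = 0 \<longrightarrow> (\<forall>i\<in>S. u i = 0)"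
  proof (intro allI impI ballI)
    fix u i assume u: "(\<Sum>i\<in>S. u i *\<^sub>R v i) = 0" and i: "i \<in> S"
    have inj: "inj_on v S" using * by (simp add: ind_fam_def)
    have "(\<Sum>x\<in>v ` S. u (the_inv_into S v x) *\<^sub>R x) = (\<Sum>i\<in>S. u i *\<^sub>R v i)"
      using inj by (subst sum.reindex) (auto simp: the_inv_into_f_f intro!: sum.cong)
    then have "\<forall>x\<in>v ` S. u (the_inv_into S v x) = 0"
      using * u assms independentD[of "v ` S" "v ` S" "\<lambda>x. u (the_inv_into S v x)"]
      by (auto simp: ind_fam_def)
    then show "u i = 0" using i inj by (auto simp: the_inv_into_f_f)
  qed
next
  assume *: "\<forall>u. (\<Sum>i\<in>S. u i *\<^sub>R v i) = 0 \<longrightarrow> (\<forall>i\<in>S. u i = 0)"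
  have inj: "inj_on v S"
  proof (rule inj_onI, rule ccontr)
    fix i j assume ij: "i \<in> S" "j \<in> S" "v i = v j" "i \<noteq> j"
    let ?u = "\<lambda>l. if l = i then 1 else if l = j then - 1 else 0::real"
    have "(\<Sum>l\<in>S. ?u l *\<^sub>R v l) = (\<Sum>l\<in>{i, j}. ?u l *\<^sub>R v l)"
      by (rule sum.mono_neutral_right) (use assms ij in auto)
    also have "\<dots> = 0" using ij by simp
    finally show False using *[rule_format, of ?u i] ij(1) by simp
  qed
  have "independent (v ` S)"
  proof (rule independent_if_scalars_zero)
    fix f x assume f: "(\<Sum>x\<in>v ` S. f x *\<^sub>R x) = 0" "x \<in> v ` S"
    have "(\<Sum>i\<in>S. f (v i) *\<^sub>R v i) = 0" using f(1) inj by (subst (asm) sum.reindex) (auto simp: o_def)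
    then have "\<forall>i\<in>S. f (v i) = 0" using *[rule_format, of "\<lambda>i. f (v i)"] by blast
    then show "f x = 0" using f(2) by auto
  qed (use assms in auto)
  then show "ind_fam v S" using inj by (simp add: ind_fam_def)
qed

lemma ind_famD:
  assumes "ind_fam v S" "finite S" "(\<Sum>i\<in>S. u i *\<^sub>R v i) = 0" "i \<in> S"
  shows "u i = 0"
  using ind_fam_iff[OF assms(2), THEN iffD1, rule_format, OF assms(1,3,4)] .

lemma ind_fam_mono: "ind_fam v S \<Longrightarrow> T \<subseteq> S \<Longrightarrow> ind_fam v T"
  unfolding ind_fam_def by (meson image_mono independent_mono inj_on_subset)

lemma ind_fam_cong: "(\<And>i. i \<in> S \<Longrightarrow> v i = w i) \<Longrightarrow> ind_fam v S \<longleftrightarrow> ind_fam w S"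
  unfolding ind_fam_def by (metis image_cong inj_on_cong)

lemma ind_fam_comp: "inj_on f S \<Longrightarrow> ind_fam (v \<circ> f) S \<longleftrightarrow> ind_fam v (f ` S)"
  unfolding ind_fam_def image_comp[symmetric] by (metis comp_inj_on_iff)

lemma ind_fam_insert:
  assumes "j \<notin> S"
  shows "ind_fam v (insert j S) \<longleftrightarrow> ind_fam v S \<and> v j \<notin> span (v ` S)"
proof
  assume *: "ind_fam v (insert j S)"
  then have "v j \<notin> v ` S" using assms by (auto simp: ind_fam_def)
  then show "ind_fam v S \<and> v j \<notin> span (v ` S)"
    using * assms by (auto simp: ind_fam_def independent_insert)
next
  assume *: "ind_fam v S \<and> v j \<notin> span (v ` S)"
  then have "v j \<notin> v ` S" using span_base[of "v j" "v ` S"] by auto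
  then show "ind_fam v (insert j S)"
    using * assms by (auto simp: ind_fam_def independent_insert)
qed

lemma dim_ind_fam:
  fixes v :: "'i \<Rightarrow> 'a::euclidean_space"
  shows "ind_fam v S \<Longrightarrow> dim (span (v ` S)) = card S"
  by (simp add: ind_fam_def dim_eq_card_independent card_image)

lemma sum_in_span_image: "(\<Sum>i\<in>S. u i *\<^sub>R v i) \<in> span (v ` S)"
  by (intro span_sum span_scale span_base imageI)

lemma span_image_iff:
  assumes "finite S"
  shows "x \<in> span (v ` S) \<longleftrightarrow> (\<exists>u. x = (\<Sum>i\<in>S. u i *\<^sub>R v i))"
proof
  assume "x \<in> span (v ` S)"
  then show "\<exists>u. x = (\<Sum>i\<in>S. u i *\<^sub>R v i)"
  proof (induction rule: span_induct_alt)
    case base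
    show ?case by (rule exI[of _ "\<lambda>_. 0"]) simp
  next
    case (step c x y)
    then obtain u i where ui: "y = (\<Sum>i\<in>S. u i *\<^sub>R v i)" "i \<in> S" "x = v i" by blast
    have "c *\<^sub>R x + y = (\<Sum>j\<in>S. (if j = i then c *\<^sub>R v j else 0) + u j *\<^sub>R v j)"
      using ui assms by (simp add: sum.distrib sum.delta)
    also have "\<dots> = (\<Sum>j\<in>S. ((if j = i then c else 0) + u j) *\<^sub>R v j)"
      by (intro sum.cong) (auto simp: scaleR_add_left)
    finally have eq: "c *\<^sub>R x + y = (\<Sum>j\<in>S. ((if j = i then c else 0) + u j) *\<^sub>R v j)" .
    show ?case by (rule exI, rule eq)
  qed
next
  assume "\<exists>u. x = (\<Sum>i\<in>S. u i *\<^sub>R v i)"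
  then show "x \<in> span (v ` S)" using sum_in_span_image by blast
qed

lemma ind_fam_span_Int:
  assumes ind: "ind_fam v S" and S: "finite S" "A \<subseteq> S" "B \<subseteq> S"
  shows "span (v ` A) \<inter> span (v ` B) = span (v ` (A \<inter> B))"
proof
  show "span (v ` (A \<inter> B)) \<subseteq> span (v ` A) \<inter> span (v ` B)"
    by (intro Int_greatest span_mono) auto
  have fin: "finite A" "finite B" using finite_subset[OF S(2,1)] finite_subset[OF S(3,1)] by auto
  show "span (v ` A) \<inter> span (v ` B) \<subseteq> span (v ` (A \<inter> B))"
  proof
    fix x assume x: "x \<in> span (v ` A) \<inter> span (v ` B)"
    from x[THEN IntD1, unfolded span_image_iff[OF fin(1)]]
    obtain a where a: "x = (\<Sum>i\<in>A. a i *\<^sub>R v i)" by (rule exE)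
    from x[THEN IntD2, unfolded span_image_iff[OF fin(2)]]
    obtain b where b: "x = (\<Sum>i\<in>B. b i *\<^sub>R v i)" by (rule exE)
    let ?u = "\<lambda>i. (if i \<in> A then a i else 0) - (if i \<in> B then b i else 0)"
    have ext: "(\<Sum>i\<in>D. c i *\<^sub>R v i) = (\<Sum>i\<in>S. (if i \<in> D then c i else 0) *\<^sub>R v i)"
      if "D \<subseteq> S" for c D
    proof -
      have "(\<Sum>i\<in>D. c i *\<^sub>R v i) = (\<Sum>i\<in>D. (if i \<in> D then c i else 0) *\<^sub>R v i)"
        by (rule sum.cong) auto
      also have "\<dots> = (\<Sum>i\<in>S. (if i \<in> D then c i else 0) *\<^sub>R v i)"
        by (rule sum.mono_neutral_left) (use S that in auto)
      finally show ?thesis .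
    qed
    have "(\<Sum>i\<in>S. ?u i *\<^sub>R v i) = x - x"
      using a b ext[OF S(2), of a] ext[OF S(3), of b] by (simp add: scaleR_diff_left sum_subtractf)
    then have "?u i = 0" if "i \<in> S" for i using ind_famD[OF ind S(1), of ?u i] that by simp
    then have "a i = 0" if "i \<in> A - B" for i using that S by fastforce
    then have "x = (\<Sum>i\<in>A \<inter> B. a i *\<^sub>R v i)" unfolding a
      by (intro sum.mono_neutral_right) (use fin in auto)
    then show "x \<in> span (v ` (A \<inter> B))" using sum_in_span_image by simp
  qed
qed

section \<open>Minors, rank and stability under perturbation\<close>

lemma minor_nonzero_iff_columns:
  assumes "distinct cs" "length rs = length cs"
  shows "minor C rs cs \<noteq> 0 \<longleftrightarrow>
    (\<forall>u. (\<forall>r\<in>set rs. (\<Sum>c\<in>set cs. C r c * u c) = 0) \<longrightarrow> (\<forall>c\<in>set cs. u c = 0))"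
proof -
  let ?n = "length cs"
  let ?A = "Matrix.mat ?n ?n (\<lambda>(a, b). C (rs ! a) (cs ! b))"
  have A: "?A \<in> carrier_mat ?n ?n" by simp
  have bij: "bij_betw ((!) cs) {0..<?n} (set cs)"
    using bij_betw_nth[OF assms(1), of "{0..<?n}" "set cs"] by (simp add: lessThan_atLeast0)
  have prod: "(?A *\<^sub>v w = 0\<^sub>v ?n) \<longleftrightarrow> (\<forall>r\<in>set rs. (\<Sum>c\<in>set cs. C r c * u c) = 0)"
    if w: "w \<in> carrier_vec ?n" and u: "\<And>b. b < ?n \<Longrightarrow> vec_index w b = u (cs ! b)" for w u
  proof -
    have "vec_index (?A *\<^sub>v w) a = (\<Sum>c\<in>set cs. C (rs ! a) c * u c)" if a: "a < ?n" for a
    proof -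
      have "vec_index (?A *\<^sub>v w) a = (\<Sum>b\<in>{0..<?n}. C (rs ! a) (cs ! b) * u (cs ! b))"
        using a w u by (auto simp: scalar_prod_def intro!: sum.cong)
      also have "\<dots> = (\<Sum>c\<in>set cs. C (rs ! a) c * u c)"
        by (rule sum.reindex_bij_betw[OF bij, of "\<lambda>c. C (rs ! a) c * u c"])
      finally show ?thesis .
    qed
    moreover have "(?A *\<^sub>v w = 0\<^sub>v ?n) \<longleftrightarrow> (\<forall>a<?n. vec_index (?A *\<^sub>v w) a = 0)"
      by (auto simp: vec_eq_iff)
    ultimately show ?thesis by (simp add: all_set_conv_all_nth assms(2))
  qed
  have "minor C rs cs = 0 \<longleftrightarrow> (\<exists>w. w \<in> carrier_vec ?n \<and> w \<noteq> 0\<^sub>v ?n \<and> ?A *\<^sub>v w = 0\<^sub>v ?n)"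
    unfolding minor_def using det_0_iff_vec_prod_zero[OF A] assms(2) by simp
  also have "\<dots> \<longleftrightarrow> (\<exists>u. (\<forall>r\<in>set rs. (\<Sum>c\<in>set cs. C r c * u c) = 0) \<and> (\<exists>c\<in>set cs. u c \<noteq> 0))"
  proof
    assume "\<exists>w. w \<in> carrier_vec ?n \<and> w \<noteq> 0\<^sub>v ?n \<and> ?A *\<^sub>v w = 0\<^sub>v ?n"
    then obtain w where w: "w \<in> carrier_vec ?n" "w \<noteq> 0\<^sub>v ?n" "?A *\<^sub>v w = 0\<^sub>v ?n" by blast
    define u where "u = (\<lambda>c. vec_index w (the_inv_into {0..<?n} ((!) cs) c))"
    have u: "u (cs ! b) = vec_index w b" if "b < ?n" for b
      using that bij by (simp add: u_def bij_betw_def the_inv_into_f_f)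
    moreover obtain b where "b < ?n" "vec_index w b \<noteq> 0" using w by (auto simp: vec_eq_iff)
    ultimately have "\<exists>c\<in>set cs. u c \<noteq> 0" by (metis nth_mem)
    then show "\<exists>u. (\<forall>r\<in>set rs. (\<Sum>c\<in>set cs. C r c * u c) = 0) \<and> (\<exists>c\<in>set cs. u c \<noteq> 0)"
      using prod[OF w(1) u[symmetric]] w(3) by blast
  next
    assume "\<exists>u. (\<forall>r\<in>set rs. (\<Sum>c\<in>set cs. C r c * u c) = 0) \<and> (\<exists>c\<in>set cs. u c \<noteq> 0)"
    then obtain u where u: "\<forall>r\<in>set rs. (\<Sum>c\<in>set cs. C r c * u c) = 0" "\<exists>c\<in>set cs. u c \<noteq> 0" by blast
    let ?w = "Matrix.vec ?n (\<lambda>b. u (cs ! b))"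
    have "?A *\<^sub>v ?w = 0\<^sub>v ?n" by (subst prod[of _ u]) (use u in auto)
    moreover have "?w \<noteq> 0\<^sub>v ?n" using u(2) by (auto simp: in_set_conv_nth vec_eq_iff)
    ultimately show "\<exists>w. w \<in> carrier_vec ?n \<and> w \<noteq> 0\<^sub>v ?n \<and> ?A *\<^sub>v w = 0\<^sub>v ?n"
      by (intro exI[of _ ?w]) auto
  qed
  finally show ?thesis by blast
qed

lemma minor_transpose:
  assumes "length rs = length cs"
  shows "minor C rs cs = minor (\<lambda>c r. C r c) cs rs"
proof -
  let ?A = "Matrix.mat (length rs) (length cs) (\<lambda>(a, b). C (rs ! a) (cs ! b))"
  have "Matrix.mat (length cs) (length rs) (\<lambda>(a, b). C (rs ! b) (cs ! a)) = transpose_mat ?A"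
    by (rule eq_matI) auto
  then show ?thesis unfolding minor_def using assms det_transpose[of ?A "length cs"] by simp
qed

lemma minor_nonzero_iff_rows:
  assumes "distinct rs" "length rs = length cs"
  shows "minor C rs cs \<noteq> 0 \<longleftrightarrow>
    (\<forall>u. (\<forall>c\<in>set cs. (\<Sum>r\<in>set rs. u r * C r c) = 0) \<longrightarrow> (\<forall>r\<in>set rs. u r = 0))"
  unfolding minor_transpose[OF assms(2)]
  by (subst minor_nonzero_iff_columns) (use assms in \<open>simp_all add: mult.commute\<close>)

lemma tendsto_minor:
  fixes C :: "'x \<Rightarrow> 'a \<Rightarrow> 'b \<Rightarrow> real"
  assumes "\<And>r c. r \<in> set rs \<Longrightarrow> c \<in> set cs \<Longrightarrow> ((\<lambda>x. C x r c) \<longlongrightarrow> C0 r c) F"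
    and len: "length rs = length cs"
  shows "((\<lambda>x. minor (C x) rs cs) \<longlongrightarrow> minor C0 rs cs) F"
proof -
  let ?n = "length cs"
  have "minor C rs cs = (\<Sum>p\<in>{p. p permutes {0..<?n}}. signof p * (\<Prod>i = 0..<?n. C (rs ! i) (cs ! p i)))"
    for C :: "'a \<Rightarrow> 'b \<Rightarrow> real"
  proof -
    have "minor C rs cs = (\<Sum>p\<in>{p. p permutes {0..<?n}}. signof p *
        (\<Prod>i = 0..<?n. Matrix.mat ?n ?n (\<lambda>(a, b). C (rs ! a) (cs ! b)) $$ (i, p i)))"
      unfolding minor_def len by (rule det_def') simp
    also have "\<dots> = (\<Sum>p\<in>{p. p permutes {0..<?n}}. signof p * (\<Prod>i = 0..<?n. C (rs ! i) (cs ! p i)))"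
      by (intro sum.cong prod.cong arg_cong2[of _ _ _ _ "(*)"] refl)
        (use permutes_in_image[of _ "{0..<?n}"] in \<open>force\<close>)
    finally show ?thesis .
  qed
  note m = this
  show ?thesis unfolding m
  proof (intro tendsto_sum tendsto_mult tendsto_const tendsto_prod)
    fix p i assume "p \<in> {p. p permutes {0..<?n}}" "i \<in> {0..<?n}"
    moreover from this have "p i \<in> {0..<?n}" using permutes_in_image[of p "{0..<?n}" i] by simp
    ultimately show "((\<lambda>x. C x (rs ! i) (cs ! p i)) \<longlongrightarrow> C0 (rs ! i) (cs ! p i)) F"
      by (intro assms) (auto simp: len)
  qed
qed

text \<open>A matrix of full row rank on the columns \<open>Q\<close> has a nonsingular square
  submatrix there. The rows, truncated to \<open>Q\<close>, are extended to a basis by unit vectors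
  with indices in \<open>K\<close>; the remaining coordinates \<open>Q - K\<close> suffice, since a
  combination of rows vanishing on them lies in the span of those unit vectors too and is therefore
  0.\<close>

lemma select_coordinates:
  fixes C :: "'b \<Rightarrow> real ^ 'r"
  assumes B: "finite B"
    and H: "\<And>u. (\<And>r. r \<in> Q \<Longrightarrow> (\<Sum>S\<in>B. u S * C S $ r) = 0) \<Longrightarrow> \<forall>S\<in>B. u S = 0"
  obtains R where "R \<subseteq> Q" "card R = card B"
    "\<And>u. (\<And>r. r \<in> R \<Longrightarrow> (\<Sum>S\<in>B. u S * C S $ r) = 0) \<Longrightarrow> \<forall>S\<in>B. u S = 0"
proof -
  define C' where "C' S = (\<chi> r. if r \<in> Q then C S $ r else 0)" for S
  have C'_comb: "(\<Sum>S\<in>B. u S *\<^sub>R C' S) $ r = (if r \<in> Q then (\<Sum>S\<in>B. u S * C S $ r) else 0)" for u r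
    by (simp add: C'_def)
  have ind: "ind_fam C' B" unfolding ind_fam_iff[OF B]
  proof (intro allI impI)
    fix u assume u: "(\<Sum>S\<in>B. u S *\<^sub>R C' S) = 0"
    show "\<forall>S\<in>B. u S = 0"
    proof (rule H)
      fix r assume "r \<in> Q"
      then show "(\<Sum>S\<in>B. u S * C S $ r) = 0" using C'_comb[of u r] u by simp
    qed
  qed
  let ?ax = "\<lambda>r::'r. axis r (1::real)"
  have ax_inj: "inj_on ?ax A" for A by (auto simp: inj_on_def axis_eq_axis)
  have ax_ind: "independent (?ax ` A)" for A
    by (rule independent_mono[OF independent_Basis]) (auto simp: Basis_vec_def)
  have in_ax: "x \<in> span (?ax ` A)" if "\<And>r. r \<notin> A \<Longrightarrow> x $ r = 0" for x :: "real^'r" and A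
  proof -
    have "x = (\<Sum>r\<in>UNIV. x $ r *\<^sub>R ?ax r)"
      using basis_expansion[of x] by (simp add: scalar_mult_eq_scaleR)
    also have "\<dots> = (\<Sum>r\<in>A. x $ r *\<^sub>R ?ax r)"
      by (rule sum.mono_neutral_right) (use that in auto)
    finally show ?thesis by (metis (no_types, lifting) image_eqI span_base span_scale span_sum)
  qed
  obtain B' where B': "C' ` B \<subseteq> B'" "B' \<subseteq> C' ` B \<union> ?ax ` Q" "independent B'" "C' ` B \<union> ?ax ` Q \<subseteq> span B'"
    using maximal_independent_subset_extend[of "C' ` B" "C' ` B \<union> ?ax ` Q"] ind
    by (auto simp: ind_fam_def)
  have "C' S \<in> span (?ax ` Q)" for S by (rule in_ax) (simp add: C'_def)
  then have "span B' = span (?ax ` Q)"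
  proof (intro subset_antisym span_minimal subspace_span)
    show "B' \<subseteq> span (?ax ` Q)" using B'(2) \<open>\<And>S. C' S \<in> span (?ax ` Q)\<close> span_superset[of "?ax ` Q"] by blast
    show "?ax ` Q \<subseteq> span B'" using B'(4) by blast
  qed
  then have cardB': "card B' = card Q"
    using dim_eq_card_independent[OF B'(3)] dim_eq_card_independent[OF ax_ind[of Q]] card_image[OF ax_inj[of Q]]
    by (metis dim_span)
  define K where "K = {r \<in> Q. ?ax r \<in> B' - C' ` B}"
  have axK: "?ax ` K = B' - C' ` B" using B'(2) by (auto simp: K_def)
  have finB': "finite B'" using B'(3) finiteI_independent by blast
  have "card K = card B' - card B"
  proof -
    have "card K = card (?ax ` K)" by (rule card_image[OF ax_inj, symmetric])
    also have "\<dots> = card B' - card (C' ` B)" unfolding axK using B'(1) B by (intro card_Diff_subset) auto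
    also have "card (C' ` B) = card B" using ind by (simp add: ind_fam_def card_image)
    finally show ?thesis .
  qed
  moreover have "card B \<le> card B'"
    using card_mono[OF finB' B'(1)] ind by (simp add: ind_fam_def card_image)
  ultimately have cardR: "card (Q - K) = card B"
    using cardB' card_Diff_subset[of K Q] by (auto simp: K_def)
  show ?thesis
  proof (rule that[of "Q - K"])
    fix u assume u: "\<And>r. r \<in> Q - K \<Longrightarrow> (\<Sum>S\<in>B. u S * C S $ r) = 0"
    let ?y = "\<Sum>S\<in>B. u S *\<^sub>R C' S"
    have "?y \<in> span (?ax ` K)" by (rule in_ax) (use C'_comb u in auto)
    moreover have "?y \<in> span (C' ` B)" by (rule sum_in_span_image)
    moreover have "span (id ` (C' ` B)) \<inter> span (id ` (B' - C' ` B)) = {0}"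
      by (subst ind_fam_span_Int[of id B']) (use B' finB' in \<open>auto simp: ind_fam_def\<close>)
    ultimately have "?y = 0" unfolding axK by auto
    then show "\<forall>S\<in>B. u S = 0" using ind ind_fam_iff[OF B] by blast
  qed (use cardR in auto)
qed

lemma ind_fam_nonzero_minor:
  fixes C :: "'b \<Rightarrow> real ^ 'r::{finite,linorder}"
  assumes "finite B" "ind_fam C B" "set Ss = B" "distinct Ss"
  obtains rs where "distinct rs" "length rs = length Ss" "minor (\<lambda>S r. C S $ r) Ss rs \<noteq> 0"
proof -
  obtain R where R: "card R = card B" "\<And>u. (\<And>r. r \<in> R \<Longrightarrow> (\<Sum>S\<in>B. u S * C S $ r) = 0) \<Longrightarrow> \<forall>S\<in>B. u S = 0"
  proof (rule select_coordinates[OF assms(1), of UNIV C])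
    fix u assume "\<And>r. r \<in> UNIV \<Longrightarrow> (\<Sum>S\<in>B. u S * C S $ r) = 0"
    then have "(\<Sum>S\<in>B. u S *\<^sub>R C S) = 0" by (simp add: Finite_Cartesian_Product.vec_eq_iff)
    then show "\<forall>S\<in>B. u S = 0" using assms ind_fam_iff by blast
  qed blast
  let ?rs = "sorted_list_of_set R"
  have len: "length Ss = length ?rs" using R(1) assms distinct_card[OF assms(4)] by simp
  have "minor (\<lambda>S r. C S $ r) Ss ?rs \<noteq> 0"
    by (subst minor_nonzero_iff_rows) (use assms len R(2) in auto)
  then show ?thesis using that[of ?rs] len by simp
qed

lemma nonzero_minor_ind_fam:
  fixes C :: "'b \<Rightarrow> real ^ 'r::{finite,linorder}"
  assumes "distinct Ss" "length Ss = length rs" "minor (\<lambda>S r. C S $ r) Ss rs \<noteq> 0"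
  shows "ind_fam C (set Ss)"
  unfolding ind_fam_iff[OF finite_set]
proof (intro allI impI)
  fix u assume "(\<Sum>S\<in>set Ss. u S *\<^sub>R C S) = 0"
  then have "(\<Sum>S\<in>set Ss. u S *\<^sub>R C S) $ r = 0" for r by simp
  then show "\<forall>S\<in>set Ss. u S = 0"
    using assms(3) unfolding minor_nonzero_iff_rows[OF assms(1,2)] by simp
qed

text \<open>Independence is witnessed by a single nonzero minor, hence it is an open condition. The
  perturbation arguments all rest on this.\<close>

lemma eventually_ind_fam:
  fixes C :: "'x \<Rightarrow> 'b \<Rightarrow> real ^ 'r::{finite,linorder}"
  assumes "finite B" "\<And>S. S \<in> B \<Longrightarrow> ((\<lambda>x. C x S) \<longlongrightarrow> C0 S) F" "ind_fam C0 B"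
  shows "\<forall>\<^sub>F x in F. ind_fam (C x) B"
proof -
  obtain Ss where Ss: "set Ss = B" "distinct Ss" using finite_distinct_list[OF assms(1)] by blast
  obtain rs where rs: "length rs = length Ss" "minor (\<lambda>S r. C0 S $ r) Ss rs \<noteq> 0"
    using ind_fam_nonzero_minor[OF assms(1,3) Ss] by blast
  have "((\<lambda>x. minor (\<lambda>S r. C x S $ r) Ss rs) \<longlongrightarrow> minor (\<lambda>S r. C0 S $ r) Ss rs) F"
    by (rule tendsto_minor) (use assms(2) Ss rs in \<open>auto intro: tendsto_vec_nth\<close>)
  then have "\<forall>\<^sub>F x in F. minor (\<lambda>S r. C x S $ r) Ss rs \<noteq> 0"
    using rs(2) tendsto_imp_eventually_ne by blast
  then show ?thesis
    by (rule eventually_mono) (use nonzero_minor_ind_fam[OF Ss(2)] rs(1) Ss(1) in metis)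
qed

subsection \<open>Normal vectors of spanned hyperplanes\<close>

definition normal :: "(nat \<Rightarrow> real ^ 'r::{finite,linorder}) \<Rightarrow> nat set \<Rightarrow> real ^ 'r::{finite,linorder}" where
  "normal v S = (\<chi> r. hyperplane_coeff v S r)"

text \<open>Up to sign the entries of the normal are the maximal minors of the matrix with columns
  \<open>v j\<close>, and these detect full rank.\<close>

lemma normal_nonzero_iff:
  fixes v :: "nat \<Rightarrow> real ^ 'r::{finite,linorder}"
  assumes S: "finite S" "card S = CARD('r) - 1"
  shows "normal v S \<noteq> 0 \<longleftrightarrow> ind_fam v S"
proof -
  let ?cs = "sorted_list_of_set S"
  have len: "length (sorted_list_of_set (UNIV - {r})) = length ?cs" for r :: 'r
    using S by (simp add: card_Diff_singleton)
  have m: "minor (\<lambda>s j. v j $ s) (sorted_list_of_set (UNIV - {r})) ?cs \<noteq> 0 \<longleftrightarrow>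
    (\<forall>u. (\<forall>s\<in>UNIV - {r}. (\<Sum>j\<in>S. v j $ s * u j) = 0) \<longrightarrow> (\<forall>j\<in>S. u j = 0))" for r
    by (subst minor_nonzero_iff_columns[OF _ len]) (use S in auto)
  have "normal v S \<noteq> 0 \<longleftrightarrow> (\<exists>r. minor (\<lambda>s j. v j $ s) (sorted_list_of_set (UNIV - {r})) ?cs \<noteq> 0)"
    by (auto simp: normal_def hyperplane_coeff_def Finite_Cartesian_Product.vec_eq_iff)
  also have "\<dots> \<longleftrightarrow> ind_fam v S"
  proof
    assume "\<exists>r. minor (\<lambda>s j. v j $ s) (sorted_list_of_set (UNIV - {r})) ?cs \<noteq> 0"
    then obtain r where r: "\<And>u. (\<forall>s\<in>UNIV - {r}. (\<Sum>j\<in>S. v j $ s * u j) = 0) \<Longrightarrow> (\<forall>j\<in>S. u j = 0)"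
      unfolding m by blast
    show "ind_fam v S" unfolding ind_fam_iff[OF S(1)]
    proof (intro allI impI, rule r, rule ballI)
      fix u s assume "(\<Sum>i\<in>S. u i *\<^sub>R v i) = 0"
      then have "(\<Sum>i\<in>S. u i *\<^sub>R v i) $ s = 0" by simp
      then show "(\<Sum>j\<in>S. v j $ s * u j) = 0" by (simp add: mult.commute)
    qed
  next
    assume ind: "ind_fam v S"
    obtain R where R: "card R = card S" "\<And>u. (\<And>r. r \<in> R \<Longrightarrow> (\<Sum>j\<in>S. u j * v j $ r) = 0) \<Longrightarrow> \<forall>j\<in>S. u j = 0"
    proof (rule select_coordinates[OF S(1), of UNIV v])
      fix u assume "\<And>r. r \<in> UNIV \<Longrightarrow> (\<Sum>j\<in>S. u j * v j $ r) = 0"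
      then have "(\<Sum>j\<in>S. u j *\<^sub>R v j) = 0" by (simp add: Finite_Cartesian_Product.vec_eq_iff)
      then show "\<forall>j\<in>S. u j = 0" using ind ind_fam_iff S by blast
    qed blast
    have "card (UNIV - R) = 1" using R(1) S(2) by (simp add: card_Diff_subset)
    then obtain r where "UNIV - R = {r}" using card_1_singletonE by blast
    then have "UNIV - {r} = R" by blast
    have "minor (\<lambda>s j. v j $ s) (sorted_list_of_set (UNIV - {r})) ?cs \<noteq> 0"
      unfolding m
    proof (intro allI impI)
      fix u assume "\<forall>s\<in>UNIV - {r}. (\<Sum>j\<in>S. v j $ s * u j) = 0"
      then show "\<forall>j\<in>S. u j = 0" using R(2)[of u] \<open>UNIV - {r} = R\<close> by (simp add: mult.commute)
    qed
    then show "\<exists>r. minor (\<lambda>s j. v j $ s) (sorted_list_of_set (UNIV - {r})) ?cs \<noteq> 0" by blast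
  qed
  finally show ?thesis .
qed

lemma remove1_nth: "distinct xs \<Longrightarrow> i < length xs \<Longrightarrow> remove1 (xs ! i) xs = take i xs @ drop (Suc i) xs"
proof -
  assume *: "distinct xs" "i < length xs"
  have "xs = take i xs @ xs ! i # drop (Suc i) xs" using id_take_nth_drop[OF *(2)] .
  moreover have "xs ! i \<notin> set (take i xs)" using * by (auto simp: in_set_conv_nth nth_eq_iff_index_eq)
  ultimately show ?thesis by (metis remove1.simps(2) remove1_append)
qed

lemma row_number_sorted_nth:
  assumes "i < CARD('r)"
  shows "row_number (sorted_list_of_set (UNIV :: 'r::{finite,linorder} set) ! i) = Suc i"
proof -
  let ?xs = "sorted_list_of_set (UNIV :: 'r set)"
  have xs: "sorted_wrt (<) ?xs" "set ?xs = UNIV" "length ?xs = CARD('r)"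
    using strict_sorted_list_of_set[of "UNIV :: 'r set"] by auto
  have "{s. s \<le> ?xs ! i} = (!) ?xs ` {..i}"
  proof (intro equalityI subsetI)
    fix s assume s: "s \<in> {s. s \<le> ?xs ! i}"
    obtain j where j: "j < CARD('r)" "s = ?xs ! j" using xs by (metis UNIV_I in_set_conv_nth)
    have "j \<le> i"
    proof (rule ccontr)
      assume "\<not> j \<le> i"
      then have "?xs ! i < ?xs ! j" using sorted_wrt_nth_less[OF xs(1), of i j] j xs(3) by simp
      then show False using s j by simp
    qed
    then show "s \<in> (!) ?xs ` {..i}" using j by blast
  next
    fix s assume "s \<in> (!) ?xs ` {..i}"
    then obtain j where "j \<le> i" "s = ?xs ! j" by blast
    then show "s \<in> {s. s \<le> ?xs ! i}"
      using sorted_wrt_nth_less[OF xs(1), of j i] assms xs(3) by (cases "j = i") auto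
  qed
  moreover have "inj_on ((!) ?xs) {..i}"
    using assms xs(3) by (auto simp: inj_on_def nth_eq_iff_index_eq)
  ultimately show ?thesis unfolding row_number_def by (simp add: card_image)
qed

text \<open>The normal is a generalized cross product: its inner product with \<open>v j\<close> is
  the Laplace expansion of a determinant in which the column \<open>v j\<close> occurs
  twice.\<close>

lemma inner_normal:
  fixes v :: "nat \<Rightarrow> real ^ 'r::{finite,linorder}"
  assumes S: "finite S" "card S = CARD('r) - 1" "j \<in> S"
  shows "normal v S \<bullet> v j = 0"
proof -
  let ?n = "CARD('r)"
  let ?xs = "sorted_list_of_set (UNIV :: 'r set)"
  let ?ys = "sorted_list_of_set S"
  have xs: "distinct ?xs" "set ?xs = UNIV" "length ?xs = ?n" by auto
  have ys: "distinct ?ys" "set ?ys = S" "length ?ys = ?n - 1" using S by auto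
  define A where "A = Matrix.mat ?n ?n (\<lambda>(i, b). if b = 0 then v j $ (?xs ! i) else v (?ys ! (b - 1)) $ (?xs ! i))"
  have A: "A \<in> carrier_mat ?n ?n" by (simp add: A_def)
  have n0: "0 < ?n" by simp
  have bij: "bij_betw ((!) ?xs) {..<?n} UNIV" using bij_betw_nth[OF xs(1)] xs by auto
  have cof: "cofactor A i 0 = normal v S $ (?xs ! i)" if i: "i < ?n" for i
  proof -
    have sl: "sorted_list_of_set (UNIV - {?xs ! i}) = take i ?xs @ drop (Suc i) ?xs"
      using remove1_nth[OF xs(1)] i xs(3) by (simp add: sorted_list_of_set_remove)
    have "mat_delete A i 0 = Matrix.mat (length (sorted_list_of_set (UNIV - {?xs ! i}))) (length ?ys)
        (\<lambda>(a, b). v (?ys ! b) $ (sorted_list_of_set (UNIV - {?xs ! i}) ! a))"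
    proof (rule eq_matI)
      fix a b assume "a < dim_row (Matrix.mat (length (sorted_list_of_set (UNIV - {?xs ! i}))) (length ?ys)
        (\<lambda>(a, b). v (?ys ! b) $ (sorted_list_of_set (UNIV - {?xs ! i}) ! a)))"
        "b < dim_col (Matrix.mat (length (sorted_list_of_set (UNIV - {?xs ! i}))) (length ?ys)
        (\<lambda>(a, b). v (?ys ! b) $ (sorted_list_of_set (UNIV - {?xs ! i}) ! a)))"
      then have ab: "a < ?n - 1" "b < ?n - 1" using ys by (auto simp: card_Diff_singleton)
      have "sorted_list_of_set (UNIV - {?xs ! i}) ! a = ?xs ! (if a < i then a else Suc a)"
        unfolding sl using ab i xs(3) by (auto simp: nth_append min_def)
      then show "mat_delete A i 0 $$ (a, b) = Matrix.mat (length (sorted_list_of_set (UNIV - {?xs ! i}))) (length ?ys)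
        (\<lambda>(a, b). v (?ys ! b) $ (sorted_list_of_set (UNIV - {?xs ! i}) ! a)) $$ (a, b)"
        using ab ys by (auto simp: mat_delete_def A_def card_Diff_singleton)
    qed (use ys in \<open>auto simp: A_def card_Diff_singleton\<close>)
    then show ?thesis
      using row_number_sorted_nth[OF i]
      by (simp add: cofactor_def normal_def hyperplane_coeff_def minor_def)
  qed
  have "Determinant.det A = (\<Sum>i<?n. v j $ (?xs ! i) * normal v S $ (?xs ! i))"
    unfolding laplace_expansion_column[OF A n0]
  proof (rule sum.cong[OF refl])
    fix i assume i: "i \<in> {..<?n}"
    then have "A $$ (i, 0) = v j $ (?xs ! i)" by (simp add: A_def)
    then show "A $$ (i, 0) * cofactor A i 0 = v j $ (?xs ! i) * normal v S $ (?xs ! i)"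
      using cof i by simp
  qed
  also have "\<dots> = (\<Sum>r\<in>UNIV. v j $ r * normal v S $ r)"
    by (rule sum.reindex_bij_betw[OF bij, of "\<lambda>r. v j $ r * normal v S $ r"])
  also have "\<dots> = normal v S \<bullet> v j" by (simp add: inner_vec_def mult.commute)
  finally have det: "Determinant.det A = normal v S \<bullet> v j" .
  obtain b where b: "b < ?n - 1" "?ys ! b = j" using ys S(3) by (metis in_set_conv_nth)
  have "Determinant.det A = 0"
    by (rule det_identical_columns[OF A, of 0 "Suc b"]) (use b in \<open>auto simp: A_def intro!: eq_vecI\<close>)
  then show ?thesis using det by simp
qed

lemma span_eq_normal:
  fixes v :: "nat \<Rightarrow> real ^ 'r::{finite,linorder}"
  assumes S: "finite S" "card S = CARD('r) - 1" and ind: "ind_fam v S"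
  shows "span (v ` S) = {x. normal v S \<bullet> x = 0}"
proof (rule subspace_dim_equal)
  show "span (v ` S) \<subseteq> {x. normal v S \<bullet> x = 0}"
    by (rule span_minimal) (use inner_normal[OF S] subspace_hyperplane in auto)
  have "dim {x. normal v S \<bullet> x = 0} = CARD('r) - 1"
    using dim_hyperplane[of "normal v S"] normal_nonzero_iff[OF S, of v] ind by simp
  then show "dim {x. normal v S \<bullet> x = 0} \<le> dim (span (v ` S))"
    using dim_ind_fam[OF ind] S by simp
qed (auto intro: subspace_hyperplane)

lemma tendsto_normal:
  fixes v :: "'x \<Rightarrow> nat \<Rightarrow> real ^ 'r::{finite,linorder}"
  assumes S: "finite S" "card S = CARD('r) - 1"
    and "\<And>j. j \<in> S \<Longrightarrow> ((\<lambda>x. v x j) \<longlongrightarrow> v0 j) F"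
  shows "((\<lambda>x. normal (v x) S) \<longlongrightarrow> normal v0 S) F"
proof (rule vec_tendstoI)
  fix r
  have "((\<lambda>x. minor (\<lambda>s j. v x j $ s) (sorted_list_of_set (UNIV - {r})) (sorted_list_of_set S)) \<longlongrightarrow>
      minor (\<lambda>s j. v0 j $ s) (sorted_list_of_set (UNIV - {r})) (sorted_list_of_set S)) F"
    by (rule tendsto_minor) (use assms in \<open>auto intro!: tendsto_vec_nth simp: card_Diff_singleton\<close>)
  then show "((\<lambda>x. normal (v x) S $ r) \<longlongrightarrow> normal v0 S $ r) F"
    unfolding normal_def hyperplane_coeff_def vec_lambda_beta by (rule tendsto_mult_left)
qed

subsection \<open>Generic configurations\<close>

definition k_subsets :: "nat \<Rightarrow> nat set \<Rightarrow> nat set set" where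
  "k_subsets d J = {S. S \<subseteq> J \<and> card S = d}"

definition flat :: "(nat \<Rightarrow> 'a::real_vector) \<Rightarrow> nat set set \<Rightarrow> 'a set" where
  "flat v B = (\<Inter>S\<in>B. span (v ` S))"

lemma finite_k_subsets: "finite J \<Longrightarrow> finite (k_subsets d J)"
  by (rule finite_subset[of _ "Pow J"]) (auto simp: k_subsets_def)

lemma subspace_flat: "subspace (flat v B)"
  unfolding flat_def by (rule subspace_Inter) auto

lemma flat_empty [simp]: "flat v {} = UNIV" by (simp add: flat_def)

lemma flat_Un: "flat v (A \<union> B) = flat v A \<inter> flat v B" by (auto simp: flat_def)

lemma flat_insert: "flat v (insert S B) = span (v ` S) \<inter> flat v B" by (auto simp: flat_def)

lemma flat_antimono: "A \<subseteq> B \<Longrightarrow> flat v B \<subseteq> flat v A" by (auto simp: flat_def)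

lemma flat_cong: "(\<And>S j. S \<in> B \<Longrightarrow> j \<in> S \<Longrightarrow> v j = w j) \<Longrightarrow> flat v B = flat w B"
  unfolding flat_def by (metis (no_types, lifting) INF_cong image_cong)

definition spanned_hyperplanes :: "(nat \<Rightarrow> real ^ 'r::{finite,linorder}) \<Rightarrow> nat set set \<Rightarrow> bool" where
  "spanned_hyperplanes v B \<longleftrightarrow> finite B \<and> (\<forall>S\<in>B. finite S \<and> card S = CARD('r) - 1 \<and> ind_fam v S)"

lemma flat_eq_normal:
  "spanned_hyperplanes v B \<Longrightarrow> flat v B = {x. \<forall>S\<in>B. normal v S \<bullet> x = 0}"
  unfolding flat_def spanned_hyperplanes_def using span_eq_normal by fastforce

text \<open>The flat is the orthogonal complement of the normals, so its codimension is their
  rank.\<close>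

lemma dim_flat:
  fixes v :: "nat \<Rightarrow> real ^ 'r::{finite,linorder}"
  assumes "spanned_hyperplanes v B"
  shows "dim (flat v B) + dim (normal v ` B) = CARD('r)"
proof -
  have "flat v B = {y \<in> UNIV. \<forall>x\<in>span (normal v ` B). real_inner_class.orthogonal x y}"
  proof -
    have "\<forall>x\<in>span (normal v ` B). x \<bullet> y = 0" if "\<forall>S\<in>B. normal v S \<bullet> y = 0" for y
    proof -
      have "span (normal v ` B) \<subseteq> {x. y \<bullet> x = 0}"
      proof (rule span_minimal)
        show "normal v ` B \<subseteq> {x. y \<bullet> x = 0}" using that by (auto simp: inner_commute)
      qed (rule subspace_hyperplane)
      then show ?thesis by (auto simp: inner_commute)
    qed
    then show ?thesis unfolding flat_eq_normal[OF assms] real_inner_class.orthogonal_def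
      using span_base[of _ "normal v ` B"] by blast
  qed
  then show ?thesis
    using dim_subspace_orthogonal_to_vectors[of "span (normal v ` B)" UNIV] by simp
qed

lemma dim_eq_card_ind_fam:
  fixes f :: "'i \<Rightarrow> 'a::euclidean_space"
  assumes "finite B" "dim (f ` B) = card B"
  shows "ind_fam f B"
proof -
  have "dim (f ` B) \<le> card (f ` B)" using assms(1) by (intro dim_le_card') simp
  then have c: "card (f ` B) = card B" using assms card_image_le[OF assms(1), of f] by simp
  then have "inj_on f B" by (rule eq_card_imp_inj_on[OF assms(1)])
  moreover have "independent (f ` B)"
    by (rule card_le_dim_spanning[of _ "span (f ` B)"]) (use assms c in \<open>simp_all add: span_superset\<close>)
  ultimately show ?thesis by (simp add: ind_fam_def)
qed

lemma ind_fam_nonzero: "ind_fam v S \<Longrightarrow> i \<in> S \<Longrightarrow> v i \<noteq> 0"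
  unfolding ind_fam_def using dependent_zero by (metis image_eqI)

text \<open>A degenerate \<open>S\<close> has normal 0 and cannot occur in an independent family.
  The equivalence links minors of the coefficient matrix, in which very genericity is phrased, to
  dimensions of flats, which are invariant under linear maps and rescaling.\<close>

lemma ind_fam_normal_iff:
  fixes v :: "nat \<Rightarrow> real ^ 'r::{finite,linorder}"
  assumes "finite B" and B: "\<And>S. S \<in> B \<Longrightarrow> finite S \<and> card S = CARD('r) - 1"
  shows "ind_fam (normal v) B \<longleftrightarrow> (\<forall>S\<in>B. ind_fam v S) \<and> dim (flat v B) + card B = CARD('r)"
proof
  assume ind: "ind_fam (normal v) B"
  have S: "\<forall>S\<in>B. ind_fam v S"
  proof
    fix S assume "S \<in> B"
    then have "normal v S \<noteq> 0" using ind_fam_nonzero[OF ind] by simp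
    then show "ind_fam v S" using normal_nonzero_iff B[OF \<open>S \<in> B\<close>] by blast
  qed
  then have "spanned_hyperplanes v B" using assms by (simp add: spanned_hyperplanes_def)
  then show "(\<forall>S\<in>B. ind_fam v S) \<and> dim (flat v B) + card B = CARD('r)"
    using S dim_flat[of v B] dim_ind_fam[OF ind] by simp
next
  assume *: "(\<forall>S\<in>B. ind_fam v S) \<and> dim (flat v B) + card B = CARD('r)"
  then have "spanned_hyperplanes v B" using assms by (simp add: spanned_hyperplanes_def)
  then have "dim (normal v ` B) = card B" using * dim_flat[of v B] by simp
  then show "ind_fam (normal v) B" using dim_eq_card_ind_fam assms by blast
qed

lemma exists_independent_normals:
  fixes v :: "nat \<Rightarrow> real ^ 'r::{finite,linorder}"
  assumes B: "spanned_hyperplanes v B"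
  obtains B0 where "B0 \<subseteq> B" "ind_fam (normal v) B0" "flat v B0 = flat v B"
proof -
  let ?I = "{B0. B0 \<subseteq> B \<and> ind_fam (normal v) B0}"
  have "finite ?I" using B by (simp add: spanned_hyperplanes_def)
  moreover have "{} \<in> ?I" by (simp add: ind_fam_def independent_empty)
  then have "?I \<noteq> {}" by auto
  ultimately obtain B0 where B0: "B0 \<in> ?I" "\<forall>B'\<in>?I. B0 \<subseteq> B' \<longrightarrow> B0 = B'"
    by (rule finite_has_maximal[THEN bexE])
  have sp: "spanned_hyperplanes v B0" using B B0(1) finite_subset by (auto simp: spanned_hyperplanes_def)
  have in_span: "normal v S \<in> span (normal v ` B0)" if "S \<in> B" for S
  proof (rule ccontr)
    assume n: "normal v S \<notin> span (normal v ` B0)"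
    then have "S \<notin> B0" using span_base[of "normal v S" "normal v ` B0"] by auto
    then have "ind_fam (normal v) (insert S B0)" using n B0(1) by (simp add: ind_fam_insert)
    then have "insert S B0 \<in> ?I" using that B0(1) by simp
    then show False using B0(2) \<open>S \<notin> B0\<close> by blast
  qed
  have "flat v B0 \<subseteq> flat v B"
  proof
    fix x assume "x \<in> flat v B0"
    then have "normal v ` B0 \<subseteq> {y. x \<bullet> y = 0}" using flat_eq_normal[OF sp] by (auto simp: inner_commute)
    then have "span (normal v ` B0) \<subseteq> {y. x \<bullet> y = 0}" by (rule span_minimal) (rule subspace_hyperplane)
    then have "normal v S \<in> {y. x \<bullet> y = 0}" if "S \<in> B" for S using in_span[OF that] by (rule subsetD)
    then show "x \<in> flat v B" using flat_eq_normal[OF B] by (simp add: inner_commute)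
  qed
  moreover have "flat v B \<subseteq> flat v B0" using B0(1) by (intro flat_antimono) auto
  ultimately show ?thesis using that[of B0] B0(1) by blast
qed

text \<open>
  The rank of every set of spanned hyperplanes is as large as for any other choice of vectors;
  in particular all dimensions of flats are the same for any two generic configurations.
\<close>

definition generic_config :: "(nat \<Rightarrow> real ^ 'r::{finite,linorder}) \<Rightarrow> nat set \<Rightarrow> bool" where
  "generic_config v J \<longleftrightarrow> (\<forall>T\<subseteq>J. card T \<le> CARD('r) \<longrightarrow> ind_fam v T) \<and>
    (\<forall>B\<subseteq>k_subsets (CARD('r) - 1) J. \<forall>v' :: nat \<Rightarrow> real ^ 'r::{finite,linorder}. (\<forall>S\<in>B. ind_fam v' S) \<longrightarrow>
      dim (flat v B) \<le> dim (flat v' B))"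

text \<open>For a basis indexed by \<open>T\<close>, the spans of the sets \<open>T - {j}\<close>
  are the coordinate hyperplanes; those with \<open>j\<close> outside \<open>A\<close> intersect in
  the coordinate subspace of \<open>A\<close>.\<close>

lemma span_eq_flat_within_basis:
  fixes v :: "nat \<Rightarrow> 'a::real_vector"
  assumes ind: "ind_fam v T" and T: "finite T" "card T = Suc d" and A: "A \<subseteq> T" "card A \<le> d"
  shows "span (v ` A) = flat v {S \<in> k_subsets d T. A \<subseteq> S}"
proof
  show "span (v ` A) \<subseteq> flat v {S \<in> k_subsets d T. A \<subseteq> S}"
    unfolding flat_def by (intro INT_greatest span_mono image_mono) simp
  have "flat v ((\<lambda>j. T - {j}) ` D) \<subseteq> span (v ` (T - D))" if "finite D" "D \<noteq> {}" "D \<subseteq> T" for D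
    using that
  proof (induction rule: finite_ne_induct)
    case (singleton j)
    then show ?case by (simp add: flat_insert)
  next
    case (insert j D)
    have "flat v ((\<lambda>j. T - {j}) ` insert j D) \<subseteq> span (v ` (T - {j})) \<inter> span (v ` (T - D))"
      using insert by (auto simp: flat_insert)
    also have "\<dots> = span (v ` ((T - {j}) \<inter> (T - D)))"
      by (rule ind_fam_span_Int[OF ind T(1)]) auto
    also have "(T - {j}) \<inter> (T - D) = T - insert j D" by blast
    finally show ?case .
  qed
  moreover have "finite (T - A)" "T - A \<noteq> {}" using T A card_mono[of A T] by (auto simp: finite_subset)
  ultimately have "flat v ((\<lambda>j. T - {j}) ` (T - A)) \<subseteq> span (v ` (T - (T - A)))" by blast
  also have "T - (T - A) = A" using A by blast
  finally have "flat v ((\<lambda>j. T - {j}) ` (T - A)) \<subseteq> span (v ` A)" .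
  moreover have "(\<lambda>j. T - {j}) ` (T - A) \<subseteq> {S \<in> k_subsets d T. A \<subseteq> S}"
    using T A by (auto simp: k_subsets_def)
  ultimately show "flat v {S \<in> k_subsets d T. A \<subseteq> S} \<subseteq> span (v ` A)"
    using flat_antimono by blast
qed

lemma flat_k_subsets_basis:
  fixes v :: "nat \<Rightarrow> 'a::real_vector"
  assumes "ind_fam v T" "finite T" "card T = Suc d"
  shows "flat v (k_subsets d T) = {0}"
  using span_eq_flat_within_basis[OF assms, of "{}"] by simp

lemma k_subsets_basis:
  assumes "finite T" "card T = Suc d"
  shows "k_subsets d T = (\<lambda>j. T - {j}) ` T" "card (k_subsets d T) = Suc d"
proof -
  show eq: "k_subsets d T = (\<lambda>j. T - {j}) ` T"
  proof (intro equalityI subsetI)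
    fix S assume S: "S \<in> k_subsets d T"
    then have "card (T - S) = 1"
      using assms card_Diff_subset[of S T] finite_subset[of S T] by (simp add: k_subsets_def)
    then obtain j where j: "T - S = {j}" using card_1_singletonE by blast
    then have "S = T - {j}" "j \<in> T" using S by (auto simp: k_subsets_def)
    then show "S \<in> (\<lambda>j. T - {j}) ` T" by blast
  qed (use assms in \<open>auto simp: k_subsets_def\<close>)
  have "inj_on (\<lambda>j. T - {j}) T" by (rule inj_onI) blast
  then show "card (k_subsets d T) = Suc d" unfolding eq using assms by (simp add: card_image)
qed

text \<open>It is enough that every set of normals which is independent for some configuration is
  independent for \<open>v\<close>. Minimality of dimensions follows by passing to an independent
  set of normals with the same flat. General position of \<open>T\<close> follows by comparison with
  unit vectors placed at the indices in \<open>T\<close>.\<close>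

lemma generic_configI:
  fixes v :: "nat \<Rightarrow> real ^ 'r::{finite,linorder}"
  assumes J: "finite J" "CARD('r) \<le> card J" and r: "2 \<le> CARD('r)"
    and H: "\<And>B v'. B \<subseteq> k_subsets (CARD('r) - 1) J \<Longrightarrow> ind_fam (normal (v' :: nat \<Rightarrow> real ^ 'r::{finite,linorder})) B \<Longrightarrow> ind_fam (normal v) B"
  shows "generic_config v J"
proof -
  let ?d = "CARD('r) - 1"
  have fin: "finite S" if "S \<subseteq> J" for S using that J finite_subset by blast
  have ks: "finite B \<and> (\<forall>S\<in>B. finite S \<and> card S = ?d)" if "B \<subseteq> k_subsets ?d J" for B
  proof (intro conjI ballI)
    show "finite B" using finite_subset[OF that finite_k_subsets[OF J(1)]] .
    fix S assume "S \<in> B"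
    then show "finite S" "card S = ?d" using that fin by (auto simp: k_subsets_def)
  qed
  have gp: "ind_fam v T" if T: "T \<subseteq> J" "card T = CARD('r)" for T
  proof -
    have finT: "finite T" and cT: "card T = Suc ?d" using fin T r by auto
    obtain g where g: "bij_betw g T (UNIV :: 'r set)"
      using finite_same_card_bij[OF finT, of "UNIV :: 'r set"] T by auto
    define v' where "v' j = axis (g j) (1::real)" for j
    have ind': "ind_fam v' T" unfolding ind_fam_iff[OF finT]
    proof (intro allI impI ballI)
      fix u i assume u: "(\<Sum>i\<in>T. u i *\<^sub>R v' i) = 0" and i: "i \<in> T"
      have "0 = (\<Sum>j\<in>T. u j *\<^sub>R v' j) $ g i" using u by simp
      also have "\<dots> = (\<Sum>j\<in>T. if j = i then u j else 0)"
        unfolding sum_component v'_def using g i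
        by (intro sum.cong) (auto simp: axis_def bij_betw_def inj_on_eq_iff)
      also have "\<dots> = u i" using finT i by simp
      finally show "u i = 0" by simp
    qed
    have sub: "k_subsets ?d T \<subseteq> k_subsets ?d J" using T by (auto simp: k_subsets_def)
    have "ind_fam (normal v') (k_subsets ?d T)"
    proof (rule ind_fam_normal_iff[THEN iffD2])
      show "finite (k_subsets ?d T)" "\<And>S. S \<in> k_subsets ?d T \<Longrightarrow> finite S \<and> card S = ?d"
        using ks[OF sub] by auto
      have "\<forall>S\<in>k_subsets ?d T. ind_fam v' S"
        using ind_fam_mono[OF ind'] by (simp add: k_subsets_def)
      moreover have "dim (flat v' (k_subsets ?d T)) = 0"
        unfolding flat_k_subsets_basis[OF ind' finT cT] by simp
      ultimately show "(\<forall>S\<in>k_subsets ?d T. ind_fam v' S) \<and>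
          dim (flat v' (k_subsets ?d T)) + card (k_subsets ?d T) = CARD('r)"
        using k_subsets_basis(2)[OF finT cT] r by simp
    qed
    then have indn: "ind_fam (normal v) (k_subsets ?d T)" by (rule H[OF sub])
    then have indS: "\<forall>S\<in>k_subsets ?d T. ind_fam v S" and dim0: "dim (flat v (k_subsets ?d T)) = 0"
      using ind_fam_normal_iff[of "k_subsets ?d T" v] ks[OF sub] k_subsets_basis(2)[OF finT cT] r by auto
    show ?thesis
    proof (rule ccontr)
      \<comment> \<open>The \<open>d\<close>-subsets of \<open>T\<close> are independent, so if
        \<open>T\<close> is not, they all span the same hyperplane, whereas their spans are known to
        meet in 0.\<close>
      assume dep: "\<not> ind_fam v T"
      obtain j where j: "j \<in> T" using cT by fastforce
      let ?S = "T - {j}"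
      have Sk: "?S \<in> k_subsets ?d T" using j finT T(2) by (auto simp: k_subsets_def)
      have "insert j ?S = T" using j by blast
      then have "v j \<in> span (v ` ?S)" using ind_fam_insert[of j ?S v] dep indS Sk by auto
      then have all: "v ` T \<subseteq> span (v ` ?S)" using span_superset[of "v ` ?S"] by blast
      have "span (v ` ?S) \<subseteq> span (v ` S')" if S': "S' \<in> k_subsets ?d T" for S'
      proof -
        have "span (v ` S') \<subseteq> span (v ` ?S)"
          by (rule span_minimal) (use S' all in \<open>auto simp: k_subsets_def\<close>)
        moreover have "dim (span (v ` ?S)) \<le> dim (span (v ` S'))"
          using dim_ind_fam[of v ?S] dim_ind_fam[of v S'] indS S' Sk by (simp add: k_subsets_def)
        ultimately have "span (v ` S') = span (v ` ?S)" by (intro subspace_dim_equal) auto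
        then show ?thesis by simp
      qed
      then have "span (v ` ?S) \<subseteq> flat v (k_subsets ?d T)" by (auto simp: flat_def)
      then have "dim (span (v ` ?S)) \<le> 0" using dim0 dim_subset by metis
      moreover have "dim (span (v ` ?S)) = ?d" using dim_ind_fam[of v ?S] indS Sk by (simp add: k_subsets_def)
      ultimately show False using r by linarith
    qed
  qed
  show ?thesis unfolding generic_config_def
  proof (intro conjI allI impI)
    fix T assume T: "T \<subseteq> J" "card T \<le> CARD('r)"
    obtain T' where "T \<subseteq> T'" "T' \<subseteq> J" "card T' = CARD('r)"
      using exists_subset_between[OF T(2) J(2) T(1) J(1)] by blast
    then show "ind_fam v T" using gp ind_fam_mono by blast
  next
    fix B and v' :: "nat \<Rightarrow> real ^ 'r::{finite,linorder}" assume B: "B \<subseteq> k_subsets ?d J" and v': "\<forall>S\<in>B. ind_fam v' S"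
    have "spanned_hyperplanes v' B" using ks[OF B] v' by (simp add: spanned_hyperplanes_def)
    then obtain B0 where B0: "B0 \<subseteq> B" "ind_fam (normal v') B0" "flat v' B0 = flat v' B"
      by (rule exists_independent_normals)
    have B0J: "B0 \<subseteq> k_subsets ?d J" using B0 B by blast
    have "dim (flat v' B0) + card B0 = CARD('r)"
      using ind_fam_normal_iff[of B0 v'] ks[OF B0J] B0(2) by blast
    moreover have "dim (flat v B0) + card B0 = CARD('r)"
      using ind_fam_normal_iff[of B0 v] ks[OF B0J] H[OF B0J B0(2)] by blast
    moreover have "dim (flat v B) \<le> dim (flat v B0)" by (rule dim_subset) (rule flat_antimono[OF B0(1)])
    ultimately show "dim (flat v B) \<le> dim (flat v' B)" using B0(3) by simp
  qed
qed

lemma generic_config_relabel: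
  fixes v :: "nat \<Rightarrow> real ^ 'r::{finite,linorder}"
  assumes g: "generic_config v J" and f: "inj_on f J'" "f ` J' \<subseteq> J"
  shows "generic_config (v \<circ> f) J'"
  unfolding generic_config_def
proof (intro conjI allI impI)
  fix T assume T: "T \<subseteq> J'" "card T \<le> CARD('r)"
  have inj: "inj_on f T" using inj_on_subset[OF f(1) T(1)] .
  have "f ` T \<subseteq> J" "card (f ` T) \<le> CARD('r)" using T f card_image[OF inj] by auto
  then have "ind_fam v (f ` T)" using g unfolding generic_config_def by blast
  then show "ind_fam (v \<circ> f) T" using ind_fam_comp[OF inj] by blast
next
  fix B and v' :: "nat \<Rightarrow> real ^ 'r::{finite,linorder}"
  assume B: "B \<subseteq> k_subsets (CARD('r) - 1) J'" and v': "\<forall>S\<in>B. ind_fam v' S"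
  define w where "w = v' \<circ> the_inv_into J' f"
  have SJ: "S \<subseteq> J'" "inj_on f S" if "S \<in> B" for S
    using that B inj_on_subset[OF f(1)] by (auto simp: k_subsets_def)
  have wf: "w (f i) = v' i" if "i \<in> J'" for i
    using that f by (simp add: w_def the_inv_into_f_f)
  have fl: "flat (v \<circ> f) B = flat v ((`) f ` B)" by (auto simp: flat_def image_comp)
  have fl': "flat v' B = flat w ((`) f ` B)"
  proof -
    have "v' ` S = w ` f ` S" if "S \<in> B" for S
      unfolding image_image using SJ[OF that] wf by (intro image_cong) auto
    then show ?thesis by (simp add: flat_def)
  qed
  have "(`) f ` B \<subseteq> k_subsets (CARD('r) - 1) J"
    using B f card_image[OF SJ(2)] by (fastforce simp: k_subsets_def)
  moreover have "\<forall>S\<in>(`) f ` B. ind_fam w S"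
  proof clarify
    fix S assume S: "S \<in> B"
    have "ind_fam (w \<circ> f) S \<longleftrightarrow> ind_fam v' S"
      by (rule ind_fam_cong) (use SJ[OF S] wf in auto)
    then show "ind_fam w (f ` S)" using ind_fam_comp[OF SJ(2)[OF S], of w] v' S by blast
  qed
  ultimately show "dim (flat (v \<circ> f) B) \<le> dim (flat v' B)"
    unfolding fl fl' using g unfolding generic_config_def by blast
qed

lemma generic_config_subset:
  "generic_config v J \<Longrightarrow> J' \<subseteq> J \<Longrightarrow> generic_config v J'"
  using generic_config_relabel[of v J id J'] by simp

definition small_subsets :: "nat \<Rightarrow> nat set \<Rightarrow> nat set set" where
  "small_subsets d R = {A. A \<subseteq> R \<and> card A \<le> d}"

definition supersets :: "nat \<Rightarrow> nat set \<Rightarrow> nat set set \<Rightarrow> nat set set" where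
  "supersets d J \<S> = {S \<in> k_subsets d J. \<exists>A\<in>\<S>. A \<subseteq> S}"

text \<open>
  Spans of at most \<open>d\<close> vectors, not just of exactly \<open>d\<close>: in this way the notion is stable under
  intersection in \<open>R\<close>, even when few points are left. For \<open>\<bar>R\<bar> > d\<close> points in
  general position the two versions agree.
\<close>

definition flats_over :: "nat \<Rightarrow> (nat \<Rightarrow> 'a::real_vector) \<Rightarrow> nat set \<Rightarrow> 'a set set" where
  "flats_over d v R = flat v ` Pow (small_subsets d R)"

lemma flats_over_mono: "R \<subseteq> R' \<Longrightarrow> flats_over d v R \<subseteq> flats_over d v R'"
  unfolding flats_over_def by (intro image_mono Pow_mono) (auto simp: small_subsets_def)

locale generic =
  fixes v :: "nat \<Rightarrow> real ^ 'r::{finite,linorder}" and J :: "nat set" and d :: nat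
  assumes gen: "generic_config v J" and J: "finite J" "CARD('r) \<le> card J"
    and r: "CARD('r) = Suc d" "1 \<le> d"
begin

lemma diff_d: "CARD('r) - 1 = d" using r by simp

lemma finite_J: "S \<subseteq> J \<Longrightarrow> finite S" using J finite_subset by blast

lemma ind: "T \<subseteq> J \<Longrightarrow> card T \<le> CARD('r) \<Longrightarrow> ind_fam v T"
  using gen unfolding generic_config_def by blast

lemma spanned: "B \<subseteq> k_subsets d J \<Longrightarrow> spanned_hyperplanes v B"
proof -
  assume B: "B \<subseteq> k_subsets d J"
  have "finite B" using finite_subset[OF B finite_k_subsets[OF J(1)]] .
  moreover have "finite S \<and> card S = d \<and> ind_fam v S" if "S \<in> B" for S
    using that B finite_J[of S] ind[of S] r by (auto simp: k_subsets_def)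
  ultimately show ?thesis unfolding spanned_hyperplanes_def diff_d by blast
qed

text \<open>\<open>J\<close> has enough points to complete \<open>A\<close> to a basis, and the
  hyperplanes spanned within that basis already cut the intersection down to the span of
  \<open>A\<close>.\<close>

lemma span_eq_flat:
  assumes A: "A \<in> small_subsets d J"
  shows "span (v ` A) = flat v {S \<in> k_subsets d J. A \<subseteq> S}"
proof
  show "span (v ` A) \<subseteq> flat v {S \<in> k_subsets d J. A \<subseteq> S}"
    unfolding flat_def by (intro INT_greatest span_mono image_mono) simp
  have A': "A \<subseteq> J" "card A \<le> d" using A by (auto simp: small_subsets_def)
  obtain T where T: "A \<subseteq> T" "T \<subseteq> J" "card T = CARD('r)"
    using exists_subset_between[of A "CARD('r)" J] A' J r by auto
  have "flat v {S \<in> k_subsets d J. A \<subseteq> S} \<subseteq> flat v {S \<in> k_subsets d T. A \<subseteq> S}"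
    by (rule flat_antimono) (use T in \<open>auto simp: k_subsets_def\<close>)
  also have "\<dots> = span (v ` A)"
    by (rule span_eq_flat_within_basis[symmetric]) (use T A' ind finite_J r in auto)
  finally show "flat v {S \<in> k_subsets d J. A \<subseteq> S} \<subseteq> span (v ` A)" .
qed

lemma flat_supersets:
  assumes "\<S> \<subseteq> small_subsets d J"
  shows "flat v (supersets d J \<S>) = flat v \<S>"
proof -
  have "flat v \<S> = (\<Inter>A\<in>\<S>. flat v {S \<in> k_subsets d J. A \<subseteq> S})"
    using span_eq_flat assms unfolding flat_def[of v \<S>] by (intro INF_cong) auto
  also have "\<dots> = flat v (supersets d J \<S>)" by (auto simp: flat_def supersets_def)
  finally show ?thesis by simp
qed

end

text \<open>Each of the two configurations is a competitor in the minimality condition of the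
  other.\<close>

lemma dim_flat_eq:
  fixes v w :: "nat \<Rightarrow> real ^ 'r::{finite,linorder}"
  assumes v: "generic v J d" and w: "generic w J d" and S: "\<S> \<subseteq> small_subsets d J"
  shows "dim (flat v \<S>) = dim (flat w \<S>)"
proof -
  let ?B = "supersets d J \<S>"
  have B: "?B \<subseteq> k_subsets d J" by (auto simp: supersets_def)
  then have "\<forall>S\<in>?B. ind_fam v S" "\<forall>S\<in>?B. ind_fam w S"
    using generic.spanned[OF v B] generic.spanned[OF w B] by (auto simp: spanned_hyperplanes_def)
  then have "dim (flat v ?B) = dim (flat w ?B)"
    using generic.gen[OF v] generic.gen[OF w] B generic.r[OF v] unfolding generic_config_def by (intro antisym) simp_all
  then show ?thesis
    using generic.flat_supersets[OF v S] generic.flat_supersets[OF w S] by metis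
qed

text \<open>An inclusion of flats is the equality of two dimensions, that of the first flat and that
  of its meet with the second, and both are the same for \<open>v\<close> and
  \<open>w\<close>.\<close>

lemma flat_subset_iff:
  fixes v w :: "nat \<Rightarrow> real ^ 'r::{finite,linorder}"
  assumes v: "generic v J d" and w: "generic w J d"
    and S: "\<S> \<subseteq> small_subsets d J" "\<S>' \<subseteq> small_subsets d J"
    and sub: "flat v \<S> \<subseteq> flat v \<S>'"
  shows "flat w \<S> \<subseteq> flat w \<S>'"
proof -
  have "flat v (\<S> \<union> \<S>') = flat v \<S>" using sub by (auto simp: flat_Un)
  then have "dim (flat w (\<S> \<union> \<S>')) = dim (flat w \<S>)"
    using dim_flat_eq[OF v w, of "\<S> \<union> \<S>'"] dim_flat_eq[OF v w, of \<S>] S by simp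
  then have "flat w (\<S> \<union> \<S>') = flat w \<S>"
    by (intro subspace_dim_equal subspace_flat flat_antimono) auto
  then show ?thesis by (auto simp: flat_Un)
qed

context generic begin

text \<open>Finitely many independence conditions persist for small \<open>t\<close>. They imply
  genericity, because every flat of \<open>v\<close> is cut out by hyperplanes with independent
  normals; these stay independent, so no dimension can grow beyond its minimum.\<close>

lemma exists_generic_move:
  obtains t where "t \<noteq> 0" "generic (v(j := v j + t *\<^sub>R u)) J d"
proof -
  let ?v = "\<lambda>t. v(j := v j + t *\<^sub>R u)"
  have lim: "((\<lambda>t. ?v t i) \<longlongrightarrow> v i) (at 0)" for i
  proof -
    have "((\<lambda>t. v j + t *\<^sub>R u) \<longlongrightarrow> v j + 0 *\<^sub>R u) (at 0)" by (intro tendsto_intros)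
    then show ?thesis by (cases "i = j") auto
  qed
  have 1: "\<forall>\<^sub>F t in at 0. \<forall>T\<in>{T. T \<subseteq> J \<and> card T \<le> CARD('r)}. ind_fam (?v t) T"
  proof (rule eventually_ball_finite)
    show "finite {T. T \<subseteq> J \<and> card T \<le> CARD('r)}" by (rule finite_subset[of _ "Pow J"]) (use J in auto)
    show "\<forall>T\<in>{T. T \<subseteq> J \<and> card T \<le> CARD('r)}. \<forall>\<^sub>F t in at 0. ind_fam (?v t) T"
      using lim ind finite_J by (auto intro!: eventually_ind_fam)
  qed
  let ?I = "{B. B \<subseteq> k_subsets d J \<and> ind_fam (normal v) B}"
  have 2: "\<forall>\<^sub>F t in at 0. \<forall>B\<in>?I. ind_fam (normal (?v t)) B"
  proof (rule eventually_ball_finite)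
    show "finite ?I" by (rule finite_subset[of _ "Pow (k_subsets d J)"]) (use finite_k_subsets[OF J(1)] in auto)
    show "\<forall>B\<in>?I. \<forall>\<^sub>F t in at 0. ind_fam (normal (?v t)) B"
    proof
      fix B assume B: "B \<in> ?I"
      then have sp: "spanned_hyperplanes v B" using spanned by blast
      show "\<forall>\<^sub>F t in at 0. ind_fam (normal (?v t)) B"
      proof (rule eventually_ind_fam)
        show "finite B" "ind_fam (normal v) B" using sp B by (auto simp: spanned_hyperplanes_def)
        fix S assume "S \<in> B"
        then show "((\<lambda>t. normal (?v t) S) \<longlongrightarrow> normal v S) (at 0)"
          using sp by (intro tendsto_normal lim) (auto simp: spanned_hyperplanes_def)
      qed
    qed
  qed
  have "\<forall>\<^sub>F t in at 0. t \<noteq> (0::real)" by (simp add: eventually_at_filter)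
  from eventually_conj[OF this eventually_conj[OF 1 2]]
  obtain t :: real where t: "t \<noteq> 0" "\<And>T. T \<subseteq> J \<Longrightarrow> card T \<le> CARD('r) \<Longrightarrow> ind_fam (?v t) T"
    "\<And>B. B \<subseteq> k_subsets d J \<Longrightarrow> ind_fam (normal v) B \<Longrightarrow> ind_fam (normal (?v t)) B"
    using eventually_happens'[OF at_neq_bot] by (smt (verit) mem_Collect_eq)
  have "generic_config (?v t) J" unfolding generic_config_def diff_d
  proof (intro conjI allI impI)
    fix B and v' :: "nat \<Rightarrow> real ^ 'r::{finite,linorder}" assume B: "B \<subseteq> k_subsets d J" and v': "\<forall>S\<in>B. ind_fam v' S"
    obtain B0 where B0: "B0 \<subseteq> B" "ind_fam (normal v) B0" "flat v B0 = flat v B"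
      using exists_independent_normals[OF spanned[OF B]] .
    have B0J: "B0 \<subseteq> k_subsets d J" using B0 B by blast
    then have f: "finite B0" "\<And>S. S \<in> B0 \<Longrightarrow> finite S \<and> card S = d"
      using spanned[OF B0J] r by (auto simp: spanned_hyperplanes_def)
    have "dim (flat (?v t) B) \<le> dim (flat (?v t) B0)" by (rule dim_subset) (rule flat_antimono[OF B0(1)])
    moreover have "dim (flat (?v t) B0) + card B0 = CARD('r)"
      using ind_fam_normal_iff[OF f[folded diff_d], of "?v t"] t(3)[OF B0J B0(2)] by blast
    moreover have "dim (flat v B0) + card B0 = CARD('r)"
      using ind_fam_normal_iff[OF f[folded diff_d], of v] B0(2) by blast
    moreover have "dim (flat v B) \<le> dim (flat v' B)"
      using gen B v' unfolding generic_config_def diff_d by blast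
    ultimately show "dim (flat (?v t) B) \<le> dim (flat v' B)" using B0(3) by simp
  qed (use t in blast)
  then have "generic (?v t) J d" using J r by unfold_locales
  then show ?thesis using that t(1) by blast
qed

text \<open>
  Moving the point \<open>j\<close> does not change \<open>X\<close>, so \<open>X\<close> lies in the spans for two positions
  of \<open>v j\<close>, whose intersection no longer involves \<open>v j\<close>.
\<close>

lemma subset_span_remove:
  assumes T: "T \<subseteq> J" and X: "X \<in> flats_over d v T" and A: "A \<in> small_subsets d J"
    and j: "j \<in> A" "j \<notin> T" and sub: "X \<subseteq> span (v ` A)"
  shows "X \<subseteq> span (v ` (A - {j}))"
proof -
  have A': "A \<subseteq> J" "card A \<le> d" using A by (auto simp: small_subsets_def)
  have "dim (span (v ` A)) = card A" using dim_ind_fam[OF ind[OF A'(1)]] A' r by simp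
  then have "dim (span (v ` A)) < dim (UNIV :: (real ^ 'r::{finite,linorder}) set)"
    using A' r by simp
  then have "span (v ` A) \<noteq> UNIV" by (metis less_irrefl)
  \<comment> \<open>The bound \<open>card A \<le> d\<close> leaves a direction outside the span of
    the whole of \<open>A\<close>; the point \<open>j\<close> is moved in this direction.\<close>
  then obtain u where u: "u \<notin> span (v ` A)" by blast
  obtain t where t: "t \<noteq> 0" "generic (v(j := v j + t *\<^sub>R u)) J d" by (rule exists_generic_move)
  let ?w = "v(j := v j + t *\<^sub>R u)"
  obtain \<S> where \<S>: "\<S> \<subseteq> small_subsets d T" "X = flat v \<S>" using X by (auto simp: flats_over_def)
  have \<S>J: "\<S> \<subseteq> small_subsets d J" using \<S>(1) T by (auto simp: small_subsets_def)
  have "flat ?w \<S> = flat v \<S>"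
    by (rule flat_cong) (use \<S>(1) j in \<open>auto simp: small_subsets_def\<close>)
  moreover have "flat ?w \<S> \<subseteq> flat ?w {A}"
    by (rule flat_subset_iff[OF generic_axioms t(2) \<S>J]) (use A sub \<S>(2) in \<open>auto simp: flat_insert\<close>)
  ultimately have Xw: "X \<subseteq> span (?w ` A)" using \<S>(2) by (simp add: flat_insert)
  have im: "v ` A = insert (v j) (v ` (A - {j}))" "?w ` A = insert (v j + t *\<^sub>R u) (v ` (A - {j}))"
    using j by auto
  show ?thesis
  proof
    fix x assume x: "x \<in> X"
    from subsetD[OF sub x, unfolded im span_breakdown_eq]
    obtain a where a: "x - a *\<^sub>R v j \<in> span (v ` (A - {j}))" by (rule exE)
    from subsetD[OF Xw x, unfolded im span_breakdown_eq]
    obtain b where b: "x - b *\<^sub>R (v j + t *\<^sub>R u) \<in> span (v ` (A - {j}))" by (rule exE)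
    have le: "span (v ` (A - {j})) \<subseteq> span (v ` A)" by (rule span_mono) auto
    \<comment> \<open>Subtracting the two expansions of \<open>x\<close> puts a multiple of
      \<open>u\<close> into the span of \<open>A\<close>. Its coefficient is therefore 0, and as
      \<open>t\<close> is not, the second expansion does not involve the point
      \<open>j\<close>.\<close>
    have "(b * t) *\<^sub>R u = (x - a *\<^sub>R v j) - (x - b *\<^sub>R (v j + t *\<^sub>R u)) + (a - b) *\<^sub>R v j"
      by (simp add: algebra_simps)
    also have "\<dots> \<in> span (v ` A)"
      by (intro span_add[OF span_diff[OF subsetD[OF le a] subsetD[OF le b]]] span_scale span_base imageI j)
    finally have "b * t = 0" using u t(1) span_scale[of "(b * t) *\<^sub>R u" "v ` A" "1 / (b * t)"] by (cases "b = 0") auto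
    then have "b = 0" using t by simp
    then show "x \<in> span (v ` (A - {j}))" using b by simp
  qed
qed

text \<open>The points of \<open>A\<close> outside \<open>T\<close> are removed one at a time. In
  effect, a flat over \<open>T\<close> sees a span only through the points it shares with
  \<open>T\<close>.\<close>

lemma subset_span_Int:
  assumes T: "T \<subseteq> J" and X: "X \<in> flats_over d v T" and A: "A \<in> small_subsets d J"
    and sub: "X \<subseteq> span (v ` A)"
  shows "X \<subseteq> span (v ` (A \<inter> T))"
proof -
  have fin: "finite A" using A finite_J by (auto simp: small_subsets_def)
  have "X \<subseteq> span (v ` (A - D))" if "finite D" "D \<subseteq> A - T" for D
    using that
  proof (induction rule: finite_induct)
    case (insert j D)
    have "card (A - D) \<le> card A" using fin by (intro card_mono) auto
    then have "A - D \<in> small_subsets d J" using A by (auto simp: small_subsets_def)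
    then have "X \<subseteq> span (v ` (A - D - {j}))"
      by (intro subset_span_remove[OF T X]) (use insert in auto)
    moreover have "A - D - {j} = A - insert j D" by blast
    ultimately show ?case by metis
  qed (use sub in simp)
  from this[of "A - T"] show ?thesis using fin by (simp add: Diff_Diff_Int)
qed

text \<open>In a description of \<open>X\<close> over \<open>T\<close> every spanning set
  \<open>A\<close> may be cut down to \<open>A \<inter> T'\<close>: by
  \<open>subset_span_Int\<close> the smaller span still contains \<open>X\<close>, and shrinking the
  spans cannot enlarge the intersection.\<close>

lemma flats_over_Int:
  assumes "T \<subseteq> J" "T' \<subseteq> J" "X \<in> flats_over d v T" "X \<in> flats_over d v T'"
  shows "X \<in> flats_over d v (T \<inter> T')"
proof -
  obtain \<S> where \<S>: "\<S> \<subseteq> small_subsets d T" "X = flat v \<S>" using assms by (auto simp: flats_over_def)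
  have cI: "card (A \<inter> T') \<le> card A" if "A \<in> \<S>" for A
    using \<S> that assms finite_J by (intro card_mono) (auto simp: small_subsets_def)
  have "X = flat v ((\<lambda>A. A \<inter> T') ` \<S>)"
  proof
    show "X \<subseteq> flat v ((\<lambda>A. A \<inter> T') ` \<S>)"
    proof -
      have "X \<subseteq> span (v ` (A \<inter> T'))" if A: "A \<in> \<S>" for A
      proof (rule subset_span_Int[OF assms(2,4)])
        show "A \<in> small_subsets d J" using A \<S> assms by (auto simp: small_subsets_def)
        show "X \<subseteq> span (v ` A)" using A \<S>(2) by (auto simp: flat_def)
      qed
      then show ?thesis by (auto simp: flat_def)
    qed
    have "span (v ` (A \<inter> T')) \<subseteq> span (v ` A)" for A by (intro span_mono) auto
    then show "flat v ((\<lambda>A. A \<inter> T') ` \<S>) \<subseteq> X" unfolding \<S>(2) by (auto simp: flat_def)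
  qed
  moreover have "(\<lambda>A. A \<inter> T') ` \<S> \<subseteq> small_subsets d (T \<inter> T')"
  proof
    fix B assume "B \<in> (\<lambda>A. A \<inter> T') ` \<S>"
    then obtain A where A: "A \<in> \<S>" "B = A \<inter> T'" by blast
    then have "A \<subseteq> T" "card A \<le> d" using \<S>(1) by (auto simp: small_subsets_def)
    then show "B \<in> small_subsets d (T \<inter> T')"
      using cI[OF A(1)] A(2) by (auto simp: small_subsets_def)
  qed
  ultimately show ?thesis by (auto simp: flats_over_def)
qed

lemma flats_over_J: "flats_over d v J = flat v ` Pow (k_subsets d J)"
proof
  show "flats_over d v J \<subseteq> flat v ` Pow (k_subsets d J)"
  proof
    fix X assume "X \<in> flats_over d v J"
    then obtain \<S> where \<S>: "\<S> \<subseteq> small_subsets d J" "X = flat v \<S>" by (auto simp: flats_over_def)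
    have "X = flat v (supersets d J \<S>)" using flat_supersets[OF \<S>(1)] \<S>(2) by simp
    moreover have "supersets d J \<S> \<subseteq> k_subsets d J" by (auto simp: supersets_def)
    ultimately show "X \<in> flat v ` Pow (k_subsets d J)" by blast
  qed
  show "flat v ` Pow (k_subsets d J) \<subseteq> flats_over d v J"
    unfolding flats_over_def by (intro image_mono Pow_mono) (auto simp: k_subsets_def small_subsets_def)
qed

end

subsection \<open>Supports of chains of flats\<close>

text \<open>Only minimality under inclusion is required; for generic configurations
  \<open>exact_support_least\<close> shows that such a set is the least one.\<close>

definition exact_support :: "nat \<Rightarrow> (nat \<Rightarrow> 'a::real_vector) \<Rightarrow> nat set \<Rightarrow> 'a set set \<Rightarrow> bool" where
  "exact_support d v R C \<longleftrightarrow> C \<subseteq> flats_over d v R \<and> (\<forall>R'. R' \<subset> R \<longrightarrow> \<not> C \<subseteq> flats_over d v R')"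

text \<open>Chains of arbitrary sets in the ambient space, with a least member of codimension
  \<open>i\<close>. That the members are flats of the configuration is left to
  \<open>exact_support\<close>, so that chains of different configurations are objects of the same
  kind.\<close>

definition flat_chains :: "nat \<Rightarrow> 'a::euclidean_space set set set" where
  "flat_chains i = {C. finite C \<and> UNIV \<in> C \<and> (\<forall>X\<in>C. \<forall>Y\<in>C. X \<subseteq> Y \<or> Y \<subseteq> X) \<and>
    (\<exists>F\<in>C. (\<forall>X\<in>C. F \<subseteq> X) \<and> dim F + i = DIM('a))}"

definition chain_sum :: "nat \<Rightarrow> (nat \<Rightarrow> 'a::euclidean_space) \<Rightarrow> nat \<Rightarrow> nat set \<Rightarrow> int" where
  "chain_sum d v i R = (\<Sum>C | C \<in> flat_chains i \<and> exact_support d v R C. (-1) ^ (card C + 1))"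

lemma finite_flats_over: "finite R \<Longrightarrow> finite (flats_over d v R)"
  unfolding flats_over_def small_subsets_def by simp

lemma UNIV_in_flats_over: "UNIV \<in> flats_over d v R"
  unfolding flats_over_def by (rule image_eqI[of _ _ "{}"]) auto

lemma subspace_flats_over: "X \<in> flats_over d v R \<Longrightarrow> subspace X"
  unfolding flats_over_def using subspace_flat by blast

lemma finite_exact_support: "finite R \<Longrightarrow> finite {C. C \<in> flat_chains i \<and> exact_support d v R C}"
  by (rule finite_subset[of _ "Pow (flats_over d v R)"]) (auto simp: exact_support_def finite_flats_over)

lemma flat_image: "flat (v \<circ> f) \<S> = flat v ((`) f ` \<S>)"
  by (simp add: flat_def image_comp)

lemma flats_over_comp:
  assumes "inj_on f R"
  shows "flats_over d (v \<circ> f) R = flats_over d v (f ` R)"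
proof -
  have "(`) f ` small_subsets d R = small_subsets d (f ` R)"
  proof (intro equalityI subsetI)
    fix A assume "A \<in> (`) f ` small_subsets d R"
    then obtain A' where A': "A' \<subseteq> R" "card A' \<le> d" "A = f ` A'" by (auto simp: small_subsets_def)
    have "card A = card A'" unfolding A'(3) by (rule card_image[OF inj_on_subset[OF assms A'(1)]])
    then show "A \<in> small_subsets d (f ` R)" using A' by (auto simp: small_subsets_def)
  next
    fix A assume "A \<in> small_subsets d (f ` R)"
    then have "A \<subseteq> f ` R" "card A \<le> d" by (auto simp: small_subsets_def)
    then obtain A' where A': "A' \<subseteq> R" "A = f ` A'" by (meson subset_imageE)
    have "card A = card A'" unfolding A'(2) by (rule card_image[OF inj_on_subset[OF assms A'(1)]])
    then show "A \<in> (`) f ` small_subsets d R" using A' \<open>card A \<le> d\<close> by (auto simp: small_subsets_def)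
  qed
  then have "Pow (small_subsets d (f ` R)) = (`) ((`) f) ` Pow (small_subsets d R)"
    by (metis image_Pow_surj)
  then have "flats_over d v (f ` R) = flat v ` (`) ((`) f) ` Pow (small_subsets d R)"
    unfolding flats_over_def by (rule arg_cong)
  also have "\<dots> = flats_over d (v \<circ> f) R"
    unfolding flats_over_def by (simp only: image_image flat_image[symmetric])
  finally show ?thesis by simp
qed

lemma exact_support_comp:
  assumes "inj_on f R"
  shows "exact_support d (v \<circ> f) R C \<longleftrightarrow> exact_support d v (f ` R) C"
proof -
  have inj: "inj_on f R'" if "R' \<subseteq> R" for R' using inj_on_subset[OF assms that] .
  have "(\<forall>R'. R' \<subset> R \<longrightarrow> \<not> C \<subseteq> flats_over d v (f ` R')) \<longleftrightarrow> (\<forall>R'. R' \<subset> f ` R \<longrightarrow> \<not> C \<subseteq> flats_over d v R')"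
  proof
    assume *: "\<forall>R'. R' \<subset> R \<longrightarrow> \<not> C \<subseteq> flats_over d v (f ` R')"
    show "\<forall>R'. R' \<subset> f ` R \<longrightarrow> \<not> C \<subseteq> flats_over d v R'"
    proof (intro allI impI)
      fix R' assume R': "R' \<subset> f ` R"
      then obtain R'' where "R'' \<subseteq> R" "R' = f ` R''" by (meson psubset_imp_subset subset_imageE)
      then show "\<not> C \<subseteq> flats_over d v R'" using * R' by (metis psubsetI psubset_eq)
    qed
  next
    assume *: "\<forall>R'. R' \<subset> f ` R \<longrightarrow> \<not> C \<subseteq> flats_over d v R'"
    show "\<forall>R'. R' \<subset> R \<longrightarrow> \<not> C \<subseteq> flats_over d v (f ` R')"
    proof (intro allI impI)
      fix R' assume R': "R' \<subset> R"
      then have "f ` R' \<noteq> f ` R" using inj_on_image_eq_iff[OF assms, of R' R] by auto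
      then have "f ` R' \<subset> f ` R" using R' by auto
      then show "\<not> C \<subseteq> flats_over d v (f ` R')" using * by blast
    qed
  qed
  moreover have "flats_over d (v \<circ> f) R' = flats_over d v (f ` R')" if "R' \<subseteq> R" for R'
    by (rule flats_over_comp[OF inj[OF that]])
  ultimately show ?thesis unfolding exact_support_def by (metis psubset_imp_subset subset_refl)
qed

lemma chain_sum_comp:
  "inj_on f R \<Longrightarrow> chain_sum d (v \<circ> f) i R = chain_sum d v i (f ` R)"
  unfolding chain_sum_def using exact_support_comp by metis

context generic begin

lemma exact_support_exists:
  assumes "C \<subseteq> flats_over d v J"
  obtains R where "R \<subseteq> J" "exact_support d v R C"
proof -
  let ?P = "{R. R \<subseteq> J \<and> C \<subseteq> flats_over d v R}"
  have "finite ?P" by (rule finite_subset[of _ "Pow J"]) (use J in auto)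
  moreover have "J \<in> ?P" using assms by simp
  then have "?P \<noteq> {}" by auto
  ultimately obtain R where R: "R \<in> ?P" "\<forall>R'\<in>?P. R' \<subseteq> R \<longrightarrow> R = R'"
    by (rule finite_has_minimal[THEN bexE])
  then have "exact_support d v R C" unfolding exact_support_def by blast
  then show ?thesis using that R by blast
qed

lemma exact_support_least:
  assumes "R \<subseteq> J" "exact_support d v R C" "T \<subseteq> J" "C \<subseteq> flats_over d v T"
  shows "R \<subseteq> T"
proof -
  have "C \<subseteq> flats_over d v (R \<inter> T)"
    using flats_over_Int[OF assms(1,3)] assms(2,4) unfolding exact_support_def by blast
  then have "\<not> R \<inter> T \<subset> R" using assms(2) unfolding exact_support_def by blast
  then show ?thesis by blast
qed

lemma chains_by_least:
  "{C. C \<in> flat_chains i \<and> C \<subseteq> flats_over d v J} =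
    (\<Union>F\<in>{F. F \<in> flats_over d v J \<and> dim F + i = CARD('r)}. chains_to (flats_over d v J) F)"
proof (intro equalityI subsetI)
  fix C assume "C \<in> {C. C \<in> flat_chains i \<and> C \<subseteq> flats_over d v J}"
  then obtain F where "F \<in> C" "\<forall>X\<in>C. F \<subseteq> X" "dim F + i = CARD('r)" "C \<subseteq> flats_over d v J" "UNIV \<in> C"
    "\<forall>X\<in>C. \<forall>Y\<in>C. X \<subseteq> Y \<or> Y \<subseteq> X"
    by (auto simp: flat_chains_def)
  then have "C \<in> chains_to (flats_over d v J) F" "F \<in> flats_over d v J" "dim F + i = CARD('r)"
    unfolding chains_to_def by auto
  then show "C \<in> (\<Union>F\<in>{F. F \<in> flats_over d v J \<and> dim F + i = CARD('r)}. chains_to (flats_over d v J) F)"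
    by blast
next
  fix C assume "C \<in> (\<Union>F\<in>{F. F \<in> flats_over d v J \<and> dim F + i = CARD('r)}. chains_to (flats_over d v J) F)"
  then obtain F where F: "F \<in> flats_over d v J" "dim F + i = CARD('r)" "C \<in> chains_to (flats_over d v J) F"
    by blast
  then have "finite C" using finite_subset[OF _ finite_flats_over[OF J(1)]] by (auto simp: chains_to_def)
  then show "C \<in> {C. C \<in> flat_chains i \<and> C \<subseteq> flats_over d v J}"
    using F unfolding chains_to_def flat_chains_def by auto
qed

text \<open>Hall's theorem turns the left side into a signed count of all chains over
  \<open>J\<close>; each of them has exactly one support, and sorting by it gives the right
  side.\<close>

lemma sum_moebius_eq_chain_sum:
  "(\<Sum>F | F \<in> flats_over d v J \<and> dim F + i = CARD('r). moebius (flats_over d v J) UNIV F) =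
    (\<Sum>R\<in>Pow J. chain_sum d v i R)"
proof -
  let ?L = "flats_over d v J"
  let ?Fs = "{F. F \<in> ?L \<and> dim F + i = CARD('r)}"
  have fL: "finite ?L" using finite_flats_over J by blast
  have fch: "finite (chains_to ?L F)" for F
    by (rule finite_subset[of _ "Pow ?L"]) (use fL in \<open>auto simp: chains_to_def\<close>)
  have "(\<Sum>F\<in>?Fs. moebius ?L UNIV F) = (\<Sum>F\<in>?Fs. \<Sum>C\<in>chains_to ?L F. (-1) ^ (card C + 1))"
    using moebius_eq_chain_sum[OF fL UNIV_in_flats_over] by (intro sum.cong) auto
  also have "\<dots> = (\<Sum>C\<in>(\<Union>F\<in>?Fs. chains_to ?L F). (-1) ^ (card C + 1))"
    by (rule sum.UNION_disjoint[symmetric]) (use fL fch in \<open>auto simp: chains_to_def\<close>)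
  also have "(\<Union>F\<in>?Fs. chains_to ?L F) = {C. C \<in> flat_chains i \<and> C \<subseteq> ?L}"
    by (rule chains_by_least[symmetric])
  also have "\<dots> = (\<Union>R\<in>Pow J. {C. C \<in> flat_chains i \<and> exact_support d v R C})"
  proof (intro equalityI subsetI)
    fix C assume C: "C \<in> {C. C \<in> flat_chains i \<and> C \<subseteq> ?L}"
    then obtain R where "R \<subseteq> J" "exact_support d v R C" using exact_support_exists[of C] by blast
    then show "C \<in> (\<Union>R\<in>Pow J. {C. C \<in> flat_chains i \<and> exact_support d v R C})" using C by blast
  next
    fix C assume "C \<in> (\<Union>R\<in>Pow J. {C. C \<in> flat_chains i \<and> exact_support d v R C})"
    then obtain R where R: "R \<subseteq> J" "C \<in> flat_chains i" "exact_support d v R C" by blast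
    then show "C \<in> {C. C \<in> flat_chains i \<and> C \<subseteq> ?L}"
      using flats_over_mono[OF R(1), of d v] unfolding exact_support_def by blast
  qed
  also have "(\<Sum>C\<in>\<dots>. (-1) ^ (card C + 1)) = (\<Sum>R\<in>Pow J. chain_sum d v i R)"
    unfolding chain_sum_def
  proof (rule sum.UNION_disjoint)
    show "\<forall>R\<in>Pow J. finite {C. C \<in> flat_chains i \<and> exact_support d v R C}"
      using finite_exact_support finite_J by blast
    show "\<forall>R\<in>Pow J. \<forall>R'\<in>Pow J. R \<noteq> R' \<longrightarrow>
      {C. C \<in> flat_chains i \<and> exact_support d v R C} \<inter> {C. C \<in> flat_chains i \<and> exact_support d v R' C} = {}"
    proof (intro ballI impI, rule ccontr)
      fix R R' assume R: "R \<in> Pow J" "R' \<in> Pow J" "R \<noteq> R'"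
        "{C. C \<in> flat_chains i \<and> exact_support d v R C} \<inter> {C. C \<in> flat_chains i \<and> exact_support d v R' C} \<noteq> {}"
      then obtain C where C: "exact_support d v R C" "exact_support d v R' C" by blast
      then have "C \<subseteq> flats_over d v R" "C \<subseteq> flats_over d v R'" by (simp_all add: exact_support_def)
      then have "R \<subseteq> R'" "R' \<subseteq> R"
        using exact_support_least[OF _ C(1), of R'] exact_support_least[OF _ C(2), of R] R by auto
      then show False using R by blast
    qed
  qed (use J in simp)
  finally show ?thesis .
qed

end

section \<open>Transfer of chains from one generic configuration to another\<close>

definition flat_transfer :: "nat \<Rightarrow> nat set \<Rightarrow> (nat \<Rightarrow> 'a::real_vector) \<Rightarrow> (nat \<Rightarrow> 'a) \<Rightarrow> 'a set \<Rightarrow> 'a set" where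
  "flat_transfer d J v w X = flat w {A \<in> small_subsets d J. X \<subseteq> span (v ` A)}"

text \<open>The family of all spans containing a flat is its largest description and depends on the
  flat alone, which makes the transfer well defined. Enlarging \<open>\<S>\<close> to it does not
  change the flat for \<open>v\<close>, and since inclusions carry over, not for \<open>w\<close>
  either.\<close>

lemma flat_transfer_flat:
  fixes v w :: "nat \<Rightarrow> real ^ 'r::{finite,linorder}"
  assumes v: "generic v J d" and w: "generic w J d" and S: "\<S> \<subseteq> small_subsets d J"
  shows "flat_transfer d J v w (flat v \<S>) = flat w \<S>"
proof -
  let ?c = "{A \<in> small_subsets d J. flat v \<S> \<subseteq> span (v ` A)}"
  have "\<S> \<subseteq> ?c" using S by (auto simp: flat_def)
  then have "flat w ?c \<subseteq> flat w \<S>" by (rule flat_antimono)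
  moreover have "flat v \<S> \<subseteq> flat v ?c" unfolding flat_def[of v ?c] by (rule INT_greatest) simp
  then have "flat w \<S> \<subseteq> flat w ?c" using flat_subset_iff[OF v w S] by simp
  ultimately show ?thesis by (simp add: flat_transfer_def)
qed

lemma flat_transfer_properties:
  fixes v w :: "nat \<Rightarrow> real ^ 'r::{finite,linorder}"
  assumes v: "generic v J d" and w: "generic w J d"
  shows "X \<in> flats_over d v J \<Longrightarrow> flat_transfer d J w v (flat_transfer d J v w X) = X"
    and "R \<subseteq> J \<Longrightarrow> X \<in> flats_over d v R \<Longrightarrow> flat_transfer d J v w X \<in> flats_over d w R"
    and "X \<in> flats_over d v J \<Longrightarrow> dim (flat_transfer d J v w X) = dim X"
    and "X \<in> flats_over d v J \<Longrightarrow> Y \<in> flats_over d v J \<Longrightarrow> X \<subseteq> Y \<Longrightarrow>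
      flat_transfer d J v w X \<subseteq> flat_transfer d J v w Y"
    and "flat_transfer d J v w UNIV = UNIV"
proof -
  note tr = flat_transfer_flat[OF v w] flat_transfer_flat[OF w v]
  show "flat_transfer d J w v (flat_transfer d J v w X) = X" if X: "X \<in> flats_over d v J"
    using X tr by (auto simp: flats_over_def)
  show "flat_transfer d J v w X \<in> flats_over d w R" if R: "R \<subseteq> J" and X: "X \<in> flats_over d v R"
  proof -
    obtain \<S> where \<S>: "\<S> \<subseteq> small_subsets d R" "X = flat v \<S>" using X by (auto simp: flats_over_def)
    then have "\<S> \<subseteq> small_subsets d J" using R by (auto simp: small_subsets_def)
    then show ?thesis using tr(1) \<S> by (auto simp: flats_over_def)
  qed
  show "dim (flat_transfer d J v w X) = dim X" if X: "X \<in> flats_over d v J"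
    using X tr(1) dim_flat_eq[OF w v] by (auto simp: flats_over_def)
  show "flat_transfer d J v w X \<subseteq> flat_transfer d J v w Y"
    if X: "X \<in> flats_over d v J" and Y: "Y \<in> flats_over d v J" and "X \<subseteq> Y"
  proof -
    obtain \<S> where \<S>: "\<S> \<subseteq> small_subsets d J" "X = flat v \<S>" using X by (auto simp: flats_over_def)
    obtain \<S>' where \<S>': "\<S>' \<subseteq> small_subsets d J" "Y = flat v \<S>'" using Y by (auto simp: flats_over_def)
    have "flat w \<S> \<subseteq> flat w \<S>'" by (rule flat_subset_iff[OF v w \<S>(1) \<S>'(1)]) (use \<S> \<S>' \<open>X \<subseteq> Y\<close> in simp)
    then show ?thesis using tr(1) \<S> \<S>' by simp
  qed
  show "flat_transfer d J v w UNIV = UNIV" using tr(1)[of "{}"] by simp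
qed

lemma transfer_chain:
  fixes v w :: "nat \<Rightarrow> real ^ 'r::{finite,linorder}"
  assumes v: "generic v J d" and w: "generic w J d" and R: "R \<subseteq> J"
    and C: "C \<in> flat_chains i" "exact_support d v R C"
  shows "(`) (flat_transfer d J v w) C \<in> flat_chains i"
    and "exact_support d w R ((`) (flat_transfer d J v w) C)"
    and "(`) (flat_transfer d J w v) ((`) (flat_transfer d J v w) C) = C"
    and "card ((`) (flat_transfer d J v w) C) = card C"
proof -
  let ?f = "flat_transfer d J v w" and ?g = "flat_transfer d J w v"
  note p = flat_transfer_properties[OF v w] and q = flat_transfer_properties[OF w v]
  have CR: "C \<subseteq> flats_over d v R" using C by (simp add: exact_support_def)
  then have CJ: "X \<in> flats_over d v J" if "X \<in> C" for X using flats_over_mono[OF R] that by blast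
  show gf: "?g ` ?f ` C = C" unfolding image_image using p(1)[OF CJ] by simp
  have "inj_on ?f C" using p(1)[OF CJ] by (metis inj_on_inverseI)
  then show "card (?f ` C) = card C" by (rule card_image)
  obtain F where F: "F \<in> C" "\<forall>X\<in>C. F \<subseteq> X" "dim F + i = CARD('r)" and
    C': "finite C" "UNIV \<in> C" "\<forall>X\<in>C. \<forall>Y\<in>C. X \<subseteq> Y \<or> Y \<subseteq> X"
    using C(1) by (auto simp: flat_chains_def)
  show "?f ` C \<in> flat_chains i" unfolding flat_chains_def
  proof (intro CollectI conjI)
    show "finite (?f ` C)" using C' by simp
    show "UNIV \<in> ?f ` C" using C'(2) p(5) by (metis image_eqI)
    show "\<forall>X\<in>?f ` C. \<forall>Y\<in>?f ` C. X \<subseteq> Y \<or> Y \<subseteq> X"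
    proof (intro ballI)
      fix X' Y' assume "X' \<in> ?f ` C" "Y' \<in> ?f ` C"
      then obtain X Y where XY: "X \<in> C" "Y \<in> C" "X' = ?f X" "Y' = ?f Y" by blast
      have "X \<subseteq> Y \<or> Y \<subseteq> X" using C'(3) XY by blast
      then show "X' \<subseteq> Y' \<or> Y' \<subseteq> X'"
        using p(4)[OF CJ[OF XY(1)] CJ[OF XY(2)]] p(4)[OF CJ[OF XY(2)] CJ[OF XY(1)]] XY(3,4) by auto
    qed
    show "\<exists>F\<in>?f ` C. (\<forall>X\<in>?f ` C. F \<subseteq> X) \<and> dim F + i = DIM(real ^ 'r::{finite,linorder})"
      using F p(3)[OF CJ[OF F(1)]] p(4)[OF CJ[OF F(1)] CJ] by (intro bexI[of _ "?f F"]) auto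
  qed
  show "exact_support d w R (?f ` C)" unfolding exact_support_def
  proof (intro conjI allI impI)
    show "?f ` C \<subseteq> flats_over d w R" using CR p(2)[OF R] by blast
    fix R' assume R': "R' \<subset> R"
    show "\<not> ?f ` C \<subseteq> flats_over d w R'"
    proof
      assume "?f ` C \<subseteq> flats_over d w R'"
      then have "?g ` ?f ` C \<subseteq> flats_over d v R'" using q(2)[of R'] R' R by blast
      then show False using C(2) R' gf unfolding exact_support_def by simp
    qed
  qed
qed

lemma chain_sum_eq:
  fixes v w :: "nat \<Rightarrow> real ^ 'r::{finite,linorder}"
  assumes v: "generic v J d" and w: "generic w J d" and R: "R \<subseteq> J"
  shows "chain_sum d v i R = chain_sum d w i R"
  unfolding chain_sum_def
proof (rule sum.reindex_bij_witness[of _ "(`) (flat_transfer d J w v)" "(`) (flat_transfer d J v w)"])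
  fix C assume C: "C \<in> {C. C \<in> flat_chains i \<and> exact_support d v R C}"
  note t = transfer_chain[OF v w R, of C i]
  show "flat_transfer d J w v ` flat_transfer d J v w ` C = C"
    "flat_transfer d J v w ` C \<in> {C. C \<in> flat_chains i \<and> exact_support d w R C}"
    "(-1::int) ^ (card (flat_transfer d J v w ` C) + 1) = (-1) ^ (card C + 1)"
    using t C by simp_all
next
  fix C assume C: "C \<in> {C. C \<in> flat_chains i \<and> exact_support d w R C}"
  note t = transfer_chain[OF w v R, of C i]
  show "flat_transfer d J v w ` flat_transfer d J w v ` C = C"
    "flat_transfer d J w v ` C \<in> {C. C \<in> flat_chains i \<and> exact_support d v R C}"
    using t C by simp_all
qed

text \<open>Both supports are enlarged to sets \<open>J0\<close> and \<open>J1\<close> of a common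
  size that is at least \<open>CARD('r)\<close>, as genericity of a configuration requires. A
  bijection between these that matches the supports relabels one configuration, and the two can be
  compared on the same index set.\<close>

lemma chain_sum_card:
  fixes v w :: "nat \<Rightarrow> real ^ 'r::{finite,linorder}"
  assumes v: "generic v J d" and w: "generic w J' d" and R: "R \<subseteq> J" "R' \<subseteq> J'" "card R = card R'"
  shows "chain_sum d v i R = chain_sum d w i R'"
proof -
  let ?n = "max (CARD('r)) (card R)"
  note Jv = generic.J[OF v] and Jw = generic.J[OF w]
  have c: "card R \<le> card J" "card R' \<le> card J'" using card_mono[OF Jv(1) R(1)] card_mono[OF Jw(1) R(2)] by auto
  obtain J0 where J0: "R \<subseteq> J0" "J0 \<subseteq> J" "card J0 = ?n"
    using exists_subset_between[of R ?n J] R Jv c by auto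
  obtain J1 where J1: "R' \<subseteq> J1" "J1 \<subseteq> J'" "card J1 = ?n"
    using exists_subset_between[of R' ?n J'] R Jw c by auto
  have fin: "finite J0" "finite J1" "finite R" "finite R'"
    using J0 J1 Jv Jw finite_subset by (metis subset_trans)+
  have "card (J0 - R) = card (J1 - R')" using J0 J1 R fin by (simp add: card_Diff_subset)
  then obtain f1 where f1: "bij_betw f1 (J0 - R) (J1 - R')"
    using finite_same_card_bij[of "J0 - R" "J1 - R'"] fin by auto
  obtain f0 where f0: "bij_betw f0 R R'" using finite_same_card_bij[OF fin(3,4) R(3)] by blast
  define f where "f x = (if x \<in> R then f0 x else f1 x)" for x
  have "bij_betw f R R'" using f0 by (rule bij_betw_cong[THEN iffD1, rotated]) (simp add: f_def)
  moreover have "bij_betw f (J0 - R) (J1 - R')"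
    using f1 by (rule bij_betw_cong[THEN iffD1, rotated]) (simp add: f_def)
  ultimately have "bij_betw f (R \<union> (J0 - R)) (R' \<union> (J1 - R'))"
    by (rule bij_betw_combine) auto
  then have f: "bij_betw f J0 J1" using J0 J1 by (simp add: Un_absorb1)
  have fR: "f ` R = R'" using \<open>bij_betw f R R'\<close> by (simp add: bij_betw_def)
  have v0: "generic v J0 d"
    using generic_config_subset[OF generic.gen[OF v] J0(2)] fin J0 generic.r[OF v] by unfold_locales auto
  have "generic_config (w \<circ> f) J0"
    by (rule generic_config_relabel[OF generic.gen[OF w]]) (use f J1 in \<open>auto simp: bij_betw_def\<close>)
  then have w0: "generic (w \<circ> f) J0 d" using fin J0 generic.r[OF v] by unfold_locales auto
  have "chain_sum d v i R = chain_sum d (w \<circ> f) i R" by (rule chain_sum_eq[OF v0 w0 J0(1)])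
  also have "\<dots> = chain_sum d w i (f ` R)"
    by (rule chain_sum_comp) (use f J0 inj_on_subset in \<open>auto simp: bij_betw_def\<close>)
  finally show ?thesis using fR by simp
qed

context generic begin

section \<open>The number of hyperplanes that cut out a chain\<close>

lemma flats_over_unions: "B \<subseteq> k_subsets d J \<Longrightarrow> flat v B \<in> flats_over d v (\<Union>B)"
  unfolding flats_over_def by (rule imageI) (auto simp: k_subsets_def small_subsets_def)

text \<open>Hyperplanes through \<open>F\<close> are added while the flat is still too large. Each
  of them lowers the dimension by at least one, so \<open>card B + dim (flat v B)\<close> never
  increases.\<close>

lemma extend_hyperplanes:
  assumes "B' \<subseteq> k_subsets d J" "F \<in> flats_over d v J" "F \<subseteq> flat v B'"
  shows "\<exists>B. B' \<subseteq> B \<and> B \<subseteq> k_subsets d J \<and> flat v B = F \<and> card B + dim F \<le> card B' + dim (flat v B')"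
  using assms
proof (induction "dim (flat v B')" arbitrary: B' rule: less_induct)
  case less
  show ?case
  proof (cases "F = flat v B'")
    case False
    obtain \<S> where \<S>: "\<S> \<subseteq> k_subsets d J" "F = flat v \<S>" using less.prems(2) by (auto simp: flats_over_J)
    have "\<not> flat v B' \<subseteq> F" using False less.prems by blast
    then obtain S where S: "S \<in> \<S>" "\<not> flat v B' \<subseteq> span (v ` S)"
      using \<S>(2) by (auto simp: flat_def[of v \<S>])
    let ?B = "insert S B'"
    have sub: "flat v ?B \<subset> flat v B'" using S by (auto simp: flat_insert)
    have dl: "dim (flat v ?B) < dim (flat v B')"
    proof (rule ccontr)
      assume "\<not> ?thesis"
      then have "flat v ?B = flat v B'" using sub by (intro subspace_dim_equal subspace_flat) auto
      then show False using sub by blast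
    qed
    have "?B \<subseteq> k_subsets d J" using S \<S> less.prems by blast
    moreover have "F \<subseteq> flat v ?B" using S \<S> less.prems by (auto simp: flat_def)
    ultimately obtain B where B: "?B \<subseteq> B" "B \<subseteq> k_subsets d J" "flat v B = F"
        "card B + dim F \<le> card ?B + dim (flat v ?B)"
      using less.hyps[OF dl] less.prems(2) by blast
    have "card ?B \<le> Suc (card B')" by (rule card_insert_le_m1) simp_all
    then show ?thesis using B dl by (intro exI[of _ B]) auto
  qed (use less.prems in auto)
qed

text \<open>Going down the chain, the hyperplanes that cut out the larger members are kept. A whole
  chain therefore costs no more hyperplanes than the codimension of its least member.\<close>

lemma chain_hyperplanes:
  assumes "finite C" "UNIV \<in> C" "C \<subseteq> flats_over d v J" "\<forall>X\<in>C. \<forall>Y\<in>C. X \<subseteq> Y \<or> Y \<subseteq> X"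
    "F \<in> C" "\<forall>X\<in>C. F \<subseteq> X"
  shows "\<exists>B. B \<subseteq> k_subsets d J \<and> flat v B = F \<and> card B + dim F \<le> CARD('r) \<and> C \<subseteq> flat v ` Pow B"
  using assms
proof (induction "card C" arbitrary: C F rule: less_induct)
  case less
  show ?case
  proof (cases "F = UNIV")
    case True
    then have "C = {UNIV}" using less.prems by auto
    then show ?thesis using True by (intro exI[of _ "{}"]) auto
  next
    case False
    let ?C = "C - {F}"
    have C: "finite ?C" "UNIV \<in> ?C" "?C \<subseteq> flats_over d v J" "\<forall>X\<in>?C. \<forall>Y\<in>?C. X \<subseteq> Y \<or> Y \<subseteq> X"
      using less.prems False by auto
    obtain G where G: "G \<in> ?C" "\<forall>X\<in>?C. G \<subseteq> X"
      using finite_chain_has_least[OF C(1) _ C(4)] C(2) by blast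
    have "card ?C < card C" by (rule psubset_card_mono) (use less.prems in auto)
    from less.hyps[OF this C G] obtain B' where B': "B' \<subseteq> k_subsets d J" "flat v B' = G"
      "card B' + dim G \<le> CARD('r)" "?C \<subseteq> flat v ` Pow B'" by blast
    have "F \<in> flats_over d v J" "F \<subseteq> flat v B'" using less.prems G B' by auto
    from extend_hyperplanes[OF B'(1) this] obtain B where B: "B' \<subseteq> B" "B \<subseteq> k_subsets d J" "flat v B = F"
      "card B + dim F \<le> card B' + dim (flat v B')" by blast
    have "C \<subseteq> flat v ` Pow B"
    proof
      fix X assume X: "X \<in> C"
      show "X \<in> flat v ` Pow B"
      proof (cases "X = F")
        case False
        then have "X \<in> flat v ` Pow B'" using X B'(4) by blast
        then show ?thesis using B(1) by blast
      qed (use B in blast)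
    qed
    then show ?thesis using B B' by (intro exI[of _ B]) auto
  qed
qed

lemma flat_chain_support:
  assumes "R \<subseteq> J" "C \<in> flat_chains i" "exact_support d v R C"
  obtains B where "B \<subseteq> k_subsets d J" "card B \<le> i" "flat v B \<in> C" "\<forall>X\<in>C. flat v B \<subseteq> X"
    "dim (flat v B) + i = CARD('r)" "R \<subseteq> \<Union>B" "card (\<Union>B) \<le> card B * d"
proof -
  obtain F where F: "F \<in> C" "\<forall>X\<in>C. F \<subseteq> X" "dim F + i = CARD('r)" and
    C: "finite C" "UNIV \<in> C" "\<forall>X\<in>C. \<forall>Y\<in>C. X \<subseteq> Y \<or> Y \<subseteq> X"
    using assms(2) by (auto simp: flat_chains_def)
  have CJ: "C \<subseteq> flats_over d v J"
    using assms(3) flats_over_mono[OF assms(1), of d v] by (auto simp: exact_support_def)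
  obtain B where B: "B \<subseteq> k_subsets d J" "flat v B = F" "card B + dim F \<le> CARD('r)" "C \<subseteq> flat v ` Pow B"
    using chain_hyperplanes[OF C(1,2) CJ C(3) F(1,2)] by blast
  have "C \<subseteq> flats_over d v (\<Union>B)"
  proof
    fix X assume "X \<in> C"
    then obtain B' where B': "B' \<subseteq> B" "X = flat v B'" using B(4) by blast
    have "X \<in> flats_over d v (\<Union>B')" using flats_over_unions[of B'] B B' by auto
    then show "X \<in> flats_over d v (\<Union>B)" using flats_over_mono[of "\<Union>B'" "\<Union>B" d v] B' by blast
  qed
  moreover have "\<Union>B \<subseteq> J" using B(1) by (auto simp: k_subsets_def)
  ultimately have "R \<subseteq> \<Union>B" using exact_support_least[OF assms(1,3)] by blast
  moreover have "card (\<Union>B) \<le> card B * d"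
  proof -
    have "card (\<Union>B) \<le> (\<Sum>S\<in>B. card S)" by (rule card_Union_le_sum_card)
    also have "\<dots> = (\<Sum>S\<in>B. d)" using B(1) by (intro sum.cong) (auto simp: k_subsets_def)
    finally show ?thesis by simp
  qed
  ultimately show ?thesis using that[of B] B F by auto
qed

lemma chain_sum_eq_0:
  assumes "R \<subseteq> J" "i * d < card R"
  shows "chain_sum d v i R = 0"
proof -
  have "False" if C: "C \<in> flat_chains i" "exact_support d v R C" for C
  proof -
    obtain B where B: "B \<subseteq> k_subsets d J" "card B \<le> i" "R \<subseteq> \<Union>B" "card (\<Union>B) \<le> card B * d"
      using flat_chain_support[OF assms(1) C] by metis
    have "finite (\<Union>B)" using B(1) finite_J[of "\<Union>B"] by (auto simp: k_subsets_def)
    then have "card R \<le> card (\<Union>B)" using B(3) card_mono by blast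
    also have "\<dots> \<le> i * d" using B(2,4) by (meson le_trans mult_le_mono1)
    finally show False using assms(2) by simp
  qed
  then have "{C. C \<in> flat_chains i \<and> exact_support d v R C} = {}" by blast
  then show ?thesis unfolding chain_sum_def by (simp only: sum.empty)
qed

subsection \<open>Flats spanned by disjoint hyperplanes\<close>

lemma dim_span_hyperplane: "S \<in> k_subsets d J \<Longrightarrow> dim (span (v ` S)) = d"
  using dim_ind_fam[OF ind] r by (simp add: k_subsets_def)

lemma dim_flat_insert_ge:
  assumes "S \<in> k_subsets d J"
  shows "dim (flat v B) \<le> Suc (dim (flat v (insert S B)))"
proof -
  have "dim {x + y |x y. x \<in> span (v ` S) \<and> y \<in> flat v B} + dim (span (v ` S) \<inter> flat v B) =
      dim (span (v ` S)) + dim (flat v B)"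
    by (rule dim_sums_Int) (auto simp: subspace_flat)
  moreover have "dim {x + y |x y. x \<in> span (v ` S) \<and> y \<in> flat v B} \<le> CARD('r)"
    using dim_subset_UNIV[of "{x + y |x y. x \<in> span (v ` S) \<and> y \<in> flat v B}"] by simp
  ultimately show ?thesis using dim_span_hyperplane[OF assms] r by (simp add: flat_insert)
qed

lemma dim_flat_ge:
  assumes "finite B" "B \<subseteq> k_subsets d J"
  shows "CARD('r) \<le> dim (flat v B) + card B"
  using assms
proof (induction rule: finite_induct)
  case (insert S B)
  then show ?case using dim_flat_insert_ge[of S B] by simp
qed simp

lemma dim_flat_insert_less:
  assumes "\<not> flat v B \<subseteq> span (v ` S)"
  shows "dim (flat v (insert S B)) < dim (flat v B)"
proof (rule ccontr)
  assume "\<not> ?thesis"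
  then have "flat v (insert S B) = flat v B"
    by (intro subspace_dim_equal subspace_flat) (auto simp: flat_insert)
  then show False using assms by (auto simp: flat_insert)
qed

text \<open>Let \<open>I\<close> be a minimal part of \<open>B\<close> whose flat lies in the span
  of \<open>S\<close>. For \<open>a\<close> in \<open>I\<close>, exchanging \<open>a\<close> for
  \<open>S\<close> does not change the flat, as a count of dimensions shows; so the flat is defined
  over \<open>S\<close> and the remaining sets, and being inside the span of \<open>a\<close>, it
  lies in the span of \<open>a \<inter> S\<close>, since \<open>a\<close> misses the remaining sets.
  Two such sets \<open>a\<close> and \<open>b\<close> would force the flat to be 0, although at most
  \<open>d\<close> hyperplanes leave dimension at least 1; a single one forces
  \<open>S = a\<close>.\<close>

lemma disjoint_flat_closed:
  assumes B: "B \<subseteq> k_subsets d J" "disjoint B" "card B \<le> d"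
    and S: "S \<in> k_subsets d J" "flat v B \<subseteq> span (v ` S)"
  shows "S \<in> B"
proof (rule ccontr)
  assume SB: "S \<notin> B"
  have finB: "finite B" using finite_subset[OF B(1) finite_k_subsets[OF J(1)]] .
  let ?I = "{I. I \<subseteq> B \<and> flat v I \<subseteq> span (v ` S)}"
  have "finite ?I" using finB by simp
  moreover have "B \<in> ?I" using S by simp
  then have "?I \<noteq> {}" by auto
  ultimately obtain I where I: "I \<in> ?I" "\<forall>I'\<in>?I. I' \<subseteq> I \<longrightarrow> I = I'"
    by (rule finite_has_minimal[THEN bexE])
  have IB: "I \<subseteq> B" "flat v I \<subseteq> span (v ` S)" using I(1) by auto
  have IJ: "I \<subseteq> k_subsets d J" using IB B by blast
  have finI: "finite I" using IB finB finite_subset by blast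
  have S': "S \<subseteq> J" "card S = d" "finite S" using S finite_J by (auto simp: k_subsets_def)
  have indS: "ind_fam v S" using ind S' r by auto
  have "card I \<le> d" using card_mono[OF finB IB(1)] B(3) by simp
  then have dimI: "1 \<le> dim (flat v I)" using dim_flat_ge[OF finI IJ] r by linarith
  have key: "flat v I \<subseteq> span (v ` (a \<inter> S))" if a: "a \<in> I" for a
  proof -
    have aJ: "a \<in> k_subsets d J" using a IJ by blast
    let ?I' = "I - {a}"
    let ?Y = "flat v (insert S ?I')"
    have Ieq: "insert a ?I' = I" using a by blast
    have "\<not> flat v ?I' \<subseteq> span (v ` S)"
    proof
      assume "flat v ?I' \<subseteq> span (v ` S)"
      then have "?I' \<in> ?I" using IB by blast
      then show False using I(2) a by blast
    qed
    then have "dim ?Y < dim (flat v ?I')" by (rule dim_flat_insert_less)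
    moreover have "dim (flat v ?I') \<le> Suc (dim (flat v I))" using dim_flat_insert_ge[OF aJ, of ?I'] Ieq by simp
    moreover have "flat v I \<subseteq> flat v ?I'" by (rule flat_antimono) auto
    then have "flat v I \<subseteq> ?Y" using IB(2) by (simp add: flat_insert)
    \<comment> \<open>The flat of \<open>I\<close> has codimension at most one in that of
      \<open>?I'\<close>, and \<open>?Y\<close> lies between them, strictly below the latter, so it
      equals the former.\<close>
    ultimately have eq: "flat v I = ?Y" by (intro subspace_dim_equal subspace_flat) auto
    let ?T = "\<Union>(insert S ?I')"
    have ins: "insert S ?I' \<subseteq> k_subsets d J" using S IJ by blast
    have "flat v I \<in> flats_over d v ?T" unfolding eq by (rule flats_over_unions[OF ins])
    moreover have "?T \<subseteq> J" using ins by (auto simp: k_subsets_def)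
    moreover have "a \<in> small_subsets d J" using aJ by (auto simp: k_subsets_def small_subsets_def)
    moreover have "flat v I \<subseteq> span (v ` a)" using a by (auto simp: flat_def)
    ultimately have "flat v I \<subseteq> span (v ` (a \<inter> ?T))" by (intro subset_span_Int)
    moreover have "a \<inter> ?T = a \<inter> S"
    proof -
      have "a \<inter> b = {}" if "b \<in> ?I'" for b
        using B(2) a IB(1) that by (intro disjointD[OF B(2)]) auto
      then show ?thesis by auto
    qed
    ultimately show ?thesis by simp
  qed
  have "I \<noteq> {}"
  proof
    assume "I = {}"
    then have "span (v ` S) = UNIV" using IB(2) by auto
    then have "dim (span (v ` S)) = CARD('r)" by (metis dim_UNIV DIM_cart DIM_real mult.right_neutral)
    then show False using dim_span_hyperplane[OF S(1)] r by simp
  qed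
  then obtain a where a: "a \<in> I" by blast
  show False
  proof (cases "I = {a}")
    case True
    have aJ: "a \<in> k_subsets d J" using a IJ by blast
    then have af: "finite a" "card a = d" using finite_J by (auto simp: k_subsets_def)
    have "span (v ` a) \<subseteq> span (v ` (a \<inter> S))" using key[OF a] True by (simp add: flat_insert)
    then have "dim (span (v ` a)) \<le> dim (span (v ` (a \<inter> S)))" by (rule dim_subset)
    also have "\<dots> = card (a \<inter> S)" by (rule dim_ind_fam) (rule ind_fam_mono[OF indS], simp)
    finally have "d \<le> card (a \<inter> S)" using dim_span_hyperplane[OF aJ] by simp
    then have "a \<inter> S = a" by (intro card_seteq[OF af(1)]) (simp_all add: af)
    moreover have "a \<inter> S = S"
      using \<open>d \<le> card (a \<inter> S)\<close> by (intro card_seteq[OF S'(3)]) (simp_all add: S')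
    ultimately have "S = a" by blast
    then show False using SB a IB by blast
  next
    case False
    then obtain b where b: "b \<in> I" "b \<noteq> a" using a by blast
    have ab: "a \<inter> b = {}" using B(2) a b IB by (intro disjointD[OF B(2)]) auto
    have "flat v I \<subseteq> span (v ` (a \<inter> S)) \<inter> span (v ` (b \<inter> S))" using key[OF a] key[OF b(1)] by blast
    also have "\<dots> = span (v ` ((a \<inter> S) \<inter> (b \<inter> S)))"
      by (rule ind_fam_span_Int[OF indS S'(3)]) auto
    also have "(a \<inter> S) \<inter> (b \<inter> S) = {}" using ab by blast
    finally have "flat v I \<subseteq> {0}" by simp
    then have "dim (flat v I) = 0" by simp
    then show False using dimI by linarith
  qed
qed

lemma dim_disjoint_flat:
  assumes "finite B" "B \<subseteq> k_subsets d J" "disjoint B" "card B \<le> d"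
  shows "dim (flat v B) + card B = CARD('r)"
  using assms
proof (induction rule: finite_induct)
  case (insert S B)
  have B: "B \<subseteq> k_subsets d J" "disjoint B" "card B \<le> d"
    using insert.prems insert.hyps by (auto simp: pairwise_insert)
  have "\<not> flat v B \<subseteq> span (v ` S)" using disjoint_flat_closed[OF B, of S] insert by blast
  then have "dim (flat v (insert S B)) < dim (flat v B)" by (rule dim_flat_insert_less)
  moreover have "CARD('r) \<le> dim (flat v (insert S B)) + card (insert S B)"
    by (rule dim_flat_ge) (use insert in auto)
  ultimately show ?case using insert.IH[OF B] insert.hyps by simp
qed simp

lemma disjoint_flat_subset_iff:
  assumes B: "B \<subseteq> k_subsets d J" "disjoint B" "card B \<le> d" and B': "B' \<subseteq> k_subsets d J"
  shows "flat v B \<subseteq> flat v B' \<longleftrightarrow> B' \<subseteq> B"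
proof
  assume *: "flat v B \<subseteq> flat v B'"
  show "B' \<subseteq> B"
  proof
    fix S assume "S \<in> B'"
    then show "S \<in> B" using disjoint_flat_closed[OF B, of S] * B' by (auto simp: flat_def)
  qed
qed (rule flat_antimono)

lemma sum_Pow_alternating:
  assumes "finite A"
  shows "(\<Sum>X\<in>Pow A. (-1::int) ^ card X) = (if A = {} then 1 else 0)"
  using assms
proof (induction rule: finite_induct)
  case (insert a A)
  have "(\<Sum>X\<in>Pow (insert a A). (-1::int) ^ card X) =
      (\<Sum>X\<in>Pow A. (-1) ^ card X) + (\<Sum>X\<in>insert a ` Pow A. (-1) ^ card X)"
    unfolding Pow_insert by (rule sum.union_disjoint) (use insert in auto)
  also have "(\<Sum>X\<in>insert a ` Pow A. (-1::int) ^ card X) = (\<Sum>X\<in>Pow A. (-1) ^ card (insert a X))"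
    by (subst sum.reindex) (use insert in \<open>auto simp: inj_on_def\<close>)
  also have "\<dots> = (\<Sum>X\<in>Pow A. - ((-1) ^ card X))"
  proof (rule sum.cong[OF refl])
    fix X assume "X \<in> Pow A"
    then have "finite X" "a \<notin> X" using insert finite_subset by auto
    then show "(-1::int) ^ card (insert a X) = - ((-1) ^ card X)" by simp
  qed
  finally show ?case by (simp add: sum_negf)
qed simp

lemma moebius_disjoint_flat:
  assumes B: "B \<subseteq> k_subsets d J" "disjoint B" "card B \<le> d"
  shows "moebius (flats_over d v J) UNIV (flat v B) = (-1) ^ card B"
proof -
  let ?L = "flats_over d v J"
  have finB: "finite B" using finite_subset[OF B(1) finite_k_subsets[OF J(1)]] .
  have sub: "B' \<subseteq> k_subsets d J" "disjoint B'" "card B' \<le> d" "finite B'" if "B' \<subseteq> B" for B'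
    using that B card_mono[OF finB that] pairwise_subset[OF B(2) that] finite_subset[OF that finB] by auto
  \<comment> \<open>The sign is written through the codimension to make it a function of the flat;
    above \<open>flat v B\<close> the codimension is the number of hyperplanes.\<close>
  let ?f = "\<lambda>X. (-1::int) ^ (CARD('r) - dim X)"
  have fB: "?f (flat v B') = (-1) ^ card B'" if "B' \<subseteq> B" for B'
    using dim_disjoint_flat[OF sub(4,1,2,3)[OF that]] by (metis add_diff_cancel_left')
  have above: "{G. G \<in> ?L \<and> flat v B' \<subseteq> G} = flat v ` Pow B'" if "B' \<subseteq> B" for B'
  proof (intro equalityI subsetI)
    fix G assume "G \<in> {G. G \<in> ?L \<and> flat v B' \<subseteq> G}"
    then obtain B'' where B'': "B'' \<subseteq> k_subsets d J" "G = flat v B''" "flat v B' \<subseteq> flat v B''"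
      by (auto simp: flats_over_J)
    then show "G \<in> flat v ` Pow B'" using disjoint_flat_subset_iff[OF sub(1-3)[OF that] B''(1)] by blast
  next
    fix G assume "G \<in> flat v ` Pow B'"
    then obtain B'' where B'': "B'' \<subseteq> B'" "G = flat v B''" by blast
    then show "G \<in> {G. G \<in> ?L \<and> flat v B' \<subseteq> G}"
      using flat_antimono[OF B''(1), of v] sub(1)[of B''] that by (auto simp: flats_over_J)
  qed
  have inj: "inj_on (flat v) (Pow B)"
  proof (rule inj_onI)
    fix B1 B2 assume *: "B1 \<in> Pow B" "B2 \<in> Pow B" "flat v B1 = flat v B2"
    then have B12: "B1 \<subseteq> B" "B2 \<subseteq> B" by auto
    have "B2 \<subseteq> B1" using disjoint_flat_subset_iff[OF sub(1-3)[OF B12(1)] sub(1)[OF B12(2)]] * by simp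
    moreover have "B1 \<subseteq> B2" using disjoint_flat_subset_iff[OF sub(1-3)[OF B12(2)] sub(1)[OF B12(1)]] * by simp
    ultimately show "B1 = B2" by blast
  qed
  have UNIV0: "flat v B' = UNIV \<longleftrightarrow> B' = {}" if "B' \<subseteq> B" for B'
  proof
    assume "flat v B' = UNIV"
    then have "flat v B' = flat v {}" by simp
    then show "B' = {}" using inj_onD[OF inj, of B' "{}"] that by simp
  qed simp
  have "moebius ?L UNIV (flat v B) = ?f (flat v B)"
  proof (rule moebius_unique[of ?L "flat v ` Pow B"])
    show "finite ?L" using finite_flats_over J by blast
    show "UNIV \<in> ?L" by (rule UNIV_in_flats_over)
    show "flat v ` Pow B \<subseteq> ?L" using sub(1) by (auto simp: flats_over_J)
    show "flat v B \<in> flat v ` Pow B" by blast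
  next
    fix F G assume "F \<in> flat v ` Pow B" "G \<in> ?L" "F \<subseteq> G"
    then obtain B' where B': "B' \<subseteq> B" "flat v B' \<subseteq> G" by blast
    then have "G \<in> flat v ` Pow B'" using above[OF B'(1)] \<open>G \<in> ?L\<close> by blast
    then show "G \<in> flat v ` Pow B" using B' by blast
  next
    fix F assume "F \<in> flat v ` Pow B"
    then obtain B' where B': "B' \<subseteq> B" "F = flat v B'" by blast
    have "(\<Sum>G | G \<in> ?L \<and> F \<subseteq> G. ?f G) = (\<Sum>X\<in>Pow B'. ?f (flat v X))"
      unfolding B'(2) above[OF B'(1)]
      by (subst sum.reindex) (use inj_on_subset[OF inj, of "Pow B'"] B' in \<open>auto simp: o_def\<close>)
    also have "\<dots> = (\<Sum>X\<in>Pow B'. (-1) ^ card X)" using fB B' by (intro sum.cong) auto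
    also have "\<dots> = (if F = UNIV then 1 else 0)"
      using sum_Pow_alternating[OF sub(4)[OF B'(1)]] UNIV0[OF B'(1)] B'(2) by simp
    finally show "(\<Sum>G | G \<in> ?L \<and> F \<subseteq> G. ?f G) = (if F = UNIV then 1 else 0)" .
  qed
  then show ?thesis using fB[of B] by simp
qed

text \<open>If a point \<open>x\<close> of some \<open>a\<close> in \<open>B\<close> could be
  spared, the flat would lie in the span of \<open>a \<inter> R'\<close>, hence in the hyperplane
  obtained from \<open>a\<close> by exchanging \<open>x\<close> for a point \<open>y\<close> outside
  \<open>a\<close>. By closedness this hyperplane belongs to \<open>B\<close>, yet it meets
  \<open>a\<close>. If \<open>a \<inter> R'\<close> is empty, the flat would be 0 instead.\<close>

lemma exact_support_disjoint_flat:
  assumes B: "B \<subseteq> k_subsets d J" "disjoint B" "card B \<le> d"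
    and C: "C \<in> chains_to (flats_over d v J) (flat v B)"
  shows "exact_support d v (\<Union>B) C"
  unfolding exact_support_def
proof (intro conjI allI impI)
  have finB: "finite B" using finite_subset[OF B(1) finite_k_subsets[OF J(1)]] .
  show "C \<subseteq> flats_over d v (\<Union>B)"
  proof
    fix X assume "X \<in> C"
    then have "X \<in> flats_over d v J" "flat v B \<subseteq> X" using C by (auto simp: chains_to_def)
    then obtain B' where B': "B' \<subseteq> k_subsets d J" "X = flat v B'" by (auto simp: flats_over_J)
    then have "B' \<subseteq> B" using disjoint_flat_subset_iff[OF B B'(1)] \<open>flat v B \<subseteq> X\<close> by simp
    then show "X \<in> flats_over d v (\<Union>B)"
      using flats_over_unions[OF B'(1)] B'(2) flats_over_mono[of "\<Union>B'" "\<Union>B" d v] by blast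
  qed
  fix R' assume R': "R' \<subset> \<Union>B"
  show "\<not> C \<subseteq> flats_over d v R'"
  proof
    assume "C \<subseteq> flats_over d v R'"
    then have F: "flat v B \<in> flats_over d v R'" using C by (auto simp: chains_to_def)
    obtain a x where a: "a \<in> B" "x \<in> a" "x \<notin> R'" using R' by blast
    have aJ: "a \<subseteq> J" "card a = d" "finite a" using a B(1) finite_J by (auto simp: k_subsets_def)
    have "\<Union>B \<subseteq> J" using B(1) unfolding k_subsets_def by blast
    then have R'J: "R' \<subseteq> J" using R' by blast
    have sub: "flat v B \<subseteq> span (v ` (a \<inter> R'))"
      by (rule subset_span_Int[OF R'J F]) (use aJ a in \<open>auto simp: small_subsets_def flat_def\<close>)
    show False
    proof (cases "a \<inter> R' = {}")
      case True
      then have "flat v B \<subseteq> {0}" using sub by simp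
      then have "dim (flat v B) = 0" by simp
      then show False using dim_disjoint_flat[OF finB B] B(3) r by linarith
    next
      case False
      have "card a < card J" using aJ J r by simp
      then have "\<not> J \<subseteq> a" using card_mono[OF aJ(3)] by (metis not_less)
      then obtain y where y: "y \<in> J" "y \<notin> a" by blast
      let ?S = "insert y (a - {x})"
      have "card ?S = d" using aJ a y r by simp
      then have S: "?S \<in> k_subsets d J" using aJ y by (auto simp: k_subsets_def)
      have "span (v ` (a \<inter> R')) \<subseteq> span (v ` ?S)" by (rule span_mono) (use a in auto)
      then have "?S \<in> B" using disjoint_flat_closed[OF B S] sub by blast
      moreover have "?S \<noteq> a" using y by blast
      ultimately have "?S \<inter> a = {}" using a disjointD[OF B(2)] by blast
      then show False using False a by blast
    qed
  qed
qed

section \<open>Chains with the largest possible support\<close>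

definition partitions :: "nat set \<Rightarrow> nat set set set" where
  "partitions R = {B. B \<subseteq> k_subsets d R \<and> disjoint B \<and> \<Union>B = R}"

lemma partitions_nonempty:
  assumes "finite R" "card R = i * d"
  shows "partitions R \<noteq> {}"
  using assms
proof (induction i arbitrary: R)
  case 0
  then have "{} \<in> partitions R" by (auto simp: partitions_def)
  then show ?case by blast
next
  case (Suc i)
  obtain S where S: "S \<subseteq> R" "card S = d"
    using obtain_subset_with_card_n[of d R] Suc.prems by auto
  have "card (R - S) = i * d" using S Suc.prems card_Diff_subset[of S R] finite_subset[OF S(1)] by simp
  then obtain B where B: "B \<in> partitions (R - S)" using Suc.IH[of "R - S"] Suc.prems by blast
  then have "insert S B \<in> partitions R"
    using S by (auto simp: partitions_def k_subsets_def pairwise_insert disjnt_def)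
  then show ?case by blast
qed

text \<open>At most \<open>i\<close> sets of size \<open>d\<close> cover the \<open>i * d\<close>
  points of the support, so they partition it. Conversely, every chain down to the flat of a
  partition has support \<open>R\<close>. Distinct partitions have distinct flats, so the chains
  fall into classes, each contributing the Moebius value of its flat.\<close>

lemma chain_sum_top:
  assumes i: "i \<le> d" and R: "R \<subseteq> J" "card R = i * d"
  shows "chain_sum d v i R = (-1) ^ i * int (card (partitions R))"
proof -
  let ?L = "flats_over d v J"
  have finR: "finite R" using finite_J[OF R(1)] .
  have P: "B \<subseteq> k_subsets d J" "disjoint B" "card B = i" "\<Union>B = R" if "B \<in> partitions R" for B
  proof -
    have B: "B \<subseteq> k_subsets d R" "disjoint B" "\<Union>B = R" using that by (auto simp: partitions_def)
    show "B \<subseteq> k_subsets d J" using B(1) R(1) unfolding k_subsets_def by blast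
    have "card (\<Union>B) = (\<Sum>S\<in>B. card S)"
    proof (rule card_Union_disjoint[OF B(2)])
      fix A assume "A \<in> B"
      then have "A \<subseteq> R" using B(3) by blast
      then show "finite A" using finR finite_subset by blast
    qed
    also have "\<dots> = (\<Sum>S\<in>B. d)" using B(1) by (intro sum.cong) (auto simp: k_subsets_def)
    finally have "card B * d = i * d" using B(3) R(2) by auto
    then show "card B = i" using r by auto
    show "disjoint B" "\<Union>B = R" using B by auto
  qed
  have finP: "finite (partitions R)"
    by (rule finite_subset[of _ "Pow (k_subsets d R)"]) (use finite_k_subsets[OF finR] in \<open>auto simp: partitions_def\<close>)
  have fL: "finite ?L" using finite_flats_over J by blast
  have "{C. C \<in> flat_chains i \<and> exact_support d v R C} = (\<Union>B\<in>partitions R. chains_to ?L (flat v B))"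
  proof (intro equalityI subsetI)
    fix C assume "C \<in> {C. C \<in> flat_chains i \<and> exact_support d v R C}"
    then have C: "C \<in> flat_chains i" "exact_support d v R C" by auto
    obtain B where B: "B \<subseteq> k_subsets d J" "card B \<le> i" "flat v B \<in> C" "\<forall>X\<in>C. flat v B \<subseteq> X"
      "R \<subseteq> \<Union>B" "card (\<Union>B) \<le> card B * d"
      using flat_chain_support[OF R(1) C] by metis
    have finB: "finite B" using finite_subset[OF B(1) finite_k_subsets[OF J(1)]] .
    have finU: "finite (\<Union>B)" using B(1) finite_J[of "\<Union>B"] by (auto simp: k_subsets_def)
    have le: "card (\<Union>B) \<le> i * d" using B(2,6) by (meson le_trans mult_le_mono1)
    then have U: "R = \<Union>B" using card_seteq[OF finU B(5)] R(2) by simp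
    have "disjoint B"
    proof (rule pairwiseI, rule ccontr)
      fix a b assume ab: "a \<in> B" "b \<in> B" "a \<noteq> b" "\<not> disjnt a b"
      have fin: "finite a" "finite b" "card a = d" "card b = d"
        using ab B(1) finite_J by (auto simp: k_subsets_def)
      let ?B = "B - {a, b}"
      have "card (a \<inter> b) > 0" using ab fin by (auto simp: disjnt_def card_gt_0_iff)
      then have cab: "card (a \<union> b) < 2 * d" using card_Un_Int[OF fin(1,2)] fin by simp
      have "card (\<Union>?B) \<le> (\<Sum>S\<in>?B. card S)" by (rule card_Union_le_sum_card)
      also have "\<dots> = (\<Sum>S\<in>?B. d)" using B(1) by (intro sum.cong) (auto simp: k_subsets_def)
      also have "\<dots> = (card B - 2) * d" using ab finB by (simp add: card_Diff_subset numeral_2_eq_2)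
      finally have cr: "card (\<Union>?B) \<le> (card B - 2) * d" .
      have "\<Union>B = (a \<union> b) \<union> \<Union>?B" using ab by blast
      then have "card (\<Union>B) \<le> card (a \<union> b) + card (\<Union>?B)" using card_Un_le by metis
      also have "\<dots> < 2 * d + (card B - 2) * d" using cab cr by linarith
      also have "\<dots> = card B * d"
      proof -
        have "card {a, b} \<le> card B" using ab finB by (intro card_mono) auto
        then have "2 \<le> card B" using ab by simp
        then obtain n where "card B = n + 2" using le_Suc_ex add.commute by metis
        then show ?thesis by (simp add: algebra_simps)
      qed
      also have "\<dots> \<le> i * d" using B(2) by simp
      finally show False using U R(2) by simp
    qed
    then have "B \<in> partitions R" using B(1) U by (auto simp: partitions_def k_subsets_def)
    moreover have "C \<subseteq> ?L" using C(2) flats_over_mono[OF R(1), of d v] by (auto simp: exact_support_def)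
    then have "C \<in> chains_to ?L (flat v B)" using C(1) B by (auto simp: chains_to_def flat_chains_def)
    ultimately show "C \<in> (\<Union>B\<in>partitions R. chains_to ?L (flat v B))" by blast
  next
    fix C assume "C \<in> (\<Union>B\<in>partitions R. chains_to ?L (flat v B))"
    then obtain B where B: "B \<in> partitions R" "C \<in> chains_to ?L (flat v B)" by blast
    note PB = P[OF B(1)]
    have finB: "finite B" using finite_subset[OF PB(1) finite_k_subsets[OF J(1)]] .
    have "exact_support d v R C"
      using exact_support_disjoint_flat[OF PB(1,2) _ B(2)] PB(3,4) i by simp
    moreover have "dim (flat v B) + i = CARD('r)" using dim_disjoint_flat[OF finB PB(1,2)] PB(3) i by simp
    moreover have "finite C" using B(2) finite_subset[OF _ fL] by (auto simp: chains_to_def)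
    ultimately show "C \<in> {C. C \<in> flat_chains i \<and> exact_support d v R C}"
      using B(2) unfolding chains_to_def flat_chains_def by auto
  qed
  then have "chain_sum d v i R = (\<Sum>C\<in>(\<Union>B\<in>partitions R. chains_to ?L (flat v B)). (-1) ^ (card C + 1))"
    by (simp add: chain_sum_def)
  also have "\<dots> = (\<Sum>B\<in>partitions R. \<Sum>C\<in>chains_to ?L (flat v B). (-1) ^ (card C + 1))"
  proof (rule sum.UNION_disjoint[OF finP])
    show "\<forall>B\<in>partitions R. finite (chains_to ?L (flat v B))"
      using fL by (auto intro!: finite_subset[of _ "Pow ?L"] simp: chains_to_def)
    show "\<forall>B\<in>partitions R. \<forall>B'\<in>partitions R. B \<noteq> B' \<longrightarrow>
        chains_to ?L (flat v B) \<inter> chains_to ?L (flat v B') = {}"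
    proof (intro ballI impI, rule ccontr)
      fix B B' assume BB': "B \<in> partitions R" "B' \<in> partitions R" "B \<noteq> B'"
        "chains_to ?L (flat v B) \<inter> chains_to ?L (flat v B') \<noteq> {}"
      then have "flat v B = flat v B'" unfolding chains_to_def by blast
      then have "B' \<subseteq> B" "B \<subseteq> B'"
        using disjoint_flat_subset_iff[of B B'] disjoint_flat_subset_iff[of B' B] P[OF BB'(1)] P[OF BB'(2)] i
        by auto
      then show False using BB'(3) by blast
    qed
  qed
  also have "\<dots> = (\<Sum>B\<in>partitions R. (-1) ^ i)"
  proof (rule sum.cong[OF refl])
    fix B assume B: "B \<in> partitions R"
    have "flat v B \<in> ?L" using P(1)[OF B] by (auto simp: flats_over_J)
    then have "(\<Sum>C\<in>chains_to ?L (flat v B). (-1) ^ (card C + 1)) = moebius ?L UNIV (flat v B)"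
      by (rule moebius_eq_chain_sum[OF fL UNIV_in_flats_over, symmetric])
    also have "\<dots> = (-1) ^ i" using moebius_disjoint_flat[OF P(1,2)[OF B]] P(3)[OF B] i by simp
    finally show "(\<Sum>C\<in>chains_to ?L (flat v B). (-1::int) ^ (card C + 1)) = (-1) ^ i" .
  qed
  finally show ?thesis by simp
qed

lemma chain_sum_top_nonzero:
  assumes i: "i \<le> d" and R: "R \<subseteq> J" "card R = i * d"
  shows "chain_sum d v i R \<noteq> 0"
proof -
  have fin: "finite R" using finite_J R by blast
  have "finite (partitions R)"
    by (rule finite_subset[of _ "Pow (k_subsets d R)"]) (use finite_k_subsets[OF fin] in \<open>auto simp: partitions_def\<close>)
  then show ?thesis using chain_sum_top[OF assms] partitions_nonempty[OF fin R(2)] by simp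
qed

end

subsection \<open>Polynomiality in the number of points\<close>

definition binomial_poly :: "nat \<Rightarrow> real poly" where
  "binomial_poly s = Polynomial.smult (1 / fact s) (\<Prod>i<s. [:- of_nat i, 1:])"

lemma poly_binomial_poly: "poly (binomial_poly s) (of_nat n) = of_nat (n choose s)"
proof -
  have "poly (binomial_poly s) (of_nat n) = (\<Prod>i<s. of_nat n - of_nat i) / fact s"
    by (simp add: binomial_poly_def poly_prod)
  also have "\<dots> = of_nat n gchoose s" by (simp add: gbinomial_prod_rev lessThan_atLeast0)
  finally show ?thesis by (simp add: binomial_gbinomial)
qed

lemma degree_binomial_poly: "degree (binomial_poly s) = s"
proof -
  have "degree (\<Prod>i<s. [:- of_nat i, 1::real:]) = (\<Sum>i<s. 1)"
    by (subst degree_prod_sum_eq) auto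
  then show ?thesis by (simp add: binomial_poly_def)
qed

text \<open>
  The signed number of chains with a given support of \<open>s\<close> points. The value 1 for sizes \<open>s\<close> that
  occur in no generic configuration keeps the leading coefficient nonzero, so that the existence of
  generic configurations is never an issue.
\<close>

definition support_coeff :: "nat \<Rightarrow> (nat \<Rightarrow> real ^ 'r::{finite,linorder}) itself \<Rightarrow> nat \<Rightarrow> nat \<Rightarrow> real" where
  "support_coeff d T i s =
    (if \<exists>v :: nat \<Rightarrow> real ^ 'r::{finite,linorder}. \<exists>J R. generic v J d \<and> R \<subseteq> J \<and> card R = s
     then SOME c. \<exists>v :: nat \<Rightarrow> real ^ 'r::{finite,linorder}. \<exists>J R.
       generic v J d \<and> R \<subseteq> J \<and> card R = s \<and> c = of_int (chain_sum d v i R)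
     else 1)"

lemma support_coeff_eq:
  fixes v :: "nat \<Rightarrow> real ^ 'r::{finite,linorder}"
  assumes "generic v J d" "R \<subseteq> J"
  shows "support_coeff d TYPE(nat \<Rightarrow> real ^ 'r::{finite,linorder}) i (card R) = of_int (chain_sum d v i R)"
proof -
  let ?P = "\<lambda>c::real. \<exists>w :: nat \<Rightarrow> real ^ 'r::{finite,linorder}. \<exists>J' R'.
       generic w J' d \<and> R' \<subseteq> J' \<and> card R' = card R \<and> c = of_int (chain_sum d w i R')"
  have ex: "\<exists>w :: nat \<Rightarrow> real ^ 'r::{finite,linorder}. \<exists>J' R'. generic w J' d \<and> R' \<subseteq> J' \<and> card R' = card R"
    using assms by blast
  have "?P (of_int (chain_sum d v i R))" using assms by blast
  then have "?P (SOME c. ?P c)" by (rule someI)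
  then obtain w :: "nat \<Rightarrow> real ^ 'r::{finite,linorder}" and J' R' where
    w: "generic w J' d" "R' \<subseteq> J'" "card R' = card R" "(SOME c. ?P c) = of_int (chain_sum d w i R')" by blast
  show ?thesis unfolding support_coeff_def using ex w(4) chain_sum_card[OF w(1) assms(1) w(2) assms(2) w(3)]
    by simp
qed

definition flat_poly :: "nat \<Rightarrow> (nat \<Rightarrow> real ^ 'r::{finite,linorder}) itself \<Rightarrow> nat \<Rightarrow> real poly" where
  "flat_poly d T i = (\<Sum>s\<le>i * d. Polynomial.smult (support_coeff d T i s) (binomial_poly s))"

lemma degree_flat_poly:
  assumes "i \<le> d"
  shows "degree (flat_poly d TYPE(nat \<Rightarrow> real ^ 'r::{finite,linorder}) i) = i * d"
proof -
  let ?c = "support_coeff d TYPE(nat \<Rightarrow> real ^ 'r::{finite,linorder}) i"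
  have nz: "?c (i * d) \<noteq> 0"
  proof (cases "\<exists>v :: nat \<Rightarrow> real ^ 'r::{finite,linorder}. \<exists>J R. generic v J d \<and> R \<subseteq> J \<and> card R = i * d")
    case True
    then obtain v :: "nat \<Rightarrow> real ^ 'r::{finite,linorder}" and J R where
      v: "generic v J d" "R \<subseteq> J" "card R = i * d" by blast
    then show ?thesis using support_coeff_eq[OF v(1,2), of i] generic.chain_sum_top_nonzero[OF v(1) assms v(2,3)]
      by simp
  next
    case False
    then show ?thesis unfolding support_coeff_def by (simp only: if_False)
  qed
  have "degree (\<Sum>s<i * d. Polynomial.smult (?c s) (binomial_poly s)) < i * d" if "i * d > 0"
    by (rule degree_sum_less) (use that in \<open>auto simp: degree_binomial_poly intro: le_less_trans[OF degree_smult_le]\<close>)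
  moreover have "flat_poly d TYPE(nat \<Rightarrow> real ^ 'r::{finite,linorder}) i =
      (\<Sum>s<i * d. Polynomial.smult (?c s) (binomial_poly s)) + Polynomial.smult (?c (i * d)) (binomial_poly (i * d))"
    unfolding flat_poly_def by (simp add: lessThan_Suc_atMost[symmetric])
  moreover have "degree (Polynomial.smult (?c (i * d)) (binomial_poly (i * d))) = i * d"
    using nz by (simp add: degree_binomial_poly)
  ultimately show ?thesis
    by (cases "i * d > 0") (auto simp: degree_add_eq_right)
qed

theorem (in generic) sum_moebius_eq_poly:
  "of_int (\<Sum>F | F \<in> flats_over d v J \<and> dim F + i = CARD('r). moebius (flats_over d v J) UNIV F) =
    poly (flat_poly d TYPE(nat \<Rightarrow> real ^ 'r::{finite,linorder}) i) (of_nat (card J))"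
proof -
  let ?c = "support_coeff d TYPE(nat \<Rightarrow> real ^ 'r::{finite,linorder}) i"
  let ?h = "\<lambda>s. if s \<le> i * d then ?c s else 0"
  have "of_int (\<Sum>R\<in>Pow J. chain_sum d v i R) = (\<Sum>R\<in>Pow J. ?h (card R))"
    unfolding of_int_sum
  proof (rule sum.cong[OF refl])
    fix R assume "R \<in> Pow J"
    then show "of_int (chain_sum d v i R) = ?h (card R)"
      using support_coeff_eq[OF generic_axioms, of R i] chain_sum_eq_0[of R i] by auto
  qed
  also have "\<dots> = (\<Sum>s\<le>card J. \<Sum>R\<in>{R \<in> Pow J. card R = s}. ?h (card R))"
    by (rule sum.group[symmetric]) (use J card_mono in auto)
  also have "\<dots> = (\<Sum>s\<le>card J. of_nat (card J choose s) * ?h s)"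
  proof (rule sum.cong[OF refl])
    fix s
    have "card {R \<in> Pow J. card R = s} = card J choose s" using n_subsets[OF J(1)] by simp
    then show "(\<Sum>R\<in>{R \<in> Pow J. card R = s}. ?h (card R)) = of_nat (card J choose s) * ?h s" by simp
  qed
  \<comment> \<open>Both ranges are embedded in a common one: the binomial coefficient vanishes for
    \<open>s > card J\<close>, and \<open>?h s\<close> for \<open>s > i * d\<close>. So the final
    range does not depend on the number of points.\<close>
  also have "\<dots> = (\<Sum>s\<le>max (card J) (i * d). of_nat (card J choose s) * ?h s)"
    by (rule sum.mono_neutral_left) auto
  also have "\<dots> = (\<Sum>s\<le>i * d. of_nat (card J choose s) * ?h s)"
    by (rule sum.mono_neutral_right) auto
  also have "\<dots> = poly (flat_poly d TYPE(nat \<Rightarrow> real ^ 'r::{finite,linorder}) i) (of_nat (card J))"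
    by (simp add: flat_poly_def poly_sum poly_binomial_poly mult.commute)
  finally show ?thesis unfolding sum_moebius_eq_chain_sum .
qed

subsection \<open>Very generic parameters give generic configurations\<close>

lemma flat_linear_image:
  fixes v w :: "nat \<Rightarrow> real ^ 'r::{finite,linorder}"
  assumes h: "linear h" "inj h" and c: "\<And>j. j \<in> \<Union>B \<Longrightarrow> c j \<noteq> 0 \<and> w j = c j *\<^sub>R h (v j)"
  shows "S \<in> B \<Longrightarrow> span (w ` S) = h ` span (v ` S)" "flat w B = h ` flat v B"
proof -
  show sp: "span (w ` S) = h ` span (v ` S)" if S: "S \<in> B" for S
  proof -
    have "span (w ` S) = span (h ` v ` S)"
    proof (intro subset_antisym span_minimal subspace_span)
      have cS: "c j \<noteq> 0" "w j = c j *\<^sub>R h (v j)" if "j \<in> S" for j using c[of j] S that by auto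
      have "w j \<in> span (h ` v ` S)" if "j \<in> S" for j
        unfolding cS(2)[OF that] using that by (intro span_scale span_base imageI)
      then show "w ` S \<subseteq> span (h ` v ` S)" by blast
      have "h (v j) = (1 / c j) *\<^sub>R w j" if "j \<in> S" for j using cS[OF that] by simp
      then have "h (v j) \<in> span (w ` S)" if "j \<in> S" for j
        using span_scale[OF span_base[OF imageI[OF that]], of "1 / c j" w] that by simp
      then show "h ` v ` S \<subseteq> span (w ` S)" by blast
    qed
    then show ?thesis using h(1) by (simp add: linear_span_image)
  qed
  show "flat w B = h ` flat v B"
  proof (cases "B = {}")
    case True
    then show ?thesis using linear_inj_imp_surj[OF h] by simp
  next
    case False
    then show ?thesis unfolding flat_def using sp image_INT[of h UNIV B "\<lambda>S. span (v ` S)"] h(2) by auto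
  qed
qed

lemma ind_fam_iff_dim:
  fixes v :: "'i \<Rightarrow> 'a::euclidean_space"
  shows "finite S \<Longrightarrow> ind_fam v S \<longleftrightarrow> dim (span (v ` S)) = card S"
  using dim_ind_fam dim_eq_card_ind_fam by (metis dim_span)

text \<open>Independence of normals is expressed through dimensions of spans and flats, which an
  invertible linear map and a rescaling of the vectors preserve. The way in which the normals
  themselves transform never enters.\<close>

lemma ind_fam_normal_linear_image:
  fixes v w :: "nat \<Rightarrow> real ^ 'r::{finite,linorder}"
  assumes h: "linear h" "inj h" and c: "\<And>j. j \<in> \<Union>B \<Longrightarrow> c j \<noteq> 0 \<and> w j = c j *\<^sub>R h (v j)"
    and B: "finite B" "\<And>S. S \<in> B \<Longrightarrow> finite S \<and> card S = CARD('r) - 1"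
  shows "ind_fam (normal w) B \<longleftrightarrow> ind_fam (normal v) B"
proof -
  have dimh: "dim (h ` X) = dim X" for X
    by (rule dim_image_eq) (use h in \<open>auto intro: inj_on_subset\<close>)
  have "ind_fam w S \<longleftrightarrow> ind_fam v S" if "S \<in> B" for S
    using B(2)[OF that] flat_linear_image(1)[OF h c that] dimh by (simp add: ind_fam_iff_dim)
  moreover have "dim (flat w B) = dim (flat v B)" using flat_linear_image(2)[OF h c] dimh by simp
  ultimately show ?thesis using ind_fam_normal_iff[OF B, of v] ind_fam_normal_iff[OF B, of w] by simp
qed

lemma exists_avoiding_hyperplanes:
  fixes X :: "'a::euclidean_space set"
  assumes "finite X" "0 \<notin> X"
  obtains a where "\<And>x. x \<in> X \<Longrightarrow> a \<bullet> x \<noteq> 0"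
proof -
  have "negligible (\<Union>x\<in>X. {a. x \<bullet> a = 0})"
    using assms by (intro negligible_Union) (auto intro!: negligible_hyperplane)
  then have "(\<Union>x\<in>X. {a. x \<bullet> a = 0}) \<noteq> UNIV" using open_not_negligible[OF open_UNIV] by auto
  then obtain a where "a \<notin> (\<Union>x\<in>X. {a. x \<bullet> a = 0})" by blast
  then show ?thesis using that[of a] by (auto simp: inner_commute)
qed

text \<open>Independence at \<open>z'\<close> yields a minor that is nonzero there, hence not
  identically zero; very genericity makes it nonzero at \<open>z\<close>.\<close>

lemma very_generic_ind_fam:
  assumes vg: "very_generic (V :: 'p \<Rightarrow> nat \<Rightarrow> real ^ 'r::{finite,linorder}) m z"
    and B: "B \<subseteq> k_subsets (CARD('r) - 1) {1..m}"
    and ex: "ind_fam (normal (V z')) B"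
  shows "ind_fam (normal (V z)) B"
proof -
  have finB: "finite B" using B finite_k_subsets finite_subset by blast
  obtain Ss where Ss: "set Ss = B" "distinct Ss" using finite_distinct_list[OF finB] by blast
  obtain rs where rs: "distinct rs" "length rs = length Ss" "minor (\<lambda>S r. normal (V z') S $ r) Ss rs \<noteq> 0"
    using ind_fam_nonzero_minor[OF finB ex Ss] .
  have "set Ss \<subseteq> index_sets CARD('r) m" using B Ss by (auto simp: index_sets_def k_subsets_def)
  moreover have "minor (hyperplane_coeff (V z')) Ss rs \<noteq> 0" using rs(3) by (simp add: normal_def)
  ultimately have "minor (hyperplane_coeff (V z)) Ss rs \<noteq> 0"
    using vg Ss(2) rs(1,2) unfolding very_generic_def by metis
  then have "ind_fam (normal (V z)) (set Ss)"
    using Ss rs by (intro nonzero_minor_ind_fam[of Ss rs]) (auto simp: normal_def)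
  then show ?thesis using Ss by simp
qed

text \<open>Here the columns of the minor are confined to \<open>Q\<close>. With \<open>Q\<close>
  the coordinates other than \<open>None\<close>, this handles the linear parts of the equations of
  affine hyperplanes.\<close>

lemma very_generic_restricted:
  assumes vg: "very_generic (V :: 'p \<Rightarrow> nat \<Rightarrow> real ^ 'r::{finite,linorder}) m z"
    and B: "B \<subseteq> k_subsets (CARD('r) - 1) {1..m}"
    and ex: "\<And>u. (\<And>r. r \<in> Q \<Longrightarrow> (\<Sum>S\<in>B. u S * normal (V z') S $ r) = 0) \<Longrightarrow> \<forall>S\<in>B. u S = 0"
    and u: "\<And>r. r \<in> Q \<Longrightarrow> (\<Sum>S\<in>B. u S * normal (V z) S $ r) = 0" "S \<in> B"
  shows "u S = 0"
proof -
  have finB: "finite B" using B finite_k_subsets finite_subset by blast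
  obtain Ss where Ss: "set Ss = B" "distinct Ss" using finite_distinct_list[OF finB] by blast
  obtain R where R: "R \<subseteq> Q" "card R = card B"
    "\<And>u. (\<And>r. r \<in> R \<Longrightarrow> (\<Sum>S\<in>B. u S * normal (V z') S $ r) = 0) \<Longrightarrow> \<forall>S\<in>B. u S = 0"
    using select_coordinates[OF finB ex, where Q = Q] by blast
  let ?rs = "sorted_list_of_set R"
  have len: "length Ss = length ?rs" using R(2) Ss distinct_card[OF Ss(2)] by simp
  have "minor (hyperplane_coeff (V z')) Ss ?rs \<noteq> 0"
    unfolding minor_nonzero_iff_rows[OF Ss(2) len] using R(3) Ss(1) by (simp add: normal_def)
  moreover have "set Ss \<subseteq> index_sets CARD('r) m" using B Ss by (auto simp: index_sets_def k_subsets_def)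
  ultimately have "minor (hyperplane_coeff (V z)) Ss ?rs \<noteq> 0"
    using vg Ss(2) len unfolding very_generic_def by (metis distinct_sorted_list_of_set)
  then show ?thesis
    unfolding minor_nonzero_iff_rows[OF Ss(2) len] using R(1) Ss(1) u by (auto simp: normal_def)
qed

lemma flat_inside_hyperplane:
  fixes v :: "nat \<Rightarrow> real ^ 'r::{finite,linorder}"
  assumes sp: "spanned_hyperplanes v B" and sub: "flat v B \<subseteq> {x. a \<bullet> x = 0}"
  shows "a \<in> span (normal v ` B)"
proof -
  obtain y z where yz: "y \<in> span (normal v ` B)" "\<And>w. w \<in> span (normal v ` B) \<Longrightarrow> real_inner_class.orthogonal z w" "a = y + z"
    using orthogonal_subspace_decomp_exists[of "normal v ` B" a] by blast
  have "normal v S \<bullet> z = 0" if "S \<in> B" for S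
    using yz(2)[OF span_base[OF imageI[OF that]]] by (simp add: real_inner_class.orthogonal_def inner_commute)
  then have "z \<in> flat v B" unfolding flat_eq_normal[OF sp] by simp
  then have "a \<bullet> z = 0" using sub by blast
  moreover have "y \<bullet> z = 0" using yz(1,2) by (simp add: real_inner_class.orthogonal_def inner_commute)
  ultimately have "z = 0" using yz(3) by (simp add: inner_add_left)
  then show ?thesis using yz by simp
qed

section \<open>Vectors as homogenized points\<close>

lemma homogenize_nth [simp]: "homogenize y $ None = 1" "homogenize y $ Some i = y $ i"
  by (simp_all add: homogenize_def)

text \<open>After a suitable rotation none of the finitely many vectors involved has first
  coordinate 0, and division by it turns them into homogenized points.\<close>

lemma exists_homogeneous_points:
  fixes v :: "nat \<Rightarrow> real ^ ('n::{finite,linorder}) option"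
  assumes ind: "ind_fam (normal v) B"
    and B: "B \<subseteq> k_subsets (CARD('n option) - 1) {1..m}"
  obtains P :: "nat \<Rightarrow> real ^ 'n::{finite,linorder}" where "ind_fam (normal (homogeneous_points P)) B"
    "card B < CARD('n option) \<Longrightarrow> \<not> flat (homogeneous_points P) B \<subseteq> {x. x $ None = 0}"
proof -
  have finB: "finite B" using B finite_k_subsets finite_subset by blast
  have BS: "finite S \<and> card S = CARD('n option) - 1" if "S \<in> B" for S
    using B that finite_subset[of S "{1..m}"] by (auto simp: k_subsets_def)
  have finU: "finite (\<Union>B)" using finB BS by blast
  note iff = ind_fam_normal_iff[OF finB BS, of v]
  have vnz: "v j \<noteq> 0" if j: "j \<in> \<Union>B" for j
  proof -
    obtain S where S: "S \<in> B" "j \<in> S" using j by blast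
    then have "ind_fam v S" using ind iff by blast
    then show ?thesis using ind_fam_nonzero[of v S j] S(2) by simp
  qed
  \<comment> \<open>A nonzero vector of the flat, if there is one, is rotated away from infinity
    together with the \<open>v j\<close>; it certifies the second claim.\<close>
  obtain w0 where w0: "w0 \<in> flat v B" "w0 \<noteq> 0 \<or> card B = CARD('n option)"
  proof (cases "card B = CARD('n option)")
    case True
    then show ?thesis using that[of 0] subspace_0[OF subspace_flat, of v B] by simp
  next
    case False
    then have "dim (flat v B) \<noteq> 0" using ind iff by linarith
    then have "\<not> flat v B \<subseteq> {0}" by simp
    then obtain x where "x \<in> flat v B" "x \<noteq> 0" by blast
    then show ?thesis using that[of x] by simp
  qed
  let ?X = "insert w0 (v ` \<Union>B) - {0}"
  obtain a where a: "\<And>x. x \<in> ?X \<Longrightarrow> a \<bullet> x \<noteq> 0"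
    using exists_avoiding_hyperplanes[of ?X] finU by auto
  \<comment> \<open>Rotating \<open>a\<close> to the axis of \<open>None\<close> makes the
    coordinate \<open>None\<close> of \<open>f x\<close> nonzero whenever
    \<open>a \<bullet> x\<close> is.\<close>
  have "norm a = norm (norm a *\<^sub>R axis (None :: 'n option) (1::real))" by simp
  then obtain f where f: "orthogonal_transformation f" "f a = norm a *\<^sub>R axis (None :: 'n option) (1::real)"
    by (rule orthogonal_transformation_exists)
  have fl: "linear f" "inj f" using f(1) by (auto simp: orthogonal_transformation_linear orthogonal_transformation_inj)
  have fNone: "f x $ None \<noteq> 0" if "a \<bullet> x \<noteq> 0" for x
  proof
    assume "f x $ None = 0"
    then have "f a \<bullet> f x = 0" unfolding f(2) by (simp add: inner_axis')
    then show False using that f(1) by (simp add: orthogonal_transformation_def)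
  qed
  define P where "P j = (\<chi> i. f (v j) $ Some i / f (v j) $ None)" for j
  define c where "c j = 1 / f (v j) $ None" for j
  have c: "c j \<noteq> 0 \<and> homogeneous_points P j = c j *\<^sub>R f (v j)" if "j \<in> \<Union>B" for j
  proof -
    have n: "f (v j) $ None \<noteq> 0" by (rule fNone, rule a) (use that vnz in auto)
    have "homogeneous_points P j $ r = (c j *\<^sub>R f (v j)) $ r" for r
      using n by (cases r) (simp_all add: homogeneous_points_def P_def c_def)
    then show ?thesis using n by (simp add: c_def Finite_Cartesian_Product.vec_eq_iff)
  qed
  show ?thesis
  proof (rule that[of P])
    show "ind_fam (normal (homogeneous_points P)) B"
      using ind_fam_normal_linear_image[OF fl c finB BS] ind by simp
    assume "card B < CARD('n option)"
    then have "w0 \<noteq> 0" using w0 by simp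
    then have "f w0 $ None \<noteq> 0" by (intro fNone a) simp
    moreover have "f w0 \<in> flat (homogeneous_points P) B"
      using flat_linear_image(2)[OF fl c] w0(1) by simp
    ultimately show "\<not> flat (homogeneous_points P) B \<subseteq> {x. x $ None = 0}" by blast
  qed
qed

lemma generic_homogeneous_points:
  fixes P :: "nat \<Rightarrow> real ^ 'n::{finite,linorder}"
  assumes vg: "very_generic homogeneous_points m P" and m: "CARD('n) < m"
  shows "generic (homogeneous_points P) {1..m} (CARD('n))"
proof
  show "generic_config (homogeneous_points P) {1..m}"
  proof (rule generic_configI)
    fix B and v' :: "nat \<Rightarrow> real ^ ('n::{finite,linorder}) option"
    assume B: "B \<subseteq> k_subsets (CARD('n option) - 1) {1..m}" "ind_fam (normal v') B"
    obtain P' :: "nat \<Rightarrow> real ^ 'n::{finite,linorder}" where "ind_fam (normal (homogeneous_points P')) B"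
      using exists_homogeneous_points[OF B(2,1)] by blast
    then show "ind_fam (normal (homogeneous_points P)) B" using very_generic_ind_fam[OF vg B(1), of P'] by simp
  qed (use m in auto)
qed (use m in auto)

text \<open>A flat at infinity has the axis of \<open>None\<close> in the span of its normals, so an
  independent set of normals has dependent linear parts. For some other points \<open>P'\<close> the
  same set of hyperplanes has a flat off infinity and hence independent linear parts; very
  genericity carries this over to \<open>P\<close>.\<close>

lemma homogeneous_points_transversal:
  fixes P :: "nat \<Rightarrow> real ^ 'n::{finite,linorder}"
  assumes vg: "very_generic homogeneous_points m P" and m: "CARD('n) < m"
    and F: "F \<in> flats_over CARD('n) (homogeneous_points P) {1..m}" "1 \<le> dim F"
  shows "\<not> F \<subseteq> {x. x $ None = 0}"
proof -
  let ?v = "homogeneous_points P"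
  interpret generic ?v "{1..m}" "CARD('n)" by (rule generic_homogeneous_points[OF vg m])
  obtain B where B: "B \<subseteq> k_subsets CARD('n) {1..m}" "F = flat ?v B" using F(1) flats_over_J by blast
  obtain B0 where B0: "B0 \<subseteq> B" "ind_fam (normal ?v) B0" "flat ?v B0 = flat ?v B"
    using exists_independent_normals[OF spanned[OF B(1)]] .
  have B0k: "B0 \<subseteq> k_subsets (CARD('n option) - 1) {1..m}" using B0 B by auto
  have sp: "spanned_hyperplanes ?v B0" using spanned[of B0] B0k by simp
  then have finB0: "finite B0" by (simp add: spanned_hyperplanes_def)
  have "dim (flat ?v B0) + card B0 = CARD('n option)"
    using ind_fam_normal_iff[of B0 ?v] sp B0(2) unfolding spanned_hyperplanes_def by blast
  then have "dim F + card B0 = CARD('n option)" using B(2) B0(3) by simp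
  then have cB0: "card B0 < CARD('n option)" using F(2) by linarith
  obtain P' :: "nat \<Rightarrow> real ^ 'n::{finite,linorder}" where P': "ind_fam (normal (homogeneous_points P')) B0"
    "\<not> flat (homogeneous_points P') B0 \<subseteq> {x. x $ None = 0}"
    using exists_homogeneous_points[OF B0(2) B0k] cB0 by blast
  have sp': "spanned_hyperplanes (homogeneous_points P') B0"
    using P'(1) ind_fam_normal_iff[of B0 "homogeneous_points P'"] sp unfolding spanned_hyperplanes_def by blast
  let ?Q = "- {None :: 'n option}"
  have comb: "(\<Sum>S\<in>B0. u S *\<^sub>R normal w S) = (\<Sum>S\<in>B0. u S * normal w S $ None) *\<^sub>R axis None 1"
    if "\<And>r. r \<in> ?Q \<Longrightarrow> (\<Sum>S\<in>B0. u S * normal w S $ r) = 0" for u and w :: "nat \<Rightarrow> real ^ ('n::{finite,linorder}) option"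
  proof -
    have "(\<Sum>S\<in>B0. u S *\<^sub>R normal w S) $ r = ((\<Sum>S\<in>B0. u S * normal w S $ None) *\<^sub>R axis None 1) $ r" for r
      using that[of r] by (cases "r = None") (auto simp: axis_def)
    then show ?thesis unfolding Finite_Cartesian_Product.vec_eq_iff by blast
  qed
  have restr': "\<forall>S\<in>B0. u S = 0"
    if u: "\<And>r. r \<in> ?Q \<Longrightarrow> (\<Sum>S\<in>B0. u S * normal (homogeneous_points P') S $ r) = 0" for u
  proof -
    let ?t = "\<Sum>S\<in>B0. u S * normal (homogeneous_points P') S $ None"
    let ?y = "\<Sum>S\<in>B0. u S *\<^sub>R normal (homogeneous_points P') S"
    have y: "?y = ?t *\<^sub>R axis None 1" by (rule comb[OF u])
    obtain x where x: "x \<in> flat (homogeneous_points P') B0" "x $ None \<noteq> 0" using P'(2) by blast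
    have "?y \<bullet> x = 0" using x(1) unfolding flat_eq_normal[OF sp'] by (simp add: inner_sum_left)
    then have "?t = 0" using x(2) unfolding y by (simp add: inner_axis')
    then have "?y = 0" using y by simp
    then show ?thesis using ind_famD[OF P'(1) finB0] by blast
  qed
  show ?thesis
  proof
    assume "F \<subseteq> {x. x $ None = 0}"
    then have "flat ?v B0 \<subseteq> {x. axis None 1 \<bullet> x = 0}" using B(2) B0(3) by (auto simp: inner_axis')
    then have "axis None 1 \<in> span (normal ?v ` B0)" by (rule flat_inside_hyperplane[OF sp])
    from this[unfolded span_image_iff[OF finB0]]
    obtain u where u: "axis None 1 = (\<Sum>S\<in>B0. u S *\<^sub>R normal ?v S)" by (rule exE)
    have z: "(\<Sum>S\<in>B0. u S * normal ?v S $ r) = 0" if "r \<in> ?Q" for r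
    proof -
      have "(\<Sum>S\<in>B0. u S *\<^sub>R normal ?v S) $ r = 0" unfolding u[symmetric] using that by (simp add: axis_def)
      then show ?thesis by simp
    qed
    have "u S = 0" if S: "S \<in> B0" for S
    proof (rule very_generic_restricted[OF vg B0k _ _ S, where Q = ?Q and z' = P'])
      fix u assume "\<And>r. r \<in> ?Q \<Longrightarrow> (\<Sum>S\<in>B0. u S * normal (homogeneous_points P') S $ r) = 0"
      then show "\<forall>S\<in>B0. u S = 0" by (rule restr')
    qed (rule z)
    then have "(axis None 1 :: real ^ ('n::{finite,linorder}) option) = 0" unfolding u by simp
    then show False by (simp add: axis_eq_0_iff)
  qed
qed

text \<open>Independence of the normals of \<open>B\<close> does not yet put all the vectors in
  general position, which a projective frame requires. The vectors are moved one at a time, each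
  within a neighbourhood that keeps the normals independent, so as to avoid finitely many proper
  subspaces.\<close>

lemma exists_general_position:
  fixes v :: "nat \<Rightarrow> real ^ 'r::{finite,linorder}"
  assumes ind: "ind_fam (normal v) B" and B: "finite B" "\<And>S. S \<in> B \<Longrightarrow> finite S \<and> card S = CARD('r) - 1"
  obtains w :: "nat \<Rightarrow> real ^ 'r::{finite,linorder}" where "ind_fam (normal w) B" "\<And>T. T \<subseteq> {1..n} \<Longrightarrow> card T \<le> CARD('r) \<Longrightarrow> ind_fam w T"
proof -
  have "\<exists>w. ind_fam (normal w) B \<and> (\<forall>T\<subseteq>{1..n}. card T \<le> CARD('r) \<longrightarrow> ind_fam (w :: nat \<Rightarrow> real ^ 'r::{finite,linorder}) T)"
  proof (induction n)
    case 0
    show ?case using ind by (intro exI[of _ v]) (auto simp: ind_fam_def independent_empty)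
  next
    case (Suc n)
    then obtain w :: "nat \<Rightarrow> real ^ 'r::{finite,linorder}" where
      w: "ind_fam (normal w) B" "\<And>T. T \<subseteq> {1..n} \<Longrightarrow> card T \<le> CARD('r) \<Longrightarrow> ind_fam w T" by blast
    let ?w = "\<lambda>u. w(Suc n := u)"
    have lim: "((\<lambda>u. ?w u i) \<longlongrightarrow> w i) (nhds (w (Suc n)))" for i
      by (cases "i = Suc n") (auto intro: tendsto_ident_at filterlim_ident)
    have "\<forall>\<^sub>F u in nhds (w (Suc n)). ind_fam (normal (?w u)) B"
    proof (rule eventually_ind_fam[OF B(1) _ w(1)])
      fix S assume "S \<in> B"
      then show "((\<lambda>u. normal (?w u) S) \<longlongrightarrow> normal w S) (nhds (w (Suc n)))"
        using B(2) lim by (intro tendsto_normal) auto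
    qed
    then obtain U where U: "open U" "w (Suc n) \<in> U" "\<And>u. u \<in> U \<Longrightarrow> ind_fam (normal (?w u)) B"
      unfolding eventually_nhds by blast
    let ?T = "{T. T \<subseteq> {1..n} \<and> card T < CARD('r)}"
    have "negligible (\<Union>T\<in>?T. span (w ` T))"
    proof (rule negligible_Union)
      show "finite ((\<lambda>T. span (w ` T)) ` ?T)"
        by (rule finite_imageI, rule finite_subset[of _ "Pow {1..n}"]) auto
      fix X assume "X \<in> (\<lambda>T. span (w ` T)) ` ?T"
      then obtain T where T: "T \<subseteq> {1..n}" "card T < CARD('r)" "X = span (w ` T)" by blast
      then have "dim X = card T" using dim_ind_fam[OF w(2)[OF T(1)]] by simp
      then show "negligible X" using T(2) by (intro negligible_lowdim) simp
    qed
    then have "\<not> U \<subseteq> (\<Union>T\<in>?T. span (w ` T))"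
      using open_not_negligible[OF U(1)] U(2) negligible_subset by blast
    then obtain u where u: "u \<in> U" "\<And>T. T \<subseteq> {1..n} \<Longrightarrow> card T < CARD('r) \<Longrightarrow> u \<notin> span (w ` T)"
      by blast
    have same: "ind_fam (?w u) T \<longleftrightarrow> ind_fam w T" "?w u ` T = w ` T" if "T \<subseteq> {1..n}" for T
      using that by (intro ind_fam_cong image_cong; force)+
    have "ind_fam (?w u) T" if T: "T \<subseteq> {1..Suc n}" "card T \<le> CARD('r)" for T
    proof (cases "Suc n \<in> T")
      case True
      let ?S = "T - {Suc n}"
      have finT: "finite T" using T(1) finite_subset by blast
      have S: "?S \<subseteq> {1..n}" using T(1) by auto
      have "card T = Suc (card ?S)" using True finT by (metis card_Suc_Diff1)
      then have cS: "card ?S < CARD('r)" using T(2) by simp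
      have "ind_fam (?w u) (insert (Suc n) ?S)"
      proof (rule ind_fam_insert[THEN iffD2])
        show "ind_fam (?w u) ?S \<and> ?w u (Suc n) \<notin> span (?w u ` ?S)"
          using same[OF S] w(2)[OF S] u(2)[OF S cS] cS by simp
      qed simp
      then show ?thesis using True by (simp add: insert_absorb)
    next
      case False
      then have "T \<subseteq> {1..n}" using T(1) by (auto simp: le_Suc_eq)
      then show ?thesis using same w(2) T(2) by simp
    qed
    then show ?case using U(3)[OF u(1)] by (intro exI[of _ "?w u"]) blast
  qed
  then obtain w :: "nat \<Rightarrow> real ^ 'r::{finite,linorder}" where
    "ind_fam (normal w) B" "\<forall>T\<subseteq>{1..n}. card T \<le> CARD('r) \<longrightarrow> ind_fam w T" by (elim exE conjE)
  then show ?thesis using that[of w] by simp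
qed

section \<open>Projective frames and the columns of the matrix\<close>

lemma row_number_bij: "bij_betw row_number (UNIV :: 'r::{finite,linorder} set) {1..CARD('r)}"
proof -
  let ?xs = "sorted_list_of_set (UNIV :: 'r set)"
  have im: "row_number ` (UNIV :: 'r set) = {1..CARD('r)}"
  proof -
    have "UNIV = (!) ?xs ` {..<CARD('r)}"
      using bij_betw_nth[of ?xs "{..<CARD('r)}" UNIV] by (simp add: bij_betw_def)
    then have "row_number ` (UNIV :: 'r set) = (\<lambda>i. row_number (?xs ! i)) ` {..<CARD('r)}"
      by (metis image_image)
    also have "\<dots> = Suc ` {..<CARD('r)}"
      by (intro image_cong) (auto simp: row_number_sorted_nth)
    also have "\<dots> = {1..CARD('r)}" by (simp add: image_Suc_lessThan)
    finally show ?thesis .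
  qed
  have "inj_on row_number (UNIV :: 'r set)"
    by (rule eq_card_imp_inj_on) (simp_all add: im)
  then show ?thesis using im by (simp add: bij_betw_def)
qed

text \<open>
  A projective frame can be moved to any other by a linear map and rescaling of the vectors,
  so prescribing the first \<open>k + 1\<close> columns is no restriction.
\<close>

lemma exists_matrix_columns:
  fixes v :: "nat \<Rightarrow> real ^ 'r::{finite,linorder}"
  assumes ind: "ind_fam (normal v) B"
    and B: "B \<subseteq> k_subsets (CARD('r) - 1) {1..m}"
  obtains x where "ind_fam (normal (matrix_column x :: nat \<Rightarrow> real ^ 'r::{finite,linorder})) B"
proof -
  let ?K = "CARD('r)"
  \<comment> \<open>The frame has \<open>k + 1\<close> vectors even when \<open>m = k\<close>, where
    \<open>k\<close> is the dimension.\<close>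
  let ?N = "max m (Suc ?K)"
  have finB: "finite B" using B finite_k_subsets finite_subset by blast
  have BS: "finite S \<and> card S = ?K - 1" if "S \<in> B" for S
    using B that finite_subset[of S "{1..m}"] by (auto simp: k_subsets_def)
  obtain w :: "nat \<Rightarrow> real ^ 'r::{finite,linorder}" where
    w: "ind_fam (normal w) B" "\<And>T. T \<subseteq> {1..?N} \<Longrightarrow> card T \<le> ?K \<Longrightarrow> ind_fam w T"
    using exists_general_position[OF ind finB BS, of ?N] by blast
  have bas: "ind_fam w {1..?K}" by (rule w(2)) auto
  have "span (w ` {1..?K}) = UNIV"
  proof (rule subspace_dim_equal)
    show "dim (UNIV :: (real ^ 'r::{finite,linorder}) set) \<le> dim (span (w ` {1..?K}))" using dim_ind_fam[OF bas] by simp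
  qed auto
  then have "w (Suc ?K) \<in> span (w ` {1..?K})" by simp
  from this[unfolded span_image_iff[OF finite_atLeastAtMost]]
  obtain a where a: "w (Suc ?K) = (\<Sum>j\<in>{1..?K}. a j *\<^sub>R w j)" by (rule exE)
  \<comment> \<open>Otherwise vector \<open>k + 1\<close> would lie in the span of
    \<open>k - 1\<close> of the first \<open>k\<close> vectors, against general position.\<close>
  have anz: "a j \<noteq> 0" if j: "j \<in> {1..?K}" for j
  proof
    assume a0: "a j = 0"
    let ?T = "{1..?K} - {j}"
    have "w (Suc ?K) = (\<Sum>i\<in>?T. a i *\<^sub>R w i)"
      unfolding a by (rule sum.mono_neutral_right) (use a0 in auto)
    then have "w (Suc ?K) \<in> span (w ` ?T)" using sum_in_span_image by metis
    moreover have "ind_fam w (insert (Suc ?K) ?T)" by (rule w(2)) (use j in auto)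
    ultimately show False using ind_fam_insert[of "Suc ?K" ?T w] by auto
  qed
  let ?n = "row_number :: 'r \<Rightarrow> nat"
  have nb: "?n r \<in> {1..?K}" for r using row_number_bij bij_betwE by blast
  have ninj: "?n r = ?n s \<longleftrightarrow> r = s" for r s
    using row_number_bij by (auto simp: bij_betw_def inj_on_def)
  have nsurj: "\<exists>r. ?n r = i" if "i \<in> {1..?K}" for i
    using row_number_bij that by (metis bij_betw_imp_surj_on imageE)
  have rb: "bij_betw (\<lambda>r. Suc ?K - ?n r) UNIV {1..?K}"
  proof (rule bij_betw_byWitness[where f' = "\<lambda>i. SOME r. ?n r = Suc ?K - i"])
    show "\<forall>r\<in>UNIV. (SOME s. ?n s = Suc ?K - (Suc ?K - ?n r)) = r"
    proof
      fix r
      have "Suc ?K - (Suc ?K - ?n r) = ?n r" using nb[of r] by simp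
      then show "(SOME s. ?n s = Suc ?K - (Suc ?K - ?n r)) = r" by (simp add: ninj)
    qed
    show "\<forall>i\<in>{1..?K}. Suc ?K - ?n (SOME r. ?n r = Suc ?K - i) = i"
    proof
      fix i assume i: "i \<in> {1..?K}"
      then have "?n (SOME r. ?n r = Suc ?K - i) = Suc ?K - i" by (intro someI_ex[OF nsurj]) auto
      then show "Suc ?K - ?n (SOME r. ?n r = Suc ?K - i) = i" using i by simp
    qed
    show "(\<lambda>r. Suc ?K - ?n r) ` UNIV \<subseteq> {1..?K}"
    proof (rule image_subsetI)
      fix r
      show "Suc ?K - ?n r \<in> {1..?K}" using nb[of r] by auto
    qed
  qed simp
  \<comment> \<open>The unit vector of row \<open>r\<close> goes to
    \<open>a i *\<^sub>R w i\<close>, where \<open>i\<close> is \<open>k + 1\<close> minus the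
    number of that row. Column \<open>i\<close> of the frame has its single entry in this row, so it
    goes to a multiple of \<open>w i\<close>, and the column of ones goes to vector
    \<open>k + 1\<close> by the choice of \<open>a\<close>.\<close>
  define h where "h y = (\<Sum>r\<in>UNIV. (a (Suc ?K - ?n r) * y $ r) *\<^sub>R w (Suc ?K - ?n r))" for y :: "real ^ 'r::{finite,linorder}"
  have hl: "linear h" unfolding h_def
    by (rule linearI) (simp_all add: algebra_simps sum.distrib scaleR_sum_right)
  have hinj: "inj h"
  proof (rule linear_injective_0[OF hl, THEN iffD2], intro allI impI)
    fix y assume y: "h y = 0"
    have ix: "Suc ?K - (Suc ?K - ?n r) = ?n r" for r using nb[of r] by simp
    define u where "u i = a i * y $ (SOME r. ?n r = Suc ?K - i)" for i
    have ur: "u (Suc ?K - ?n r) = a (Suc ?K - ?n r) * y $ r" for r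
      unfolding u_def ix by (simp add: ninj)
    have "(\<Sum>i\<in>{1..?K}. u i *\<^sub>R w i) = (\<Sum>r\<in>UNIV. u (Suc ?K - ?n r) *\<^sub>R w (Suc ?K - ?n r))"
      by (rule sum.reindex_bij_betw[OF rb, symmetric])
    also have "\<dots> = 0" using y by (simp add: h_def ur)
    finally have "u i = 0" if "i \<in> {1..?K}" for i using ind_famD[OF bas _ _ that] by blast
    moreover have mem: "Suc ?K - ?n r \<in> {1..?K}" for r using nb[of r] by auto
    ultimately have "u (Suc ?K - ?n r) = 0" for r by blast
    then have "y $ r = 0" for r using ur[of r] anz[OF mem[of r]] by simp
    then show "y = 0" by (simp add: Finite_Cartesian_Product.vec_eq_iff)
  qed
  have hsurj: "surj h" using linear_inj_imp_surj[OF hl hinj] .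
  define z where "z j = inv_into UNIV h (w j)" for j
  have hz: "h (z j) = w j" for j unfolding z_def by (rule f_inv_into_f) (simp add: hsurj)
  obtain r1 where r1: "?n r1 = 1" using nsurj[of 1] by auto
  \<comment> \<open>Row 1 corresponds to \<open>w\<close> at index \<open>k\<close>; with first
    coordinate 0, the vector \<open>w j\<close> would lie in the span of the first
    \<open>k - 1\<close> vectors.\<close>
  have znz: "z j $ r1 \<noteq> 0" if j: "Suc ?K < j" "j \<le> m" for j
  proof
    assume z0: "z j $ r1 = 0"
    let ?T = "{1..?K - 1}"
    have "h (z j) \<in> span (w ` ?T)" unfolding h_def
    proof (rule span_sum)
      fix r
      show "(a (Suc ?K - ?n r) * z j $ r) *\<^sub>R w (Suc ?K - ?n r) \<in> span (w ` ?T)"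
      proof (cases "r = r1")
        case False
        then have "?n r \<noteq> 1" using r1 ninj by metis
        then have "Suc ?K - ?n r \<in> ?T" using nb[of r] by auto
        then show ?thesis by (intro span_scale span_base imageI)
      qed (simp add: z0 span_zero)
    qed
    then have "w j \<in> span (w ` ?T)" using hz by simp
    moreover have "ind_fam w (insert j ?T)" by (rule w(2)) (use j in auto)
    moreover have "j \<notin> ?T" using j by auto
    ultimately show False using ind_fam_insert[of j ?T w] by blast
  qed
  \<comment> \<open>Beyond the frame, the preimages \<open>z j\<close> are rescaled to first
    coordinate 1; their other coordinates are the parameters.\<close>
  define x where "x i l = z (Suc ?K + l) $ (SOME r. ?n r = Suc i) / z (Suc ?K + l) $ r1" for i l
  define c where "c j = (if j \<le> ?K then (-1) ^ j * a j else if j = Suc ?K then 1 else 1 / z j $ r1)" for j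
  have key: "c j \<noteq> 0 \<and> h (matrix_column x j) = c j *\<^sub>R w j" if j: "j \<in> {1..m}" for j
  proof -
    consider "j \<le> ?K" | "j = Suc ?K" | "Suc ?K < j" by linarith
    then show ?thesis
    proof cases
      case 1
      have "Suc ?K - j \<in> {1..?K}" using 1 j unfolding atLeastAtMost_iff by linarith
      then obtain r0 where r0: "?n r0 = Suc ?K - j" using nsurj by blast
      have mc: "(matrix_column x j :: real ^ 'r::{finite,linorder}) $ r = (if r = r0 then (-1) ^ j else 0)" for r
        using 1 r0 ninj[of r r0] by (simp add: matrix_column_def)
      have "h (matrix_column x j) = (\<Sum>r\<in>{r0}. (a (Suc ?K - ?n r) * (-1) ^ j) *\<^sub>R w (Suc ?K - ?n r))"
        unfolding h_def mc by (rule sum.mono_neutral_cong_right) auto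
      also have "\<dots> = c j *\<^sub>R w j" using r0 1 j by (simp add: c_def mult.commute)
      finally show ?thesis using anz[of j] 1 j by (simp add: c_def)
    next
      case 2
      have mc: "(matrix_column x j :: real ^ 'r::{finite,linorder}) $ r = 1" for r
        using 2 by (simp add: matrix_column_def)
      have "h (matrix_column x j) = (\<Sum>r\<in>UNIV. a (Suc ?K - ?n r) *\<^sub>R w (Suc ?K - ?n r))"
        unfolding h_def mc by simp
      also have "\<dots> = (\<Sum>i\<in>{1..?K}. a i *\<^sub>R w i)" by (rule sum.reindex_bij_betw[OF rb])
      finally show ?thesis using a 2 by (simp add: c_def)
    next
      case 3
      have nz: "z j $ r1 \<noteq> 0" using znz 3 j by simp
      have mc: "(matrix_column x j :: real ^ 'r::{finite,linorder}) $ r = z j $ r / z j $ r1" for r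
      proof (cases "r = r1")
        case True
        then show ?thesis using 3 r1 nz by (simp add: matrix_column_def)
      next
        case False
        then have n1: "?n r \<noteq> 1" using r1 ninj by metis
        then have "Suc (?n r - 1) = ?n r" using nb[of r] by auto
        then have "(SOME s. ?n s = Suc (?n r - 1)) = r" by (simp add: ninj)
        moreover have "Suc ?K + (j - (?K + 1)) = j" using 3 by simp
        ultimately show ?thesis using 3 n1 by (simp add: matrix_column_def x_def)
      qed
      have "matrix_column x j = (1 / z j $ r1) *\<^sub>R z j"
        by (simp add: Finite_Cartesian_Product.vec_eq_iff mc)
      then have "h (matrix_column x j) = (1 / z j $ r1) *\<^sub>R w j"
        using linear_scale[OF hl] hz by simp
      then show ?thesis using 3 nz by (simp add: c_def)
    qed
  qed
  have "ind_fam (normal w) B \<longleftrightarrow> ind_fam (normal (matrix_column x :: nat \<Rightarrow> real ^ 'r::{finite,linorder})) B"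
  proof (rule ind_fam_normal_linear_image[OF hl hinj _ finB BS])
    fix j assume "j \<in> \<Union>B"
    then have "j \<in> {1..m}" using B unfolding k_subsets_def by blast
    then show "1 / c j \<noteq> 0 \<and> w j = (1 / c j) *\<^sub>R h (matrix_column x j)" using key[of j] by auto
  qed
  then show ?thesis using that w(1) by blast
qed

lemma generic_matrix_column:
  fixes x :: "nat \<Rightarrow> nat \<Rightarrow> real"
  assumes vg: "very_generic (matrix_column :: _ \<Rightarrow> _ \<Rightarrow> real ^ 'r::{finite,linorder}) m x"
    and m: "CARD('r) \<le> m" and d: "CARD('r) = Suc d" "1 \<le> d"
  shows "generic (matrix_column x :: nat \<Rightarrow> real ^ 'r::{finite,linorder}) {1..m} d"
proof
  show "generic_config (matrix_column x :: nat \<Rightarrow> real ^ 'r::{finite,linorder}) {1..m}"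
  proof (rule generic_configI)
    fix B and v' :: "nat \<Rightarrow> real ^ 'r::{finite,linorder}"
    assume B: "B \<subseteq> k_subsets (CARD('r) - 1) {1..m}" "ind_fam (normal v') B"
    obtain x' where "ind_fam (normal (matrix_column x' :: nat \<Rightarrow> real ^ 'r::{finite,linorder})) B"
      using exists_matrix_columns[OF B(2,1)] .
    then show "ind_fam (normal (matrix_column x :: nat \<Rightarrow> real ^ 'r::{finite,linorder})) B"
      by (rule very_generic_ind_fam[OF vg B(1)])
  qed (use m d in auto)
qed (use m d in auto)

subsection \<open>Restriction to the affine hyperplane where the first coordinate is one\<close>

abbreviation infinity_hyperplane :: "(real ^ ('n::{finite,linorder}) option) set" where
  "infinity_hyperplane \<equiv> {x. x $ None = 0}"

definition zero_extend :: "real ^ 'n \<Rightarrow> real ^ 'n option" where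
  "zero_extend y = (\<chi> r. case r of None \<Rightarrow> 0 | Some i \<Rightarrow> y $ i)"

lemma zero_extend_nth [simp]: "zero_extend y $ None = 0" "zero_extend y $ Some i = y $ i"
  by (simp_all add: zero_extend_def)

lemma vec_option_eq_iff:
  fixes x y :: "'a ^ ('n::finite) option"
  shows "x = y \<longleftrightarrow> x $ None = y $ None \<and> (\<forall>i. x $ Some i = y $ Some i)"
  unfolding Finite_Cartesian_Product.vec_eq_iff by (metis option.exhaust)

lemma zero_extend_linear: "linear zero_extend"
  by (rule linearI) (simp_all add: vec_option_eq_iff)

lemma zero_extend_inj: "inj zero_extend"
  by (rule injI) (simp add: vec_option_eq_iff Finite_Cartesian_Product.vec_eq_iff)

lemma homogenize_add: "homogenize (x + y) = homogenize x + zero_extend y"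
  by (simp add: vec_option_eq_iff)

lemma scale_homogenize:
  assumes "x $ None \<noteq> 0"
  shows "x = x $ None *\<^sub>R homogenize (\<chi> i. x $ Some i / x $ None)"
  using assms by (simp add: vec_option_eq_iff)

lemma homogenize_vimage_nonempty_iff:
  fixes F :: "(real ^ ('n::{finite,linorder}) option) set"
  assumes F: "subspace F"
  shows "homogenize -` F \<noteq> {} \<longleftrightarrow> \<not> F \<subseteq> infinity_hyperplane"
proof
  assume "homogenize -` F \<noteq> {}"
  then obtain y where "homogenize y \<in> F" by blast
  moreover have "homogenize y $ None \<noteq> 0" by simp
  ultimately show "\<not> F \<subseteq> infinity_hyperplane" by blast
next
  assume "\<not> F \<subseteq> infinity_hyperplane"
  then obtain x where x: "x \<in> F" "x $ None \<noteq> 0" by blast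
  have "(1 / x $ None) *\<^sub>R x = homogenize (\<chi> i. x $ Some i / x $ None)"
    using x(2) by (simp add: vec_option_eq_iff)
  moreover have "(1 / x $ None) *\<^sub>R x \<in> F" by (rule subspace_scale[OF F x(1)])
  ultimately show "homogenize -` F \<noteq> {}" by auto
qed

text \<open>A subspace that is not at infinity is generated by its vectors off infinity: a vector
  \<open>x\<close> at infinity is \<open>(x + y) - y\<close> for any \<open>y\<close> off infinity.
  The trace thus determines the subspace.\<close>

lemma homogenize_vimage_subset_iff:
  fixes F G :: "(real ^ ('n::{finite,linorder}) option) set"
  assumes F: "subspace F" "\<not> F \<subseteq> infinity_hyperplane" and G: "subspace G"
  shows "homogenize -` F \<subseteq> homogenize -` G \<longleftrightarrow> F \<subseteq> G"
proof
  assume sub: "homogenize -` F \<subseteq> homogenize -` G"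
  have nz: "x \<in> G" if x: "x \<in> F" "x $ None \<noteq> 0" for x
  proof -
    let ?y = "\<chi> i. x $ Some i / x $ None"
    have "homogenize ?y = (1 / x $ None) *\<^sub>R x" using x(2) by (simp add: vec_option_eq_iff)
    then have "homogenize ?y \<in> F" using subspace_scale[OF F(1) x(1)] by metis
    then have "homogenize ?y \<in> G" using sub by blast
    then have "x $ None *\<^sub>R homogenize ?y \<in> G" by (rule subspace_scale[OF G])
    then show ?thesis using scale_homogenize[OF x(2)] by simp
  qed
  obtain y where y: "y \<in> F" "y $ None \<noteq> 0" using F(2) by blast
  show "F \<subseteq> G"
  proof
    fix x assume x: "x \<in> F"
    show "x \<in> G"
    proof (cases "x $ None = 0")
      case True
      have "x + y \<in> G" by (rule nz) (use True x y subspace_add[OF F(1)] in auto)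
      moreover have "y \<in> G" by (rule nz) (use y in auto)
      ultimately have "(x + y) - y \<in> G" by (rule subspace_diff[OF G])
      then show ?thesis by simp
    qed (rule nz[OF x])
  qed
qed blast

lemma dim_Int_hyperplane:
  fixes F :: "'a::euclidean_space set"
  assumes F: "subspace F" "\<not> F \<subseteq> {x. a \<bullet> x = 0}"
  shows "dim F = Suc (dim (F \<inter> {x. a \<bullet> x = 0}))"
proof -
  let ?H = "{x. a \<bullet> x = 0}"
  have a0: "a \<noteq> 0" using F(2) by auto
  have "dim {x + y |x y. x \<in> F \<and> y \<in> ?H} + dim (F \<inter> ?H) = dim F + dim ?H"
    by (rule dim_sums_Int) (use F subspace_hyperplane in auto)
  moreover have "dim {x + y |x y. x \<in> F \<and> y \<in> ?H} \<le> DIM('a)" by (rule dim_subset_UNIV)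
  moreover have "dim ?H = DIM('a) - 1" by (rule dim_hyperplane[OF a0])
  moreover have "DIM('a) \<ge> 1" by (simp add: Suc_leI)
  ultimately have "dim F \<le> Suc (dim (F \<inter> ?H))" by linarith
  moreover have "dim (F \<inter> ?H) < dim F"
  proof (rule ccontr)
    assume "\<not> ?thesis"
    then have "F \<inter> ?H = F"
      by (intro subspace_dim_equal) (auto intro: subspace_inter F(1) subspace_hyperplane)
    then show False using F(2) by blast
  qed
  ultimately show ?thesis by simp
qed

lemma infinity_hyperplane_eq: "infinity_hyperplane = {x. axis None 1 \<bullet> x = (0::real)}"
  by (simp add: inner_axis')

lemma subspace_infinity_hyperplane: "subspace infinity_hyperplane"
  unfolding infinity_hyperplane_eq by (rule subspace_hyperplane)

lemma aff_dim_homogenize_vimage: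
  fixes F :: "(real ^ ('n::{finite,linorder}) option) set"
  assumes F: "subspace F" "\<not> F \<subseteq> infinity_hyperplane"
  shows "aff_dim (homogenize -` F) + 1 = int (dim F)"
proof -
  obtain y0 where y0: "homogenize y0 \<in> F" using homogenize_vimage_nonempty_iff[OF F(1)] F(2) by blast
  let ?D = "zero_extend -` F"
  have D: "subspace ?D" by (rule linear_subspace_vimage[OF zero_extend_linear F(1)])
  have "homogenize -` F = (+) y0 ` ?D"
  proof (intro equalityI subsetI)
    fix y assume "y \<in> homogenize -` F"
    then have "homogenize y - homogenize y0 \<in> F" using subspace_diff[OF F(1)] y0 by simp
    moreover have "homogenize y - homogenize y0 = zero_extend (y - y0)" by (simp add: vec_option_eq_iff)
    ultimately have "y - y0 \<in> ?D" by simp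
    then show "y \<in> (+) y0 ` ?D" by (metis add.commute diff_add_cancel image_eqI)
  next
    fix y assume "y \<in> (+) y0 ` ?D"
    then obtain u where "y = y0 + u" "zero_extend u \<in> F" by blast
    then show "y \<in> homogenize -` F" using subspace_add[OF F(1) y0] by (simp add: homogenize_add)
  qed
  then have "aff_dim (homogenize -` F) = int (dim ?D)"
    by (simp add: aff_dim_translation_eq aff_dim_subspace[OF D])
  also have "dim ?D = dim (zero_extend ` ?D)"
    by (rule dim_image_eq[symmetric]) (use zero_extend_linear zero_extend_inj in \<open>auto intro: inj_on_subset\<close>)
  also have "zero_extend ` ?D = F \<inter> infinity_hyperplane"
  proof (intro equalityI subsetI)
    fix x assume x: "x \<in> F \<inter> infinity_hyperplane"
    then have "x = zero_extend (\<chi> i. x $ Some i)" by (simp add: vec_option_eq_iff)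
    then show "x \<in> zero_extend ` ?D" using x by (metis IntD1 image_eqI vimageI)
  qed auto
  finally have "aff_dim (homogenize -` F) = int (dim (F \<inter> infinity_hyperplane))" .
  moreover have "dim F = Suc (dim (F \<inter> infinity_hyperplane))"
    unfolding infinity_hyperplane_eq by (rule dim_Int_hyperplane[OF F(1)]) (use F(2) infinity_hyperplane_eq in auto)
  ultimately show ?thesis by simp
qed

lemma affine_homogenize_vimage:
  assumes "subspace F"
  shows "affine (homogenize -` F)"
proof -
  have "homogenize ((1 - t) *\<^sub>R x + t *\<^sub>R y) = (1 - t) *\<^sub>R homogenize x + t *\<^sub>R homogenize y"
    for x y :: "real ^ 'a" and t
    by (simp add: vec_option_eq_iff)
  then show ?thesis unfolding affine_alt using assms by (auto intro: subspace_add subspace_scale)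
qed

text \<open>The common form of both families. A hyperplane at infinity leaves an empty trace and is
  dropped.\<close>

definition dehomogenized :: "nat \<Rightarrow> nat set \<Rightarrow> (nat \<Rightarrow> real ^ ('n::{finite,linorder}) option) \<Rightarrow> (real ^ 'n::{finite,linorder}) set set" where
  "dehomogenized d J v = (\<lambda>S. homogenize -` span (v ` S)) ` k_subsets d J - {{}}"

locale generic_affine =
  generic v J "CARD('n)" for v :: "nat \<Rightarrow> real ^ ('n::{finite,linorder}) option" and J
begin

abbreviation "L \<equiv> flats_over CARD('n) v J"
abbreviation "U \<equiv> {F \<in> L. \<not> F \<subseteq> infinity_hyperplane}"
abbreviation "\<A> \<equiv> dehomogenized CARD('n) J v"

text \<open>For \<open>i \<le> CARD('n)\<close> this is the coefficient of the power
  \<open>CARD('n) - i\<close> in the characteristic polynomial of the affine arrangement, computed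
  in the central poset; a flat has dimension one more than its trace, whence
  \<open>Suc\<close>.\<close>

definition affine_sum :: "nat \<Rightarrow> int" where
  "affine_sum i = (\<Sum>F | F \<in> U \<and> dim F + i = Suc CARD('n). moebius L UNIV F)"

lemma finite_L: "finite L" using finite_flats_over J by blast

lemma intersection_poset_dehomogenized:
  "intersection_poset \<A> = (\<lambda>F. homogenize -` F) ` U"
proof (intro equalityI subsetI)
  fix X assume "X \<in> intersection_poset \<A>"
  then obtain \<B> where \<B>: "\<B> \<subseteq> \<A>" "X = \<Inter>\<B>" "X \<noteq> {}" by (auto simp: intersection_poset_def)
  then have "\<B> \<subseteq> (\<lambda>S. homogenize -` span (v ` S)) ` k_subsets CARD('n) J"
    by (auto simp: dehomogenized_def)
  then obtain B where B: "B \<subseteq> k_subsets CARD('n) J" "\<B> = (\<lambda>S. homogenize -` span (v ` S)) ` B"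
    by (meson subset_imageE)
  have X: "X = homogenize -` flat v B" unfolding \<B>(2) B(2) flat_def by auto
  then have "\<not> flat v B \<subseteq> infinity_hyperplane"
    using \<B>(3) homogenize_vimage_nonempty_iff[OF subspace_flat] by blast
  moreover have "flat v B \<in> L" using B(1) by (auto simp: flats_over_J)
  ultimately show "X \<in> (\<lambda>F. homogenize -` F) ` U" using X by blast
next
  fix X assume "X \<in> (\<lambda>F. homogenize -` F) ` U"
  then obtain B where B: "B \<subseteq> k_subsets CARD('n) J" "\<not> flat v B \<subseteq> infinity_hyperplane" "X = homogenize -` flat v B"
    by (auto simp: flats_over_J)
  have X: "X \<noteq> {}" using B(2,3) homogenize_vimage_nonempty_iff[OF subspace_flat] by blast
  let ?\<B> = "(\<lambda>S. homogenize -` span (v ` S)) ` B"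
  have X': "X = \<Inter>?\<B>" unfolding B(3) flat_def by auto
  then have "?\<B> \<subseteq> \<A>" using B(1) X unfolding dehomogenized_def by blast
  then show "X \<in> intersection_poset \<A>" using X X' unfolding intersection_poset_def by blast
qed

lemma subspace_L: "F \<in> L \<Longrightarrow> subspace F" by (rule subspace_flats_over)

lemma UNIV_in_U: "UNIV \<in> U"
proof -
  have "axis None 1 \<notin> (infinity_hyperplane :: (real ^ ('n::{finite,linorder}) option) set)"
    by (simp add: axis_def)
  then show ?thesis using UNIV_in_flats_over[of "CARD('n)" v J] by blast
qed

lemma vimage_bij: "bij_betw (\<lambda>F. homogenize -` F) U (intersection_poset \<A>)"
proof -
  have "inj_on (\<lambda>F. homogenize -` F) U"
  proof (rule inj_onI)
    fix F G assume *: "F \<in> U" "G \<in> U" "homogenize -` F = homogenize -` G"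
    have "F \<subseteq> G" using homogenize_vimage_subset_iff[OF subspace_L[of F] _ subspace_L[of G]] * by simp
    moreover have "G \<subseteq> F" using homogenize_vimage_subset_iff[OF subspace_L[of G] _ subspace_L[of F]] * by simp
    ultimately show "F = G" by blast
  qed
  then show ?thesis using intersection_poset_dehomogenized by (simp add: bij_betw_def)
qed

lemma finite_dehomogenized: "finite \<A>"
  unfolding dehomogenized_def using finite_k_subsets[OF J(1)] by blast

lemma moebius_dehomogenized:
  assumes "F \<in> U"
  shows "moebius (intersection_poset \<A>) UNIV (homogenize -` F) = moebius L UNIV F"
proof (rule moebius_iso[OF finite_L intersection_poset_finite[OF finite_dehomogenized]
      UNIV_in_flats_over UNIV_in_intersection_poset _ vimage_bij])
  fix F G assume "F \<in> U" "G \<in> L" "F \<subseteq> G"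
  then show "G \<in> U" by blast
next
  fix F G assume "F \<in> U" "G \<in> U"
  then show "homogenize -` F \<subseteq> homogenize -` G \<longleftrightarrow> F \<subseteq> G"
    using homogenize_vimage_subset_iff[OF subspace_L[of F] _ subspace_L[of G]] by simp
qed (use assms in auto)

lemma dim_U: "F \<in> U \<Longrightarrow> nat (aff_dim (homogenize -` F)) + 1 = dim F"
proof -
  assume F: "F \<in> U"
  have "aff_dim (homogenize -` F) + 1 = int (dim F)"
    using aff_dim_homogenize_vimage[OF subspace_L[of F]] F by simp
  moreover have "dim F \<noteq> 0"
  proof
    assume "dim F = 0"
    then have "F \<subseteq> {0}" by simp
    then show False using F by auto
  qed
  ultimately show ?thesis by linarith
qed

lemma betti_dehomogenized:
  assumes "i \<le> CARD('n)"
  shows "betti \<A> i = (-1) ^ i * affine_sum i"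
proof -
  let ?P = "intersection_poset \<A>"
  have "Polynomial.coeff (characteristic_polynomial \<A>) (CARD('n) - i) =
      (\<Sum>X\<in>?P. if nat (aff_dim X) = CARD('n) - i then moebius ?P UNIV X else 0)"
    unfolding characteristic_polynomial_def by (simp add: Polynomial.coeff_sum Polynomial.coeff_monom)
  also have "\<dots> = (\<Sum>F\<in>U. if nat (aff_dim (homogenize -` F)) = CARD('n) - i
      then moebius ?P UNIV (homogenize -` F) else 0)"
    by (rule sum.reindex_bij_betw[OF vimage_bij, symmetric])
  also have "\<dots> = (\<Sum>F\<in>U. if dim F + i = Suc CARD('n) then moebius L UNIV F else 0)"
  proof (rule sum.cong[OF refl])
    fix F assume F: "F \<in> U"
    have "nat (aff_dim (homogenize -` F)) = CARD('n) - i \<longleftrightarrow> dim F + i = Suc CARD('n)"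
      using dim_U[OF F] assms by linarith
    then show "(if nat (aff_dim (homogenize -` F)) = CARD('n) - i then moebius ?P UNIV (homogenize -` F) else 0) =
        (if dim F + i = Suc CARD('n) then moebius L UNIV F else 0)"
      using moebius_dehomogenized[OF F] by simp
  qed
  also have "\<dots> = affine_sum i"
    unfolding affine_sum_def by (rule sum.inter_filter[symmetric]) (use finite_L in simp)
  finally show ?thesis by (simp add: betti_def)
qed

text \<open>The hyperplanes of the central arrangement meet only in 0, so no nonzero direction is
  common to all of them. This is the essentiality needed for counting bounded regions.\<close>

lemma zero_extend_not_in_all:
  assumes "h \<noteq> 0"
  obtains S where "S \<in> k_subsets CARD('n) J" "zero_extend h \<notin> span (v ` S)"
proof -
  have "{} \<in> small_subsets CARD('n) J" by (simp add: small_subsets_def)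
  from span_eq_flat[OF this] have "flat v (k_subsets CARD('n) J) = {0}" by simp
  moreover have "zero_extend h \<noteq> 0" using assms
    by (simp add: vec_option_eq_iff Finite_Cartesian_Product.vec_eq_iff)
  ultimately have "zero_extend h \<notin> flat v (k_subsets CARD('n) J)" by simp
  then show ?thesis using that by (auto simp: flat_def)
qed

lemma bounded_regions_dehomogenized:
  "int (card (bounded_regions \<A>)) = (-1) ^ CARD('n) * (\<Sum>i\<le>CARD('n). affine_sum i)"
proof -
  let ?P = "intersection_poset \<A>"
  have "(\<Sum>X\<in>?P. moebius ?P UNIV X) = (-1) ^ DIM(real ^ 'n::{finite,linorder}) * int (card (bounded_regions \<A>))"
  proof (rule bounded_regions_count[OF finite_dehomogenized])
    fix H assume "H \<in> \<A>"
    then obtain S where S: "S \<in> k_subsets CARD('n) J" "H = homogenize -` span (v ` S)" "H \<noteq> {}"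
      by (auto simp: dehomogenized_def)
    have sp: "spanned_hyperplanes v {S}" using spanned[of "{S}"] S(1) by simp
    then have S': "finite S" "card S = CARD('n option) - 1" "ind_fam v S" by (auto simp: spanned_hyperplanes_def)
    let ?c = "normal v S"
    let ?a = "\<chi> i. ?c $ Some i"
    have ip: "?c \<bullet> homogenize y = ?c $ None + ?a \<bullet> y" for y
      unfolding inner_vec_def UNIV_option_conv
      by (subst sum.insert) (auto simp: sum.reindex)
    have H: "H = {y. ?a \<bullet> y = - ?c $ None}"
      unfolding S(2) span_eq_normal[OF S'] by (auto simp: ip eq_neg_iff_add_eq_0 add.commute)
    have "?a \<noteq> 0"
    proof
      assume a0: "?a = 0"
      then have "?c $ None = 0" using S(3) unfolding H by auto
      moreover have "?c $ Some i = 0" for i using a0 by (metis vec_lambda_beta zero_index)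
      ultimately have "?c = 0" by (simp add: vec_option_eq_iff)
      then show False using normal_nonzero_iff[OF S'(1,2)] S'(3) by blast
    qed
    then show "\<exists>a \<beta>. a \<noteq> 0 \<and> H = {x. a \<bullet> x = \<beta>}" using H by blast
  next
    fix h :: "real ^ 'n::{finite,linorder}" assume "h \<noteq> 0"
    then obtain S where S: "S \<in> k_subsets CARD('n) J" "zero_extend h \<notin> span (v ` S)"
      by (rule zero_extend_not_in_all)
    let ?H = "homogenize -` span (v ` S)"
    \<comment> \<open>A hyperplane of the right dimension inside infinity would be all of it and
      contain the direction \<open>zero_extend h\<close>; hence the one chosen has a nonempty
      trace.\<close>
    have not: "\<not> span (v ` S) \<subseteq> infinity_hyperplane"
    proof
      assume "span (v ` S) \<subseteq> infinity_hyperplane"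
      moreover have "dim (infinity_hyperplane :: (real ^ ('n::{finite,linorder}) option) set) = CARD('n)"
        unfolding infinity_hyperplane_eq by (subst dim_hyperplane) (auto simp: axis_eq_0_iff)
      ultimately have "span (v ` S) = infinity_hyperplane"
        using dim_span_hyperplane[OF S(1)]
        by (intro subspace_dim_equal subspace_span subspace_infinity_hyperplane) simp_all
      then show False using S(2) by simp
    qed
    then obtain x where x: "x \<in> ?H" using homogenize_vimage_nonempty_iff[of "span (v ` S)"] by auto
    then have "?H \<in> \<A>" using S(1) by (auto simp: dehomogenized_def)
    moreover have "x + h \<notin> ?H"
    proof
      assume "x + h \<in> ?H"
      then have "homogenize (x + h) - homogenize x \<in> span (v ` S)" using x by (auto intro: span_diff)
      then show False using S(2) by (simp add: homogenize_add)
    qed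
    ultimately show "\<exists>H\<in>\<A>. \<exists>x\<in>H. x + h \<notin> H" using x by blast
  qed
  moreover have "(\<Sum>X\<in>?P. moebius ?P UNIV X) = (\<Sum>F\<in>U. moebius L UNIV F)"
    using sum.reindex_bij_betw[OF vimage_bij, of "moebius ?P UNIV", symmetric] moebius_dehomogenized by simp
  moreover have "(\<Sum>F\<in>U. moebius L UNIV F) = (\<Sum>i\<le>CARD('n). affine_sum i)"
  proof -
    have dimF: "1 \<le> dim F" "dim F \<le> Suc CARD('n)" if "F \<in> U" for F
      using dim_U[OF that] dim_subset_UNIV[of F] by simp_all
    have "(\<Sum>F\<in>U. moebius L UNIV F) = (\<Sum>i\<le>CARD('n). \<Sum>F\<in>{F \<in> U. Suc CARD('n) - dim F = i}. moebius L UNIV F)"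
    proof (rule sum.group[symmetric])
      show "(\<lambda>F. Suc CARD('n) - dim F) ` U \<subseteq> {..CARD('n)}"
      proof (rule image_subsetI)
        fix F assume "F \<in> U"
        then show "Suc CARD('n) - dim F \<in> {..CARD('n)}" using dimF(1)[of F] by simp
      qed
    qed (use finite_L in simp_all)
    also have "\<dots> = (\<Sum>i\<le>CARD('n). affine_sum i)" unfolding affine_sum_def
    proof (intro sum.cong refl)
      fix i
      have "Suc CARD('n) - dim F = i \<longleftrightarrow> dim F + i = Suc CARD('n)" if "F \<in> U" for F
        using dimF[OF that] by linarith
      then show "{F \<in> U. Suc CARD('n) - dim F = i} = {F. F \<in> U \<and> dim F + i = Suc CARD('n)}" by blast
    qed
    finally show ?thesis .
  qed
  ultimately have "(\<Sum>i\<le>CARD('n). affine_sum i) = (-1) ^ CARD('n) * int (card (bounded_regions \<A>))" by simp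
  then have "(-1) ^ CARD('n) * (\<Sum>i\<le>CARD('n). affine_sum i) =
      ((-1) ^ CARD('n) * (-1) ^ CARD('n)) * int (card (bounded_regions \<A>))" by simp
  then show ?thesis by (simp add: power_mult_distrib[symmetric])
qed

text \<open>With \<open>i \<le> CARD('n)\<close> the flats of codimension \<open>i\<close> have
  positive dimension, so none is lost at infinity and the affine sum is the central one.\<close>

lemma affine_sum_transversal:
  assumes tr: "\<And>F. F \<in> L \<Longrightarrow> 1 \<le> dim F \<Longrightarrow> \<not> F \<subseteq> infinity_hyperplane" and i: "i \<le> CARD('n)"
  shows "of_int (affine_sum i) =
    poly (flat_poly CARD('n) TYPE(nat \<Rightarrow> real ^ ('n::{finite,linorder}) option) i) (of_nat (card J))"
proof -
  have "{F. F \<in> U \<and> dim F + i = Suc CARD('n)} = {F. F \<in> L \<and> dim F + i = CARD('n option)}"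
    using tr i by auto
  then show ?thesis using sum_moebius_eq_poly[of i] by (simp add: affine_sum_def)
qed

text \<open>
  If the hyperplane at infinity belongs to the central arrangement, then the characteristic
  polynomial of the latter is \<open>t - 1\<close> times that of the affine arrangement.
\<close>

lemma affine_sum_cone:
  assumes inf: "S \<in> k_subsets CARD('n) J" "span (v ` S) = infinity_hyperplane"
  shows "of_int (affine_sum i) =
    poly (\<Sum>j\<le>i. flat_poly CARD('n) TYPE(nat \<Rightarrow> real ^ ('n::{finite,linorder}) option) j) (of_nat (card J))"
proof (induction i)
  have split: "(\<Sum>F | F \<in> L \<and> dim F + i = CARD('n option). moebius L UNIV F) =
      affine_sum i + (\<Sum>F | F \<in> L \<and> dim F + i = Suc CARD('n) \<and> F \<subseteq> infinity_hyperplane. moebius L UNIV F)" for i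
  proof -
    have "{F. F \<in> L \<and> dim F + i = CARD('n option)} =
        {F. F \<in> U \<and> dim F + i = Suc CARD('n)} \<union>
        {F. F \<in> L \<and> dim F + i = Suc CARD('n) \<and> F \<subseteq> infinity_hyperplane}" by auto
    then show ?thesis unfolding affine_sum_def using finite_L
      by (simp only:) (rule sum.union_disjoint, auto)
  qed
  {
    case 0
    have "F \<notin> L \<or> dim F + 0 \<noteq> Suc CARD('n) \<or> \<not> F \<subseteq> infinity_hyperplane" for F
    proof (rule ccontr)
      assume "\<not> ?thesis"
      then have F: "dim F = CARD('n option)" "F \<subseteq> infinity_hyperplane" by auto
      then have "dim F \<le> dim (infinity_hyperplane :: (real ^ ('n::{finite,linorder}) option) set)" by (intro dim_subset)
      also have "\<dots> = CARD('n)" using inf dim_span_hyperplane by metis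
      finally show False using F(1) by simp
    qed
    then have "{F. F \<in> L \<and> dim F + 0 = Suc CARD('n) \<and> F \<subseteq> infinity_hyperplane} = {}" by blast
    then have "affine_sum 0 = (\<Sum>F | F \<in> L \<and> dim F + 0 = CARD('n option). moebius L UNIV F)"
      using split[of 0] by (simp only: sum.empty add_0_right)
    then show ?case using sum_moebius_eq_poly[of 0] by simp
  next
    case (Suc i)
    have infL: "infinity_hyperplane \<in> L"
      using inf unfolding flats_over_J by (intro image_eqI[of _ _ "{S}"]) (auto simp: flat_insert)
    have infne: "infinity_hyperplane \<noteq> (UNIV :: (real ^ ('n::{finite,linorder}) option) set)"
      using UNIV_in_U by auto
    have meet: "X \<inter> infinity_hyperplane \<in> L" if X: "X \<in> L" for X
    proof -
      obtain B where "B \<subseteq> k_subsets CARD('n) J" "X = flat v B" using X by (auto simp: flats_over_J)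
      then have "X \<inter> infinity_hyperplane = flat v (insert S B)" "insert S B \<subseteq> k_subsets CARD('n) J"
        using inf by (auto simp: flat_insert)
      then show ?thesis by (auto simp: flats_over_J)
    qed
    \<comment> \<open>Weisner's theorem for the hyperplane at infinity exchanges the flats of
      codimension \<open>Suc i\<close> inside it for those of codimension \<open>i\<close> not
      inside it, with opposite sign. By \<open>split\<close>, \<open>affine_sum (Suc i)\<close> is
      then the next central sum plus \<open>affine_sum i\<close>.\<close>
    have "(\<Sum>F | F \<in> L \<and> dim F + Suc i = Suc CARD('n) \<and> F \<subseteq> infinity_hyperplane. moebius L UNIV F) = - affine_sum i"
    proof (cases "i \<le> CARD('n)")
      case True
      have "(\<Sum>F | F \<in> L \<and> dim F = CARD('n) - i \<and> F \<subseteq> infinity_hyperplane. moebius L UNIV F) =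
        - (\<Sum>X | X \<in> L \<and> dim X = Suc (CARD('n) - i) \<and> \<not> X \<subseteq> infinity_hyperplane. moebius L UNIV X)"
      proof (rule moebius_sum_below_coatom[OF finite_L UNIV_in_flats_over infne meet])
        fix X assume "X \<in> L" "\<not> X \<subseteq> infinity_hyperplane"
        then show "dim X = Suc (dim (X \<inter> infinity_hyperplane))"
          unfolding infinity_hyperplane_eq by (intro dim_Int_hyperplane subspace_L)
      qed
      moreover have "{F. F \<in> L \<and> dim F + Suc i = Suc CARD('n) \<and> F \<subseteq> infinity_hyperplane} =
          {F. F \<in> L \<and> dim F = CARD('n) - i \<and> F \<subseteq> infinity_hyperplane}" using True by auto
      moreover have "{F. F \<in> U \<and> dim F + i = Suc CARD('n)} =
          {X. X \<in> L \<and> dim X = Suc (CARD('n) - i) \<and> \<not> X \<subseteq> infinity_hyperplane}" using True by auto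
      ultimately show ?thesis unfolding affine_sum_def by simp
    next
      \<comment> \<open>Both sums are empty: the first would need a negative dimension, the second a
        flat of dimension 0 or less off infinity.\<close>
      case False
      have "{F. F \<in> L \<and> dim F + Suc i = Suc CARD('n) \<and> F \<subseteq> infinity_hyperplane} = {}" using False by auto
      moreover have "{F. F \<in> U \<and> dim F + i = Suc CARD('n)} = {}"
      proof -
        have "dim F + i \<noteq> Suc CARD('n)" if "F \<in> U" for F using dim_U[OF that] False by linarith
        then show ?thesis by blast
      qed
      ultimately show ?thesis unfolding affine_sum_def by (simp only: sum.empty)
    qed
    then have "affine_sum (Suc i) = (\<Sum>F | F \<in> L \<and> dim F + Suc i = CARD('n option). moebius L UNIV F) + affine_sum i"
      using split[of "Suc i"] by linarith
    then show ?case using sum_moebius_eq_poly[of "Suc i"] Suc.IH by simp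
  }
qed

end

subsection \<open>The two families\<close>

text \<open>The coordinate \<open>None\<close> of a linear combination of homogenized points is the
  sum of its coefficients, so lying in the slice means that they sum to 1.\<close>

lemma affine_hull_eq_homogenize:
  fixes P :: "nat \<Rightarrow> real ^ 'n"
  assumes "finite S" "S \<noteq> {}"
  shows "affine hull (P ` S) = homogenize -` span (homogeneous_points P ` S)"
proof
  show "affine hull (P ` S) \<subseteq> homogenize -` span (homogeneous_points P ` S)"
    by (rule hull_minimal) (auto intro!: affine_homogenize_vimage span_base simp: homogeneous_points_def)
  show "homogenize -` span (homogeneous_points P ` S) \<subseteq> affine hull (P ` S)"
  proof
    fix y assume "y \<in> homogenize -` span (homogeneous_points P ` S)"
    then have "homogenize y \<in> span (homogeneous_points P ` S)" by simp
    from this[unfolded span_image_iff[OF assms(1)]]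
    obtain u where u: "homogenize y = (\<Sum>j\<in>S. u j *\<^sub>R homogeneous_points P j)" by (rule exE)
    have "1 = (\<Sum>j\<in>S. u j)" using arg_cong[OF u, of "\<lambda>x. x $ None"] by (simp add: homogeneous_points_def)
    have y: "y = (\<Sum>j\<in>S. u j *\<^sub>R P j)"
    proof -
      have "y $ i = (\<Sum>j\<in>S. u j *\<^sub>R P j) $ i" for i
        using arg_cong[OF u, of "\<lambda>x. x $ Some i"] by (simp add: homogeneous_points_def)
      then show ?thesis unfolding Finite_Cartesian_Product.vec_eq_iff by blast
    qed
    obtain j0 where j0: "j0 \<in> S" using assms(2) by blast
    let ?A = "affine hull (P ` S)"
    have PA: "P j \<in> ?A" if "j \<in> S" for j using that by (intro hull_inc imageI)
    have sub: "subspace ((\<lambda>x. x - P j0) ` ?A)"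
      by (rule affine_diffs_subspace_subtract[OF affine_affine_hull PA[OF j0]])
    have "(\<Sum>j\<in>S. u j *\<^sub>R (P j - P j0)) \<in> (\<lambda>x. x - P j0) ` ?A"
      by (intro subspace_sum[OF sub] subspace_scale[OF sub] imageI PA)
    moreover have "(\<Sum>j\<in>S. u j *\<^sub>R (P j - P j0)) = y - P j0"
      using y \<open>1 = sum u S\<close> by (simp add: scaleR_diff_right sum_subtractf scaleR_left.sum[symmetric])
    ultimately show "y \<in> ?A" by auto
  qed
qed

lemma arrangement_A_eq:
  fixes P :: "nat \<Rightarrow> real ^ 'n::{finite,linorder}"
  shows "arrangement_A m P = dehomogenized CARD('n) {1..m} (homogeneous_points P)"
proof -
  have "affine hull (P ` S) = homogenize -` span (homogeneous_points P ` S) \<and> affine hull (P ` S) \<noteq> {}"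
    if "S \<in> k_subsets CARD('n) {1..m}" for S
  proof -
    have "S \<noteq> {}" "finite S" using that finite_subset[of S "{1..m}"] by (auto simp: k_subsets_def)
    then show ?thesis by (intro conjI affine_hull_eq_homogenize) simp_all
  qed
  then have "(\<lambda>S. affine hull (P ` S)) ` k_subsets CARD('n) {1..m} =
      (\<lambda>S. homogenize -` span (homogeneous_points P ` S)) ` k_subsets CARD('n) {1..m}"
    and "{} \<notin> (\<lambda>S. affine hull (P ` S)) ` k_subsets CARD('n) {1..m}"
    by (auto simp del: affine_hull_eq_empty intro!: image_cong)
  then show ?thesis by (simp add: arrangement_A_def dehomogenized_def index_sets_def k_subsets_def)
qed

lemma arrangement_B_eq:
  "(arrangement_B m x :: (real ^ 'n::{finite,linorder}) set set) = dehomogenized CARD('n) {1..m} (matrix_column x)"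
  by (simp add: arrangement_B_def central_arrangement_B_def dehomogenized_def index_sets_def k_subsets_def image_image)

lemma row_number_None: "row_number (None :: 'n::{finite,linorder} option) = 1"
proof -
  have "{s. s \<le> (None :: 'n option)} = {None}" by (auto dest: less_eq_option_None_is_None)
  then show ?thesis by (simp add: row_number_def)
qed

text \<open>For \<open>j \<le> CARD('n)\<close> the nonzero entry of column \<open>j\<close> is in
  row \<open>CARD('n) + 2 - j\<close>, never in the first. These columns span a hyperplane, which
  must be the one at infinity.\<close>

lemma span_columns_infinity:
  fixes x :: "nat \<Rightarrow> nat \<Rightarrow> real"
  assumes "generic (matrix_column x :: nat \<Rightarrow> real ^ ('n::{finite,linorder}) option) J CARD('n)" "{1..CARD('n)} \<subseteq> J"
  shows "span (matrix_column x ` {1..CARD('n)}) = (infinity_hyperplane :: (real ^ ('n::{finite,linorder}) option) set)"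
proof (rule subspace_dim_equal)
  have "(matrix_column x j :: real ^ ('n::{finite,linorder}) option) $ None = 0" if "j \<in> {1..CARD('n)}" for j
  proof -
    have K: "CARD('n option) = Suc CARD('n)" by simp
    have "j \<le> CARD('n option)" "row_number (None :: 'n option) \<noteq> CARD('n option) + 1 - j"
      using that unfolding row_number_None K atLeastAtMost_iff by linarith+
    then show ?thesis by (simp only: matrix_column_def vec_lambda_beta if_True if_False)
  qed
  then show "span (matrix_column x ` {1..CARD('n)}) \<subseteq> (infinity_hyperplane :: (real ^ ('n::{finite,linorder}) option) set)"
    by (intro span_minimal subspace_infinity_hyperplane) blast
  have "dim (span (matrix_column x ` {1..CARD('n)} :: (real ^ ('n::{finite,linorder}) option) set)) = CARD('n)"
    by (rule generic.dim_span_hyperplane[OF assms(1)]) (use assms(2) in \<open>auto simp: k_subsets_def\<close>)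
  moreover have "dim (infinity_hyperplane :: (real ^ ('n::{finite,linorder}) option) set) = CARD('n)"
    unfolding infinity_hyperplane_eq by (subst dim_hyperplane) (auto simp: axis_eq_0_iff)
  ultimately show "dim (infinity_hyperplane :: (real ^ ('n::{finite,linorder}) option) set)
      \<le> dim (span (matrix_column x ` {1..CARD('n)} :: (real ^ ('n::{finite,linorder}) option) set))" by simp
qed (rule subspace_span subspace_infinity_hyperplane)+

lemma degree_sum_graded:
  fixes f :: "nat \<Rightarrow> real poly"
  assumes "1 \<le> d" "\<And>i. i \<le> n \<Longrightarrow> degree (f i) = i * d"
  shows "degree (\<Sum>i\<le>n. f i) = n * d"
  using assms(2)
proof (induction n)
  case (Suc n)
  have "degree (\<Sum>i\<le>n. f i) = n * d" by (rule Suc.IH) (use Suc.prems in simp)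
  moreover have "degree (f (Suc n)) = Suc n * d" by (rule Suc.prems) simp
  ultimately have "degree ((\<Sum>i\<le>n. f i) + f (Suc n)) = Suc n * d"
    using assms(1) by (subst degree_add_eq_right) auto
  then show ?case by simp
qed simp

theorem theorem3p3:
  fixes k :: nat
  assumes "k \<ge> 2"
    and "CARD('n) = k - 1"
  shows
    "(\<forall>i\<le>k - 1. \<exists>p :: real poly. degree p = i * (k - 1) \<and>
        (\<forall>m\<ge>k. \<forall>P :: nat \<Rightarrow> real ^ 'n::{finite,linorder}.
          very_generic homogeneous_points m P \<longrightarrow>
          of_int (betti (arrangement_A m P) i) = poly p (of_nat m))) \<and>
     (\<forall>i\<le>k - 1. \<exists>p :: real poly. degree p = i * (k - 1) \<and>
        (\<forall>m\<ge>k. \<forall>x :: nat \<Rightarrow> nat \<Rightarrow> real.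
          very_generic (matrix_column :: _ \<Rightarrow> _ \<Rightarrow> real ^ 'n option) m x \<longrightarrow>
          of_int (betti (arrangement_B m x :: (real ^ 'n::{finite,linorder}) set set) i) =
            poly p (of_nat m))) \<and>
     (\<exists>p :: real poly. degree p = (k - 1) ^ 2 \<and>
        (\<forall>m\<ge>k. \<forall>P :: nat \<Rightarrow> real ^ 'n::{finite,linorder}.
          very_generic homogeneous_points m P \<longrightarrow>
          of_nat (card (bounded_regions (arrangement_A m P))) = poly p (of_nat m))) \<and>
     (\<exists>p :: real poly. degree p = (k - 1) ^ 2 \<and>
        (\<forall>m\<ge>k. \<forall>x :: nat \<Rightarrow> nat \<Rightarrow> real.
          very_generic (matrix_column :: _ \<Rightarrow> _ \<Rightarrow> real ^ 'n option) m x \<longrightarrow>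
          of_nat (card (bounded_regions (arrangement_B m x :: (real ^ 'n::{finite,linorder}) set set))) =
            poly p (of_nat m)))"
proof -
  let ?d = "CARD('n)"
  have k: "k - 1 = ?d" "1 \<le> ?d" "k = Suc ?d" using assms by auto
  let ?q = "flat_poly ?d TYPE(nat \<Rightarrow> real ^ ('n::{finite,linorder}) option)"
  \<comment> \<open>Division of the characteristic polynomial by \<open>t - 1\<close> turns
    coefficients into partial sums, which govern the family B.\<close>
  let ?Q = "\<lambda>i. \<Sum>j\<le>i. ?q j"
  have q: "degree (?q i) = i * ?d" if "i \<le> ?d" for i by (rule degree_flat_poly[OF that])
  have Q: "degree (?Q i) = i * ?d" if "i \<le> ?d" for i
    by (rule degree_sum_graded) (use q that k in auto)
  have deg: "degree (Polynomial.smult ((-1) ^ i) p) = degree p" for i and p :: "real poly" by simp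
  have A: "generic_affine (homogeneous_points P) {1..m}"
    "\<And>i. i \<le> ?d \<Longrightarrow> of_int (generic_affine.affine_sum (homogeneous_points P) {1..m} i) = poly (?q i) (of_nat m)"
    if "m \<ge> k" "very_generic homogeneous_points m P" for m and P :: "nat \<Rightarrow> real ^ 'n::{finite,linorder}"
  proof -
    have m: "?d < m" using that(1) k(3) by simp
    show g: "generic_affine (homogeneous_points P) {1..m}"
      unfolding generic_affine_def by (rule generic_homogeneous_points[OF that(2) m])
    show "of_int (generic_affine.affine_sum (homogeneous_points P) {1..m} i) = poly (?q i) (of_nat m)"
      if "i \<le> ?d" for i
      using generic_affine.affine_sum_transversal[OF g homogeneous_points_transversal[OF \<open>very_generic _ m P\<close> m] that]
      by simp
  qed
  have B: "generic_affine (matrix_column x :: nat \<Rightarrow> real ^ ('n::{finite,linorder}) option) {1..m}"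
    "\<And>i. of_int (generic_affine.affine_sum (matrix_column x :: nat \<Rightarrow> real ^ ('n::{finite,linorder}) option) {1..m} i) = poly (?Q i) (of_nat m)"
    if "m \<ge> k" "very_generic (matrix_column :: _ \<Rightarrow> _ \<Rightarrow> real ^ 'n option) m x" for m x
  proof -
    have m: "CARD('n option) \<le> m" using that(1) k(3) by simp
    have g: "generic (matrix_column x :: nat \<Rightarrow> real ^ ('n::{finite,linorder}) option) {1..m} ?d"
      by (rule generic_matrix_column[OF that(2) m]) (use k in auto)
    show ga: "generic_affine (matrix_column x :: nat \<Rightarrow> real ^ ('n::{finite,linorder}) option) {1..m}"
      unfolding generic_affine_def by (rule g)
    have "{1..?d} \<in> k_subsets ?d {1..m}" using m by (auto simp: k_subsets_def)
    moreover have "span (matrix_column x ` {1..?d}) = (infinity_hyperplane :: (real ^ ('n::{finite,linorder}) option) set)"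
      by (rule span_columns_infinity[OF g]) (use m in auto)
    ultimately show "of_int (generic_affine.affine_sum (matrix_column x :: nat \<Rightarrow> real ^ ('n::{finite,linorder}) option) {1..m} i) = poly (?Q i) (of_nat m)" for i
      using generic_affine.affine_sum_cone[OF ga, of "{1..?d}" i] by simp
  qed
  show ?thesis
  proof (intro conjI allI impI)
    fix i assume i: "i \<le> k - 1"
    show "\<exists>p :: real poly. degree p = i * (k - 1) \<and> (\<forall>m\<ge>k. \<forall>P :: nat \<Rightarrow> real ^ 'n::{finite,linorder}.
        very_generic homogeneous_points m P \<longrightarrow> of_int (betti (arrangement_A m P) i) = poly p (of_nat m))"
    proof (intro exI conjI allI impI)
      show "degree (Polynomial.smult ((-1) ^ i) (?q i)) = i * (k - 1)" using q i k by simp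
      fix m and P :: "nat \<Rightarrow> real ^ 'n::{finite,linorder}"
      assume m: "k \<le> m" "very_generic homogeneous_points m P"
      show "of_int (betti (arrangement_A m P) i) = poly (Polynomial.smult ((-1) ^ i) (?q i)) (of_nat m)"
        unfolding arrangement_A_eq using generic_affine.betti_dehomogenized[OF A(1)[OF m], of i] A(2)[OF m, of i] i k
        by simp
    qed
    show "\<exists>p :: real poly. degree p = i * (k - 1) \<and> (\<forall>m\<ge>k. \<forall>x :: nat \<Rightarrow> nat \<Rightarrow> real.
        very_generic (matrix_column :: _ \<Rightarrow> _ \<Rightarrow> real ^ 'n option) m x \<longrightarrow>
        of_int (betti (arrangement_B m x :: (real ^ 'n::{finite,linorder}) set set) i) = poly p (of_nat m))"
    proof (intro exI conjI allI impI)
      show "degree (Polynomial.smult ((-1) ^ i) (?Q i)) = i * (k - 1)" unfolding deg using Q[of i] i k by simp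
      fix m and x :: "nat \<Rightarrow> nat \<Rightarrow> real"
      assume m: "k \<le> m" "very_generic (matrix_column :: _ \<Rightarrow> _ \<Rightarrow> real ^ 'n option) m x"
      show "of_int (betti (arrangement_B m x :: (real ^ 'n::{finite,linorder}) set set) i) =
          poly (Polynomial.smult ((-1) ^ i) (?Q i)) (of_nat m)"
        unfolding arrangement_B_eq using generic_affine.betti_dehomogenized[OF B(1)[OF m], of i] B(2)[OF m, of i] i k
        by simp
    qed
  next
    show "\<exists>p :: real poly. degree p = (k - 1) ^ 2 \<and> (\<forall>m\<ge>k. \<forall>P :: nat \<Rightarrow> real ^ 'n::{finite,linorder}.
        very_generic homogeneous_points m P \<longrightarrow>
        of_nat (card (bounded_regions (arrangement_A m P))) = poly p (of_nat m))"
    proof (intro exI conjI allI impI)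
      \<comment> \<open>The term with \<open>i = ?d\<close> dominates and has degree
        \<open>?d * ?d\<close>.\<close>
      have "degree (\<Sum>i\<le>?d. ?q i) = ?d * ?d" by (rule degree_sum_graded[OF k(2) q])
      then show "degree (Polynomial.smult ((-1) ^ ?d) (\<Sum>i\<le>?d. ?q i)) = (k - 1) ^ 2"
        unfolding deg k(1) by (simp add: power2_eq_square)
      fix m and P :: "nat \<Rightarrow> real ^ 'n::{finite,linorder}"
      assume m: "k \<le> m" "very_generic homogeneous_points m P"
      have "of_nat (card (bounded_regions (arrangement_A m P))) =
          real_of_int ((-1) ^ ?d * (\<Sum>i\<le>?d. generic_affine.affine_sum (homogeneous_points P) {1..m} i))"
        unfolding arrangement_A_eq generic_affine.bounded_regions_dehomogenized[OF A(1)[OF m], symmetric] by simp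
      also have "\<dots> = (-1) ^ ?d * (\<Sum>i\<le>?d. poly (?q i) (of_nat m))" using A(2)[OF m] by simp
      finally show "of_nat (card (bounded_regions (arrangement_A m P))) =
          poly (Polynomial.smult ((-1) ^ ?d) (\<Sum>i\<le>?d. ?q i)) (of_nat m)" by (simp add: poly_sum)
    qed
    show "\<exists>p :: real poly. degree p = (k - 1) ^ 2 \<and> (\<forall>m\<ge>k. \<forall>x :: nat \<Rightarrow> nat \<Rightarrow> real.
        very_generic (matrix_column :: _ \<Rightarrow> _ \<Rightarrow> real ^ 'n option) m x \<longrightarrow>
        of_nat (card (bounded_regions (arrangement_B m x :: (real ^ 'n::{finite,linorder}) set set))) = poly p (of_nat m))"
    proof (intro exI conjI allI impI)
      have "degree (\<Sum>i\<le>?d. ?Q i) = ?d * ?d" by (rule degree_sum_graded[OF k(2) Q])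
      then show "degree (Polynomial.smult ((-1) ^ ?d) (\<Sum>i\<le>?d. ?Q i)) = (k - 1) ^ 2"
        unfolding deg k(1) by (simp add: power2_eq_square)
      fix m and x :: "nat \<Rightarrow> nat \<Rightarrow> real"
      assume m: "k \<le> m" "very_generic (matrix_column :: _ \<Rightarrow> _ \<Rightarrow> real ^ 'n option) m x"
      have "of_nat (card (bounded_regions (arrangement_B m x :: (real ^ 'n::{finite,linorder}) set set))) =
          real_of_int ((-1) ^ ?d * (\<Sum>i\<le>?d. generic_affine.affine_sum (matrix_column x :: nat \<Rightarrow> real ^ ('n::{finite,linorder}) option) {1..m} i))"
        unfolding arrangement_B_eq generic_affine.bounded_regions_dehomogenized[OF B(1)[OF m], symmetric] by simp
      also have "\<dots> = (-1) ^ ?d * (\<Sum>i\<le>?d. poly (?Q i) (of_nat m))" using B(2)[OF m] by simp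
      finally show "of_nat (card (bounded_regions (arrangement_B m x :: (real ^ 'n::{finite,linorder}) set set))) =
          poly (Polynomial.smult ((-1) ^ ?d) (\<Sum>i\<le>?d. ?Q i)) (of_nat m)" by (simp add: poly_sum)
    qed
  qed
qed

end
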